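(* Let $\mathcal{H}$ be a boolean representable simplicial complex of dimension $2$. Then: (i) the homology groups of $\mathcal{H}$ are free abelian; (ii) $\mathcal{H}$ (i.e. its geometric realization) has the homotopy type of a wedge of $1$-spheres and $2$-spheres.
   Context: A (finite) simplicial complex is a pair $\mathcal{H}=(V,H)$ where $V$ is a finite nonempty set and $H\subseteq 2^V$ contains all singletons and is closed under taking subsets; the dimension of a face $I$ is $|I|-1$ and $\dim\mathcal{H}$ is the maximum dimension of a face. A boolean matrix (entries $0,1$) with row set $R$ and column set $V$ is nonsingular if, after independently permuting rows and columns, it is a square lower unitriangular matrix. A set $X\subseteq V$ of columns of an $R\times V$ boolean matrix $M$ is $M$-independent if there is $Y\subseteq R$ such that the submatrix $M[Y,X]$ is nonsingular. $\mathcal{H}$ is boolean representable if there is a boolean matrix $M$ such that $H$ is exactly the set of $M$-independent subsets of $V$. *)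

theory Defs
  imports "HOL-Homology.Homology"
begin

section \<open>Simplicial complexes and boolean representability\<close>

definition abstract_simplicial_complex :: "'a set \<Rightarrow> 'a set set \<Rightarrow> bool" where
  "abstract_simplicial_complex V H \<longleftrightarrow>
     finite V \<and> V \<noteq> {} \<and> H \<subseteq> Pow V \<and> (\<forall>v\<in>V. {v} \<in> H) \<and> (\<forall>I\<in>H. \<forall>J. J \<subseteq> I \<longrightarrow> J \<in> H)"

definition complex_dim :: "'a set set \<Rightarrow> int" where
  "complex_dim H = Max ((\<lambda>I. int (card I) - 1) ` H)"

text \<open>A boolean matrix is a function of type \<^typ>\<open>'r \<Rightarrow> 'c \<Rightarrow> bool\<close>, with \<^const>\<open>True\<close> for the
  entry 1.  The bijections \<open>f\<close> and \<open>g\<close> are the rearrangements of the rows \<open>Y\<close> and of the columns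
  \<open>X\<close> that bring the submatrix \<open>M[Y,X]\<close> into lower unitriangular form.  The empty matrix is
  nonsingular.\<close>

definition boolean_nonsingular :: "('r \<Rightarrow> 'c \<Rightarrow> bool) \<Rightarrow> 'r set \<Rightarrow> 'c set \<Rightarrow> bool" where
  "boolean_nonsingular M Y X \<longleftrightarrow>
     (\<exists>(n::nat) f g. bij_betw f {..<n} Y \<and> bij_betw g {..<n} X \<and>
        (\<forall>i<n. M (f i) (g i)) \<and> (\<forall>i j. i < j \<and> j < n \<longrightarrow> \<not> M (f i) (g j)))"

definition M_independent :: "('r \<Rightarrow> 'c \<Rightarrow> bool) \<Rightarrow> 'r set \<Rightarrow> 'c set \<Rightarrow> bool" where
  "M_independent M R X \<longleftrightarrow> (\<exists>Y\<subseteq>R. boolean_nonsingular M Y X)"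

text \<open>A matrix has finitely many rows, so indexing them by natural numbers loses nothing.\<close>

definition boolean_representable :: "'a set \<Rightarrow> 'a set set \<Rightarrow> bool" where
  "boolean_representable V H \<longleftrightarrow>
     (\<exists>(R :: nat set) M. finite R \<and> H = {X. X \<subseteq> V \<and> M_independent M R X})"


section \<open>Simplicial homology\<close>

text \<open>Integral (unreduced) simplicial homology.  Faces are oriented by a total order \<open>r\<close> on the
  vertices: for \<open>v\<^sub>0 < \<dots> < v\<^sub>k\<close> the summand \<open>I - {v\<^sub>i}\<close> of the boundary of the face
  \<open>I = {v\<^sub>0, \<dots>, v\<^sub>k}\<close> has sign \<open>(-1)\<^sup>i\<close>, where \<open>i\<close> is the number of vertices of \<open>I\<close> strictly
  below \<open>v\<^sub>i\<close>.\<close>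

definition simplicial_chain_group :: "'a set set \<Rightarrow> nat \<Rightarrow> ('a set \<Rightarrow>\<^sub>0 int) monoid" where
  "simplicial_chain_group H k = free_Abelian_group {I \<in> H. card I = k + 1}"

definition face_boundary :: "'a rel \<Rightarrow> 'a set \<Rightarrow> 'a set \<Rightarrow>\<^sub>0 int" where
  "face_boundary r I =
     (\<Sum>v\<in>I. frag_cmul ((-1) ^ card {u \<in> I. u \<noteq> v \<and> (u, v) \<in> r}) (frag_of (I - {v})))"

definition simplicial_boundary :: "'a rel \<Rightarrow> nat \<Rightarrow> ('a set \<Rightarrow>\<^sub>0 int) \<Rightarrow> 'a set \<Rightarrow>\<^sub>0 int" where
  "simplicial_boundary r k c = (if k = 0 then 0 else frag_extend (face_boundary r) c)"

definition simplicial_cycles :: "'a rel \<Rightarrow> 'a set set \<Rightarrow> nat \<Rightarrow> ('a set \<Rightarrow>\<^sub>0 int) set" where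
  "simplicial_cycles r H k = {c \<in> carrier (simplicial_chain_group H k). simplicial_boundary r k c = 0}"

definition simplicial_boundaries :: "'a rel \<Rightarrow> 'a set set \<Rightarrow> nat \<Rightarrow> ('a set \<Rightarrow>\<^sub>0 int) set" where
  "simplicial_boundaries r H k =
     simplicial_boundary r (k + 1) ` carrier (simplicial_chain_group H (k + 1))"

definition simplicial_homology_group ::
  "'a rel \<Rightarrow> 'a set set \<Rightarrow> nat \<Rightarrow> ('a set \<Rightarrow>\<^sub>0 int) set monoid" where
  "simplicial_homology_group r H k =
     subgroup_generated (simplicial_chain_group H k) (simplicial_cycles r H k)
       Mod simplicial_boundaries r H k"

text \<open>A basis of a free abelian group is a subset of its carrier, so taking the index set of the
  basis in the type of the group elements is no restriction.\<close>

definition free_abelian :: "('a, 'm) monoid_scheme \<Rightarrow> bool" where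
  "free_abelian G \<longleftrightarrow> (\<exists>S :: 'a set. G \<cong> free_Abelian_group S)"


section \<open>Geometric realization\<close>

text \<open>Points are given by barycentric coordinates: nonnegative functions of sum 1 whose support is
  a face.\<close>

definition geometric_realization :: "'a set \<Rightarrow> 'a set set \<Rightarrow> ('a \<Rightarrow> real) topology" where
  "geometric_realization V H =
     subtopology (powertop_real UNIV)
       {t. (\<forall>v. 0 \<le> t v) \<and> {v. t v \<noteq> 0} \<in> H \<and> (\<Sum>v\<in>V. t v) = 1}"


section \<open>Wedge sums\<close>

text \<open>The wedge of the pointed spaces \<open>(X i, b i)\<close> is the quotient of their disjoint union that
  identifies all base points; \<^const>\<open>None\<close> is the resulting common base point.  It is present
  even when \<open>I\<close> is empty, so that the empty wedge is a point.\<close>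

definition wedge_map :: "('i \<Rightarrow> 'b) \<Rightarrow> 'i \<times> 'b \<Rightarrow> ('i \<times> 'b) option" where
  "wedge_map b z = (if snd z = b (fst z) then None else Some z)"

definition wedge :: "('i \<Rightarrow> 'b topology) \<Rightarrow> ('i \<Rightarrow> 'b) \<Rightarrow> 'i set \<Rightarrow> ('i \<times> 'b) option topology" where
  "wedge X b I =
     topology (\<lambda>U. U \<subseteq> insert None (wedge_map b ` topspace (sum_topology X I)) \<and>
       openin (sum_topology X I) {z \<in> topspace (sum_topology X I). wedge_map b z \<in> U})"

lemma openin_wedge:
  "openin (wedge X b I) U \<longleftrightarrow>
     U \<subseteq> insert None (wedge_map b ` topspace (sum_topology X I)) \<and>
     openin (sum_topology X I) {z \<in> topspace (sum_topology X I). wedge_map b z \<in> U}"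
proof -
  let ?T = "topspace (sum_topology X I)"
  let ?L = "\<lambda>U. U \<subseteq> insert None (wedge_map b ` ?T) \<and>
       openin (sum_topology X I) {z \<in> ?T. wedge_map b z \<in> U}"
  have 1: "{z \<in> ?T. wedge_map b z \<in> S \<inter> S'}
      = {z \<in> ?T. wedge_map b z \<in> S} \<inter> {z \<in> ?T. wedge_map b z \<in> S'}" for S S'
    by auto
  have 2: "{z \<in> ?T. wedge_map b z \<in> \<Union>K} = (\<Union>S\<in>K. {z \<in> ?T. wedge_map b z \<in> S})" for K
    by auto
  have "istopology ?L"
    unfolding istopology_def 1 2 by (blast intro: openin_Int openin_Union)
  then show ?thesis
    by (simp add: wedge_def topology_inverse')
qed

lemma topspace_wedge:
  "topspace (wedge X b I) = insert None (wedge_map b ` topspace (sum_topology X I))"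
    (is "_ = ?W")
proof -
  have "{z \<in> topspace (sum_topology X I). wedge_map b z \<in> ?W} = topspace (sum_topology X I)"
    by auto
  then have "openin (wedge X b I) ?W"
    unfolding openin_wedge by (metis openin_topspace order_refl)
  then show ?thesis
    by (meson openin_subset openin_topspace openin_wedge subset_antisym)
qed

lemma quotient_map_wedge:
  assumes "I \<noteq> {}" and "\<And>i. i \<in> I \<Longrightarrow> b i \<in> topspace (X i)"
  shows "quotient_map (sum_topology X I) (wedge X b I) (wedge_map b)"
proof -
  from assms obtain i where "(i, b i) \<in> topspace (sum_topology X I)"
    by (force simp: topspace_sum_topology)
  then have "None \<in> wedge_map b ` topspace (sum_topology X I)"
    by (force simp: wedge_map_def)
  then show ?thesis
    unfolding quotient_map_def openin_wedge topspace_wedge by (auto simp: insert_absorb)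
qed

text \<open>The point \<open>(1, 0, 0, \<dots>)\<close> lies on \<^term>\<open>nsphere d\<close> for every \<open>d\<close>.\<close>

definition sphere_basepoint :: "nat \<Rightarrow> real" where
  "sphere_basepoint i = (if i = 0 then 1 else 0)"

text \<open>A wedge of \<open>N\<close> spheres of dimensions \<open>d 0, \<dots>, d (N - 1)\<close>.\<close>

definition wedge_of_spheres :: "nat \<Rightarrow> (nat \<Rightarrow> nat) \<Rightarrow> (nat \<times> (nat \<Rightarrow> real)) option topology" where
  "wedge_of_spheres N d = wedge (\<lambda>i. nsphere (d i)) (\<lambda>_. sphere_basepoint) {..<N}"

end

theory Submission
  imports Defs "HOL-Analysis.Analysis"
begin

text \<open>
  Call two vertices twins if their columns in the matrix agree; distinct vertices span an edge iff they
  are not twins.  Among representatives of the twin classes call \<open>a\<close>, \<open>b\<close> collinear if both lie in the zero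
  set of some row that is not identically zero.  In dimension 2 a triple of representatives is a face iff it
  contains a collinear pair but is not contained in one such zero set.  The complex can therefore be built
  from a point by elementary expansions and by attaching edges and triangles whose boundary lies in a
  collapsible subcomplex: start with the star of a vertex \<open>o'\<close>, add every edge not joining two collinearity
  components that avoid \<open>o'\<close> by an expansion, add one edge for every pair of such components, slide it
  along spanning trees to obtain the remaining edges, and fill in the remaining triangles.  A further twin
  of a vertex \<open>a\<close> is added as a second cone over the link of \<open>a\<close>.  An expansion is a homotopy
  equivalence, and attaching a \<open>d\<close>-simplex along a null-homotopic boundary adds a wedge summand, a
  \<open>d\<close>-sphere, because the homotopy type of a mapping cone depends only on the homotopy class of the
  attaching map.  On homology an expansion changes nothing, and an attachment adds one free generator.
\<close>

section \<open>Mapping cones\<close>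

text \<open>A 2-dimensional complex with free homology need not be a wedge of spheres, since its
  fundamental group can be almost anything. So every attached simplex has to come with a visible
  reason why its attaching map is null-homotopic. A collapsible subcomplex through the boundary is
  such a reason, and it is a finite certificate that works on realizations and on chains alike;
  hence one inductive predicate, \<open>buildable\<close>, serves both claims. The combinatorics
  rests on one observation: two distinct representatives are always independent, so three of them
  are independent iff some row vanishes on exactly two of them. If a row makes \<open>a\<close>,
  \<open>b\<close> collinear and \<open>a\<close>, \<open>c\<close> are not collinear, that row must
  be 1 at \<open>c\<close>, and the triple is a face for free. This is what lets an edge ending at
  \<open>a\<close> slide to \<open>b\<close>. Where two components both avoid \<open>o'\<close>, no
  triangle with \<open>o'\<close> can contain a collinear pair, so nothing fills the first edge
  between them: these are the unavoidable 1-spheres. The order of the individual expansions is never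
  tracked; maximal subcomplexes are used, whose closure properties say that no expansion or filling
  is left.\<close>

abbreviation unit_interval :: "real topology" where
  "unit_interval \<equiv> top_of_set {0..1}"

text \<open>Retracts the line onto the unit interval, so that a map on \<open>unit_interval\<close>
  can be fed any real-valued parameter inside a case distinction without range conditions.\<close>

definition clamp01 :: "real \<Rightarrow> real" where
  "clamp01 u = max 0 (min 1 u)"

lemma clamp01 [simp]: "0 \<le> clamp01 u" "clamp01 u \<le> 1"
  by (auto simp: clamp01_def)

lemma continuous_map_clamp01:
  assumes "continuous_map X euclideanreal f"
  shows "continuous_map X unit_interval (\<lambda>x. clamp01 (f x))"
  using assms unfolding clamp01_def
  by (auto simp: continuous_map_in_subtopology continuous_map_real_max continuous_map_real_min)

text \<open>Pasting along two closed maps, neither of them assumed injective: the preimage of a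
  closed set under \<open>g\<close> is the union of the images of its closed preimages
  upstairs.\<close>

lemma continuous_map_closed_cover:
  assumes f: "closed_map X Y f" "continuous_map X Z (g \<circ> f)"
    and h: "closed_map W Y h" "continuous_map W Z (g \<circ> h)"
    and cover: "topspace Y = f ` topspace X \<union> h ` topspace W"
  shows "continuous_map Y Z g"
  unfolding continuous_map_closedin
proof (intro conjI allI impI)
  show "g \<in> topspace Y \<rightarrow> topspace Z"
    using assms by (auto simp: continuous_map_def)
next
  fix C assume "closedin Z C"
  then have "closedin X {x \<in> topspace X. (g \<circ> f) x \<in> C}" "closedin W {x \<in> topspace W. (g \<circ> h) x \<in> C}"
    using f h by (auto simp: continuous_map_closedin)
  then have "closedin Y (f ` {x \<in> topspace X. (g \<circ> f) x \<in> C} \<union> h ` {x \<in> topspace W. (g \<circ> h) x \<in> C})"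
    using f h by (auto simp: closed_map_def)
  moreover have "f ` {x \<in> topspace X. (g \<circ> f) x \<in> C} \<union> h ` {x \<in> topspace W. (g \<circ> h) x \<in> C}
      = {y \<in> topspace Y. g y \<in> C}"
    using cover by auto
  ultimately show "closedin Y {y \<in> topspace Y. g y \<in> C}"
    by simp
qed

text \<open>The parameter 0 is the base of the cone and 1 its apex.  Properness of the two structure maps is what
  makes maps and homotopies descend to \<open>X'\<close>, since it survives taking products with a parameter space.\<close>

locale mapping_cone =
  fixes X :: "'x topology" and B :: "'b topology" and \<phi> :: "'b \<Rightarrow> 'x"
    and X' :: "'y topology" and i :: "'x \<Rightarrow> 'y" and q :: "real \<times> 'b \<Rightarrow> 'y"
  assumes cont_i: "continuous_map X X' i" and proper_i: "proper_map X X' i"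
    and inj_i: "inj_on i (topspace X)"
    and cont_q: "continuous_map (prod_topology unit_interval B) X' q"
    and proper_q: "proper_map (prod_topology unit_interval B) X' q"
    and cover: "topspace X' = i ` topspace X \<union> q ` ({0..1} \<times> topspace B)"
    and cont_\<phi>: "continuous_map B X \<phi>"
    and q0: "\<And>b. b \<in> topspace B \<Longrightarrow> q (0, b) = i (\<phi> b)"
    and q1: "\<And>b b'. b \<in> topspace B \<Longrightarrow> b' \<in> topspace B \<Longrightarrow> q (1, b) = q (1, b')"
    and q_inj: "\<And>s b s' b'. \<lbrakk>0 < s; s < 1; 0 < s'; s' \<le> 1; b \<in> topspace B; b' \<in> topspace B;
        q (s, b) = q (s', b')\<rbrakk> \<Longrightarrow> s = s' \<and> b = b'"
    and q_disjoint: "\<And>s b x. \<lbrakk>0 < s; s \<le> 1; b \<in> topspace B; x \<in> topspace X\<rbrakk> \<Longrightarrow> q (s, b) \<noteq> i x"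
begin

lemma descend_param:
  fixes P :: "'p topology" and Z :: "'z topology"
  assumes f: "continuous_map (prod_topology P X) Z f"
    and F: "continuous_map (prod_topology P (prod_topology unit_interval B)) Z F"
    and F0: "\<And>t b. t \<in> topspace P \<Longrightarrow> b \<in> topspace B \<Longrightarrow> F (t, 0, b) = f (t, \<phi> b)"
    and F1: "\<And>t b b'. t \<in> topspace P \<Longrightarrow> b \<in> topspace B \<Longrightarrow> b' \<in> topspace B \<Longrightarrow> F (t, 1, b) = F (t, 1, b')"
  obtains g where "continuous_map (prod_topology P X') Z g"
    "\<And>t x. t \<in> topspace P \<Longrightarrow> x \<in> topspace X \<Longrightarrow> g (t, i x) = f (t, x)"
    "\<And>t s b. \<lbrakk>t \<in> topspace P; 0 \<le> s; s \<le> 1; b \<in> topspace B\<rbrakk> \<Longrightarrow> g (t, q (s, b)) = F (t, s, b)"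
proof -
  define c where "c y = (SOME z. z \<in> {0..1} \<times> topspace B \<and> q z = y)" for y
  define g where "g = (\<lambda>(t, y). if y \<in> i ` topspace X then f (t, inv_into (topspace X) i y) else F (t, c y))"
  have gi: "g (t, i x) = f (t, x)" if "x \<in> topspace X" for t x
    using that inj_i by (simp add: g_def)
  have gq: "g (t, q (s, b)) = F (t, s, b)" if t: "t \<in> topspace P" and s: "0 \<le> s" "s \<le> 1" and b: "b \<in> topspace B" for t s b
  proof (cases "s = 0")
    case True
    then show ?thesis
      using F0[OF t b] q0[OF b] gi[of "\<phi> b" t] cont_\<phi> b by (auto simp: continuous_map_def)
  next
    case False
    with s b have ni: "q (s, b) \<notin> i ` topspace X"
      using q_disjoint[of s b] by auto
    have "\<exists>z. z \<in> {0..1} \<times> topspace B \<and> q z = q (s, b)"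
      using s b by auto
    then have c: "c (q (s, b)) \<in> {0..1} \<times> topspace B" "q (c (q (s, b))) = q (s, b)"
      unfolding c_def by (metis (mono_tags, lifting) someI_ex)+
    obtain s' b' where c': "c (q (s, b)) = (s', b')" by fastforce
    have s'b': "0 \<le> s'" "s' \<le> 1" "b' \<in> topspace B" "q (s', b') = q (s, b)"
      using c c' by auto
    have "\<phi> b' \<in> topspace X"
      using s'b'(3) cont_\<phi> by (auto simp: continuous_map_def)
    then have "i (\<phi> b') \<noteq> q (s, b)"
      using ni by (metis imageI)
    then have "s' \<noteq> 0"
      using s'b' q0[of b'] by auto
    \<comment> \<open>\<open>q_inj\<close> wants its first parameter below 1, so it is tried in both
      orders; what remains is \<open>s = s' = 1\<close>, the apex, where \<open>F1\<close> makes the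
      choice of the preimage harmless.\<close>
    then have "F (t, s', b') = F (t, s, b)"
      using q_inj[of s s' b b'] q_inj[of s' s b' b] s s'b' False b F1[OF t, of b b']
      by (metis less_eq_real_def)
    then show ?thesis
      using ni c' by (simp add: g_def)
  qed
  have top: "topspace (prod_topology P X') = (\<lambda>(t,x). (t, i x)) ` topspace (prod_topology P X)
      \<union> (\<lambda>(t,z). (t, q z)) ` topspace (prod_topology P (prod_topology unit_interval B))"
    using cover by (auto simp: image_iff)
  have "continuous_map (prod_topology P X') Z g"
  proof (rule continuous_map_closed_cover[OF _ _ _ _ top])
    have id: "proper_map P P (\<lambda>x. x)"
      using proper_map_id[of P] by (simp add: id_def)
    show "closed_map (prod_topology P X) (prod_topology P X') (\<lambda>(t,x). (t, i x))"
      by (intro proper_imp_closed_map) (use id proper_i in \<open>simp add: proper_map_prod\<close>)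
    show "closed_map (prod_topology P (prod_topology unit_interval B)) (prod_topology P X') (\<lambda>(t,z). (t, q z))"
      by (intro proper_imp_closed_map) (use id proper_q in \<open>simp add: proper_map_prod\<close>)
    show "continuous_map (prod_topology P X) Z (g \<circ> (\<lambda>(t, x). (t, i x)))"
      by (rule continuous_map_eq[OF f]) (auto simp: gi)
    show "continuous_map (prod_topology P (prod_topology unit_interval B)) Z (g \<circ> (\<lambda>(t, z). (t, q z)))"
      by (rule continuous_map_eq[OF F]) (auto simp: gq)
  qed
  then show thesis
    using that gi gq by auto
qed

lemma descend:
  fixes Z :: "'z topology"
  assumes f: "continuous_map X Z f"
    and F: "continuous_map (prod_topology unit_interval B) Z F"
    and F0: "\<And>b. b \<in> topspace B \<Longrightarrow> F (0, b) = f (\<phi> b)"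
    and F1: "\<And>b b'. b \<in> topspace B \<Longrightarrow> b' \<in> topspace B \<Longrightarrow> F (1, b) = F (1, b')"
  obtains g where "continuous_map X' Z g"
    "\<And>x. x \<in> topspace X \<Longrightarrow> g (i x) = f x"
    "\<And>s b. \<lbrakk>0 \<le> s; s \<le> 1; b \<in> topspace B\<rbrakk> \<Longrightarrow> g (q (s, b)) = F (s, b)"
proof -
  let ?P = "discrete_topology {()}"
  have "continuous_map (prod_topology ?P X) Z (f \<circ> snd)"
    using f continuous_map_compose continuous_map_snd by blast
  moreover have "continuous_map (prod_topology ?P (prod_topology unit_interval B)) Z (F \<circ> snd)"
    using F continuous_map_compose continuous_map_snd by blast
  ultimately obtain g where g: "continuous_map (prod_topology ?P X') Z g"
    "\<And>t x. t \<in> topspace ?P \<Longrightarrow> x \<in> topspace X \<Longrightarrow> g (t, i x) = (f \<circ> snd) (t, x)"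
    "\<And>t s b. \<lbrakk>t \<in> topspace ?P; 0 \<le> s; s \<le> 1; b \<in> topspace B\<rbrakk> \<Longrightarrow> g (t, q (s, b)) = (F \<circ> snd) (t, s, b)"
    by (rule descend_param) (auto simp: F0 intro: F1)
  have "continuous_map X' Z (g \<circ> (\<lambda>y. ((), y)))"
    by (rule continuous_map_compose[OF _ g(1)]) (simp add: continuous_map_pairwise o_def)
  then show thesis
    by (rule that) (auto simp: g)
qed

end

text \<open>The classical map of mapping cones induced by a square that commutes up to the homotopy
  \<open>G\<close>. The formula on the cone is kept, not just the existence of \<open>e\<close>,
  because composites of two such maps have to be computed.\<close>

definition cone_extension ::
    "'x topology \<Rightarrow> 'b topology \<Rightarrow> ('b \<Rightarrow> 'x) \<Rightarrow> 'u topology \<Rightarrow> ('x \<Rightarrow> 'u) \<Rightarrow> (real \<times> 'b \<Rightarrow> 'u)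
     \<Rightarrow> 'y topology \<Rightarrow> ('b \<Rightarrow> 'y) \<Rightarrow> 'v topology \<Rightarrow> ('y \<Rightarrow> 'v) \<Rightarrow> (real \<times> 'b \<Rightarrow> 'v)
     \<Rightarrow> ('x \<Rightarrow> 'y) \<Rightarrow> (real \<times> 'b \<Rightarrow> 'y) \<Rightarrow> ('u \<Rightarrow> 'v) \<Rightarrow> bool" where
  "cone_extension X B \<phi> X' i q Y \<psi> Y' j p h G e \<longleftrightarrow>
     continuous_map (prod_topology unit_interval B) Y G \<and>
     (\<forall>b\<in>topspace B. G (0, b) = h (\<phi> b) \<and> G (1, b) = \<psi> b) \<and>
     continuous_map X' Y' e \<and> (\<forall>x\<in>topspace X. e (i x) = j (h x)) \<and>
     (\<forall>s\<in>{0..1}. \<forall>b\<in>topspace B. e (q (s, b)) = (if s \<le> 1/2 then j (G (2 * s, b)) else p (2 * s - 1, b)))"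

lemma continuous_map_clamped:
  assumes "continuous_map (prod_topology unit_interval B) Z G"
    and "continuous_map W euclideanreal u" and "continuous_map W B v"
  shows "continuous_map W Z (\<lambda>w. G (clamp01 (u w), v w))"
proof -
  have "continuous_map W (prod_topology unit_interval B) (\<lambda>w. (clamp01 (u w), v w))"
    using assms by (simp add: continuous_map_pairwise o_def continuous_map_clamp01)
  from continuous_map_compose[OF this assms(1)] show ?thesis
    by (simp add: o_def)
qed

lemma continuous_map_compose_app:
  assumes "continuous_map Y Z f" and "continuous_map X Y g"
  shows "continuous_map X Z (\<lambda>x. f (g x))"
  using continuous_map_compose[OF assms(2,1)] by (simp add: o_def)

lemma continuous_map_interval_fst:
  "continuous_map (prod_topology (top_of_set S) B) euclideanreal fst"
  by (metis continuous_map_fst continuous_map_in_subtopology)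

lemma cone_extension_exists:
  assumes "mapping_cone X B \<phi> X' i q" and "mapping_cone Y B \<psi> Y' j p"
    and h: "continuous_map X Y h"
    and G: "continuous_map (prod_topology unit_interval B) Y G"
    and G01: "\<And>b. b \<in> topspace B \<Longrightarrow> G (0, b) = h (\<phi> b)" "\<And>b. b \<in> topspace B \<Longrightarrow> G (1, b) = \<psi> b"
  obtains e where "cone_extension X B \<phi> X' i q Y \<psi> Y' j p h G e"
proof -
  interpret S: mapping_cone X B \<phi> X' i q by fact
  interpret T: mapping_cone Y B \<psi> Y' j p by fact
  let ?IB = "prod_topology unit_interval B"
  define F where "F = (\<lambda>z. if fst z \<le> 1/2 then j (G (clamp01 (2 * fst z), snd z))
      else p (clamp01 (2 * fst z - 1), snd z))"
  note [continuous_intros] = continuous_map_interval_fst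
  have "continuous_map ?IB Y' F"
    unfolding F_def
  proof (rule continuous_map_cases_le)
    show "continuous_map ?IB euclideanreal fst" "continuous_map ?IB euclideanreal (\<lambda>z. 1/2)"
      by (simp_all add: continuous_map_interval_fst)
    have c: "continuous_map ?IB euclideanreal (\<lambda>z. 2 * fst z)" "continuous_map ?IB euclideanreal (\<lambda>z. 2 * fst z - 1)"
      by (intro continuous_intros | simp)+
    show "continuous_map (subtopology ?IB {x \<in> topspace ?IB. fst x \<le> 1/2}) Y' (\<lambda>z. j (G (clamp01 (2 * fst z), snd z)))"
      by (intro continuous_map_from_subtopology continuous_map_compose_app[OF T.cont_i]
          continuous_map_clamped[OF G] c continuous_map_snd)
    show "continuous_map (subtopology ?IB {x \<in> topspace ?IB. 1/2 \<le> fst x}) Y' (\<lambda>z. p (clamp01 (2 * fst z - 1), snd z))"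
      by (intro continuous_map_from_subtopology continuous_map_clamped[OF T.cont_q] c continuous_map_snd)
  qed (auto simp: clamp01_def G01 T.q0)
  note cF = this
  have cj: "continuous_map X Y' (\<lambda>x. j (h x))"
    using T.cont_i h by (rule continuous_map_compose_app)
  obtain e where "continuous_map X' Y' e" "\<And>x. x \<in> topspace X \<Longrightarrow> e (i x) = j (h x)"
    "\<And>s b. \<lbrakk>0 \<le> s; s \<le> 1; b \<in> topspace B\<rbrakk> \<Longrightarrow> e (q (s, b)) = F (s, b)"
    by (rule S.descend[OF cj cF]) (auto simp: F_def clamp01_def G01 intro: T.q1)
  then have "cone_extension X B \<phi> X' i q Y \<psi> Y' j p h G e"
    unfolding cone_extension_def by (auto simp: G G01 F_def clamp01_def)
  then show thesis by (rule that)
qed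

text \<open>The attaching homotopy of the inverse is \<open>k\<close> applied to \<open>G\<close>
  run backwards, followed by \<open>J\<close> along \<phi>. In the composite the excursion along
  \<open>G\<close> is then retraced and can be shrunk, while \<open>J\<close> deforms the
  base.\<close>

lemma cone_extension_left_inverse:
  assumes mX: "mapping_cone X B \<phi> X' i q" and mY: "mapping_cone Y B \<psi> Y' j p"
    and e: "cone_extension X B \<phi> X' i q Y \<psi> Y' j p h G e"
    and h: "continuous_map X Y h" and k: "continuous_map Y X k"
    and kh: "homotopic_with (\<lambda>x. True) X X (k \<circ> h) id"
  obtains G' e' where "cone_extension Y B \<psi> Y' j p X \<phi> X' i q k G' e'"
    "homotopic_with (\<lambda>x. True) X' X' (e' \<circ> e) id"
proof -
  interpret S: mapping_cone X B \<phi> X' i q by fact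
  interpret T: mapping_cone Y B \<psi> Y' j p by fact
  let ?IB = "prod_topology unit_interval B"
  obtain J where J: "continuous_map (prod_topology unit_interval X) X J"
    and J0: "\<And>x. J (0, x) = k (h x)" and J1: "\<And>x. J (1, x) = x"
    using kh by (auto simp: homotopic_with_def)
  have G: "continuous_map ?IB Y G" and G0: "\<And>b. b \<in> topspace B \<Longrightarrow> G (0, b) = h (\<phi> b)"
    and G1: "\<And>b. b \<in> topspace B \<Longrightarrow> G (1, b) = \<psi> b"
    and ce: "continuous_map X' Y' e" and ei: "\<And>x. x \<in> topspace X \<Longrightarrow> e (i x) = j (h x)"
    and eq: "\<And>s b. \<lbrakk>0 \<le> s; s \<le> 1; b \<in> topspace B\<rbrakk> \<Longrightarrow>
         e (q (s, b)) = (if s \<le> 1/2 then j (G (2 * s, b)) else p (2 * s - 1, b))"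
    using e by (auto simp: cone_extension_def)
  \<comment> \<open>For each \<open>b\<close> this is a path over a real parameter:
    \<open>k (\<psi> b)\<close> at -1, back through \<open>k \<circ> G\<close> to
    \<open>k (h (\<phi> b))\<close> at 0, then along \<open>J\<close> to \<open>\<phi> b\<close> at
    1. \<Omega> continues it through the cone of \<open>X'\<close>, with the apex at 2.\<close>
  define D where "D = (\<lambda>z. if fst z \<le> 0 then k (G (clamp01 (- fst z), snd z))
      else J (clamp01 (fst z), \<phi> (snd z)))"
  define \<Omega> where "\<Omega> = (\<lambda>z. if fst z \<le> 1 then i (D z) else q (clamp01 (fst z - 1), snd z))"
  let ?RB = "prod_topology euclideanreal B"
  have fst: "continuous_map ?RB euclideanreal fst"
    by (simp add: continuous_map_fst)
  have fsts: "continuous_map ?RB euclideanreal (\<lambda>z. fst z)" "continuous_map ?RB euclideanreal (\<lambda>z. - fst z)"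
       "continuous_map ?RB euclideanreal (\<lambda>z. fst z - 1)"
    by (intro continuous_intros fst | simp)+
  have D: "continuous_map ?RB X D"
    unfolding D_def
  proof (rule continuous_map_cases_le[OF fst])
    show "continuous_map (subtopology ?RB {x \<in> topspace ?RB. fst x \<le> 0}) X (\<lambda>z. k (G (clamp01 (- fst z), snd z)))"
      by (intro continuous_map_from_subtopology continuous_map_compose_app[OF k]
          continuous_map_clamped[OF G] fsts continuous_map_snd)
    show "continuous_map (subtopology ?RB {x \<in> topspace ?RB. 0 \<le> fst x}) X (\<lambda>z. J (clamp01 (fst z), \<phi> (snd z)))"
      by (intro continuous_map_from_subtopology continuous_map_compose_app[OF S.cont_\<phi>]
          continuous_map_clamped[OF J] fsts continuous_map_snd)
  qed (auto simp: clamp01_def G0 J0)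
  have \<Omega>: "continuous_map ?RB X' \<Omega>"
    unfolding \<Omega>_def
  proof (rule continuous_map_cases_le[OF fst])
    show "continuous_map (subtopology ?RB {x \<in> topspace ?RB. fst x \<le> 1}) X' (\<lambda>z. i (D z))"
      by (intro continuous_map_from_subtopology continuous_map_compose_app[OF S.cont_i] D)
    show "continuous_map (subtopology ?RB {x \<in> topspace ?RB. 1 \<le> fst x}) X' (\<lambda>z. q (clamp01 (fst z - 1), snd z))"
      by (intro continuous_map_from_subtopology continuous_map_clamped[OF S.cont_q] fsts continuous_map_snd)
  qed (auto simp: clamp01_def D_def J1 S.q0)
  define G' where "G' = (\<lambda>z. D (2 * fst z - 1, snd z))"
  have G': "continuous_map ?IB X G'"
    unfolding G'_def
    by (intro continuous_map_compose_app[OF D]) 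
       (auto simp: continuous_map_pairwise o_def continuous_map_snd
          intro!: continuous_intros continuous_map_interval_fst)
  have G'0: "G' (0, b) = k (\<psi> b)" and G'1: "G' (1, b) = \<phi> b" if "b \<in> topspace B" for b
    using that by (auto simp: G'_def D_def clamp01_def G1 J1)
  obtain e' where e': "cone_extension Y B \<psi> Y' j p X \<phi> X' i q k G' e'"
    using cone_extension_exists[OF mY mX k G' G'0 G'1] by blast
  have ce': "continuous_map Y' X' e'" and e'j: "\<And>y. y \<in> topspace Y \<Longrightarrow> e' (j y) = i (k y)"
    and e'p: "\<And>s b. \<lbrakk>0 \<le> s; s \<le> 1; b \<in> topspace B\<rbrakk> \<Longrightarrow>
         e' (p (s, b)) = (if s \<le> 1/2 then i (G' (2 * s, b)) else q (2 * s - 1, b))"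
    using e' by (auto simp: cone_extension_def)
  text \<open>Both the composite and the identity run along the path \<open>\<lambda>u. \<Omega> (u, b)\<close>, with different parametrisations,
     so an affine homotopy of the parametrisations connects them.\<close>
  define \<alpha> where "\<alpha> s = max (- (2 * s)) (min (8 * s - 5) (4 * s - 2))" for s :: real
  \<comment> \<open>The lower half of the cone under \<open>e\<close> yields
    \<open>- (2 * s)\<close>. The upper half is a cone parameter \<open>2 * s - 1\<close> for
    \<open>e'\<close>, which is halved once more at 3/4: \<open>G'\<close> contributes
    \<open>8 * s - 5\<close> and the cone \<open>4 * s - 2\<close>.\<close>
  have comp: "e' (e (q (s, b))) = \<Omega> (\<alpha> s, b)" if s: "0 \<le> s" "s \<le> 1" and b: "b \<in> topspace B" for s b
  proof -
    have Gin: "G (2 * s, b) \<in> topspace Y" if "s \<le> 1/2"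
      using G s b that by (auto simp: continuous_map_def Pi_iff)
    consider "s \<le> 1/2" | "1/2 < s" "s \<le> 3/4" | "3/4 < s" by linarith
    then show ?thesis
    proof cases
      case 1
      then have "\<alpha> s = - (2 * s)" by (auto simp: \<alpha>_def)
      with 1 s b show ?thesis
        by (auto simp: eq e'j Gin \<Omega>_def D_def clamp01_def)
    next
      case 2
      then have a: "\<alpha> s = 8 * s - 5" by (auto simp: \<alpha>_def)
      show ?thesis
        using 2 s b unfolding a by (auto simp: eq e'p \<Omega>_def G'_def algebra_simps)
    next
      case 3
      then have a: "\<alpha> s = 4 * s - 2" by (auto simp: \<alpha>_def)
      show ?thesis
        using 3 s b unfolding a by (auto simp: eq e'p \<Omega>_def clamp01_def algebra_simps)
    qed
  qed
  have qid: "q (s, b) = \<Omega> (1 + s, b)" if s: "0 \<le> s" "s \<le> 1" and b: "b \<in> topspace B" for s b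
    using s b by (auto simp: \<Omega>_def D_def clamp01_def J1 S.q0)
  define F where "F = (\<lambda>(t, s, b). \<Omega> ((1 - t) * \<alpha> s + t * (1 + s), b))"
  have F: "continuous_map (prod_topology unit_interval ?IB) X' F"
  proof -
    let ?P = "prod_topology unit_interval ?IB"
    have t: "continuous_map ?P euclideanreal (\<lambda>z. fst z)"
      by (rule continuous_map_interval_fst)
    have s: "continuous_map ?P euclideanreal (\<lambda>z. fst (snd z))"
      by (rule continuous_map_compose_app[OF continuous_map_interval_fst continuous_map_snd])
    have b: "continuous_map ?P B (\<lambda>z. snd (snd z))"
      by (rule continuous_map_compose_app[OF continuous_map_snd continuous_map_snd])
    have "continuous_map ?P X' (\<lambda>z. \<Omega> ((1 - fst z) * \<alpha> (fst (snd z)) + fst z * (1 + fst (snd z)), snd (snd z)))"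
      by (intro continuous_map_compose_app[OF \<Omega>])
         (auto simp: continuous_map_pairwise o_def \<alpha>_def intro!: continuous_intros t s b
            continuous_map_real_max continuous_map_real_min)
    then show ?thesis
      by (simp add: F_def case_prod_unfold)
  qed
  have iJ: "continuous_map (prod_topology unit_interval X) X' (\<lambda>z. i (J z))"
    by (rule continuous_map_compose_app[OF S.cont_i J])
  \<comment> \<open>The interpolated parameter is \<open>t\<close> at \<open>s = 0\<close>, where
    \<Omega> is \<open>J\<close> along \<phi>, and constantly 2 at \<open>s = 1\<close>, the apex.
    So \<open>F\<close> glues with the homotopy \<open>J\<close> on the base.\<close>
  obtain g where g: "continuous_map (prod_topology unit_interval X') X' g"
    and gi: "\<And>t x. t \<in> {0..1} \<Longrightarrow> x \<in> topspace X \<Longrightarrow> g (t, i x) = i (J (t, x))"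
    and gq: "\<And>t s b. \<lbrakk>t \<in> {0..1}; 0 \<le> s; s \<le> 1; b \<in> topspace B\<rbrakk> \<Longrightarrow> g (t, q (s, b)) = F (t, s, b)"
  proof (rule S.descend_param[OF iJ F])
    show "F (t, 0, b) = i (J (t, \<phi> b))" if "t \<in> topspace unit_interval" "b \<in> topspace B" for t b
      using that by (auto simp: F_def \<alpha>_def \<Omega>_def D_def clamp01_def J0 G0)
    show "F (t, 1, b) = F (t, 1, b')" if "t \<in> topspace unit_interval" "b \<in> topspace B" "b' \<in> topspace B" for t b b'
      using that S.q1[of b b'] by (auto simp: F_def \<alpha>_def \<Omega>_def clamp01_def algebra_simps)
  qed auto
  have "homotopic_with (\<lambda>x. True) X' X' (e' \<circ> e) id"
  proof (subst homotopic_with, force, intro exI conjI ballI)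
    show "continuous_map (prod_topology unit_interval X') X' g" by (fact g)
    fix y assume y: "y \<in> topspace X'"
    have hx: "h x \<in> topspace Y" if "x \<in> topspace X" for x
      using h that by (auto simp: continuous_map_def)
    show "g (0, y) = (e' \<circ> e) y"
      using y S.cover by (auto simp: gi gq J0 ei e'j hx comp F_def)
    have "g (1, q (s, b)) = q (s, b)" if "0 \<le> s" "s \<le> 1" "b \<in> topspace B" for s b
      by (subst gq) (use that in \<open>auto simp: F_def qid\<close>)
    then show "g (1, y) = id y"
      using y S.cover by (auto simp: gi J1)
  qed auto
  with e' show thesis by (rule that)
qed

text \<open>Every cone extension of a homotopy equivalence has a left homotopy inverse of the same kind; applying this
  twice gives a two-sided one.\<close>

lemma mapping_cone_homotopy_equivalent:
  assumes mX: "mapping_cone X B \<phi> X' i q" and mY: "mapping_cone Y B \<psi> Y' j p"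
    and h: "continuous_map X Y h" and k: "continuous_map Y X k"
    and kh: "homotopic_with (\<lambda>x. True) X X (k \<circ> h) id"
    and hk: "homotopic_with (\<lambda>x. True) Y Y (h \<circ> k) id"
    and att: "homotopic_with (\<lambda>x. True) B Y (h \<circ> \<phi>) \<psi>"
  shows "X' homotopy_equivalent_space Y'"
proof -
  obtain G where G: "continuous_map (prod_topology unit_interval B) Y G"
    "\<And>b. G (0, b) = h (\<phi> b)" "\<And>b. G (1, b) = \<psi> b"
    using att by (auto simp: homotopic_with_def)
  obtain e where e: "cone_extension X B \<phi> X' i q Y \<psi> Y' j p h G e"
    using cone_extension_exists[OF mX mY h G(1)] G by metis
  obtain G' e' where e': "cone_extension Y B \<psi> Y' j p X \<phi> X' i q k G' e'"
    and e'e: "homotopic_with (\<lambda>x. True) X' X' (e' \<circ> e) id"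
    using cone_extension_left_inverse[OF mX mY e h k kh] by blast
  obtain G'' e'' where e'': "cone_extension X B \<phi> X' i q Y \<psi> Y' j p h G'' e''"
    and e''e': "homotopic_with (\<lambda>x. True) Y' Y' (e'' \<circ> e') id"
    using cone_extension_left_inverse[OF mY mX e' k h hk] by blast
  have c: "continuous_map X' Y' e" "continuous_map Y' X' e'" "continuous_map X' Y' e''"
    using e e' e'' by (auto simp: cone_extension_def)
  \<comment> \<open>Bracketing the triple composite in both ways shows \<open>e\<close> and
    \<open>e''\<close> to be homotopic, so the left inverse \<open>e''\<close> of \<open>e'\<close>
    can be replaced by \<open>e\<close>.\<close>
  have "homotopic_with (\<lambda>x. True) X' Y' (e'' \<circ> (e' \<circ> e)) (e'' \<circ> id)"
    by (rule homotopic_with_compose_continuous_map_left[OF e'e c(3)]) auto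
  moreover have "homotopic_with (\<lambda>x. True) X' Y' ((e'' \<circ> e') \<circ> e) (id \<circ> e)"
    by (rule homotopic_with_compose_continuous_map_right[OF e''e' c(1)]) auto
  ultimately have "homotopic_with (\<lambda>x. True) X' Y' e e''"
    by (simp add: o_assoc) (meson homotopic_with_symD homotopic_with_trans)
  then have "homotopic_with (\<lambda>x. True) Y' Y' (e \<circ> e') (e'' \<circ> e')"
    by (rule homotopic_with_compose_continuous_map_right[OF _ c(2)]) auto
  then have "homotopic_with (\<lambda>x. True) Y' Y' (e \<circ> e') id"
    using e''e' homotopic_with_trans by blast
  with e'e c show ?thesis
    unfolding homotopy_equivalent_space_def by blast
qed

section \<open>Simplicial complexes and elementary expansions\<close>

definition realization_points :: "'a set \<Rightarrow> 'a set set \<Rightarrow> ('a \<Rightarrow> real) set" where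
  "realization_points V K = {t. (\<forall>v. 0 \<le> t v) \<and> {v. t v \<noteq> 0} \<in> K \<and> (\<Sum>v\<in>V. t v) = 1}"

lemma geometric_realization_alt:
  "geometric_realization V K = subtopology (powertop_real UNIV) (realization_points V K)"
  by (simp add: geometric_realization_def realization_points_def)

lemma topspace_geometric_realization [simp]:
  "topspace (geometric_realization V K) = realization_points V K"
  by (simp add: geometric_realization_alt)

lemma Hausdorff_geometric_realization: "Hausdorff_space (geometric_realization V K)"
  unfolding geometric_realization_alt
  by (metis Hausdorff_space_euclidean Hausdorff_space_product_topology Hausdorff_space_subtopology)

lemma continuous_map_into_geometric_realization:
  "continuous_map X (geometric_realization V K) f \<longleftrightarrow>
     (\<forall>v. continuous_map X euclideanreal (\<lambda>x. f x v)) \<and> f ` topspace X \<subseteq> realization_points V K"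
  by (auto simp: geometric_realization_alt continuous_map_in_subtopology continuous_map_componentwise_UNIV)

lemma continuous_map_barycentric_coordinate:
  "continuous_map (geometric_realization V K) euclideanreal (\<lambda>t. t v)"
  unfolding geometric_realization_alt
  by (intro continuous_map_from_subtopology continuous_map_product_projection) auto

lemma subtopology_geometric_realization:
  assumes "K \<subseteq> K'"
  shows "subtopology (geometric_realization V K') (realization_points V K) = geometric_realization V K"
proof -
  have "realization_points V K' \<inter> realization_points V K = realization_points V K"
    using assms by (auto simp: realization_points_def)
  then show ?thesis
    by (simp add: geometric_realization_alt subtopology_subtopology)
qed

lemma continuous_map_Min:
  assumes "finite S" "S \<noteq> {}" "\<And>v. v \<in> S \<Longrightarrow> continuous_map X euclideanreal (\<lambda>x. f x v)"
  shows "continuous_map X euclideanreal (\<lambda>x. Min (f x ` S))"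
  using assms
proof (induction rule: finite_ne_induct)
  case (insert v S)
  then have "(\<lambda>x. Min (f x ` insert v S)) = (\<lambda>x. min (f x v) (Min (f x ` S)))"
    by auto
  with insert show ?case
    by (auto intro!: continuous_map_real_min)
qed auto

text \<open>The situation of an elementary expansion: the simplex \<open>insert v \<tau>\<close>
  meets \<open>K\<close> in a horn, all of its boundary but the open face opposite
  \<open>v\<close>.\<close>

definition free_face :: "'a set set \<Rightarrow> 'a set \<Rightarrow> 'a \<Rightarrow> bool" where
  "free_face K \<tau> v \<longleftrightarrow> finite \<tau> \<and> v \<notin> \<tau> \<and> \<tau> \<notin> K \<and>
     (\<forall>\<rho>. \<rho> \<subset> insert v \<tau> \<and> \<rho> \<noteq> \<tau> \<longrightarrow> \<rho> \<in> K)"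

definition down_closed :: "'a set set \<Rightarrow> bool" where
  "down_closed K \<longleftrightarrow> {} \<in> K \<and> (\<forall>I\<in>K. finite I \<and> (\<forall>J\<subseteq>I. J \<in> K))"

lemma down_closedD: "down_closed K \<Longrightarrow> I \<in> K \<Longrightarrow> J \<subseteq> I \<Longrightarrow> J \<in> K"
  by (auto simp: down_closed_def)

lemma down_closed_expansion:
  assumes "down_closed K" "free_face K \<tau> v"
  shows "down_closed (K \<union> {\<tau>, insert v \<tau>})"
  unfolding down_closed_def
proof (intro conjI ballI allI impI)
  fix I assume I: "I \<in> K \<union> {\<tau>, insert v \<tau>}"
  show "finite I"
    using I assms by (auto simp: down_closed_def free_face_def)
  fix J assume J: "J \<subseteq> I"
  show "J \<in> K \<union> {\<tau>, insert v \<tau>}"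
  proof (cases "I \<in> K")
    case True
    with J assms show ?thesis by (auto dest: down_closedD)
  next
    case False
    with I J have "J \<subseteq> insert v \<tau>" by auto
    with assms show ?thesis by (auto simp: free_face_def)
  qed
qed (use assms in \<open>auto simp: down_closed_def\<close>)

lemma realization_pointsD:
  assumes "t \<in> realization_points V K"
  shows "{v. t v \<noteq> 0} \<in> K" "0 \<le> t v" "sum t V = 1"
  using assms by (auto simp: realization_points_def)

text \<open>Push away from the free face \<open>\<tau>\<close> towards the opposite vertex \<open>v\<close>, by an amount that vanishes outside the
  two new simplices.\<close>

lemma homotopy_equivalent_expansion:
  assumes V: "finite V" and K: "down_closed K" "K \<union> {\<tau>, insert v \<tau>} \<subseteq> Pow V"
    and free: "free_face K \<tau> v"
  shows "geometric_realization V (K \<union> {\<tau>, insert v \<tau>}) homotopy_equivalent_space geometric_realization V K"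
proof -
  let ?K' = "K \<union> {\<tau>, insert v \<tau>}"
  let ?X' = "geometric_realization V ?K'" and ?X = "geometric_realization V K"
  have \<tau>: "finite \<tau>" "v \<notin> \<tau>" "\<tau> \<notin> K" "\<tau> \<noteq> {}" "\<tau> \<subseteq> V" "v \<in> V"
    using free K by (auto simp: free_face_def down_closed_def)
  define m where "m t = Min (t ` \<tau>)" for t :: "'a \<Rightarrow> real"
  \<comment> \<open>Each vertex of \<tau> gives up \<open>l * m t\<close> and \<open>v\<close>
    receives the total, so the coordinate sum is kept. At \<open>l = 1\<close> a least coordinate on
    \<tau> has dropped to 0, and the support is neither of the two new faces.\<close>
  define push where "push = (\<lambda>(l::real, t) w. t w - l * m t * (of_bool (w \<in> \<tau>) - real (card \<tau>) * of_bool (w = v)))"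
  have m_le: "m t \<le> t w" if "w \<in> \<tau>" for t w
    using that \<tau> by (simp add: m_def)
  have m_att: "\<exists>w\<in>\<tau>. m t = t w" for t
    using Min_in[of "t ` \<tau>"] \<tau> by (auto simp: m_def image_iff)
  have m_nonneg: "0 \<le> m t" if "t \<in> realization_points V ?K'" for t
    using m_att[of t] that by (auto simp: realization_points_def)
  have m_zero: "m t = 0" if t: "t \<in> realization_points V K" for t
  proof (rule ccontr)
    assume "m t \<noteq> 0"
    moreover have "0 \<le> m t"
      using m_att[of t] realization_pointsD(2)[OF t] by auto
    ultimately have "0 < t w" if "w \<in> \<tau>" for w
      using m_le[OF that, of t] by linarith
    then have "\<tau> \<subseteq> {v. t v \<noteq> 0}"
      by (auto simp: less_le)
    then show False
      using down_closedD[OF K(1) realization_pointsD(1)[OF t]] \<tau> by blast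
  qed
  have m_pos: "{w. t w \<noteq> 0} = \<tau> \<or> {w. t w \<noteq> 0} = insert v \<tau>" if "t \<in> realization_points V ?K'" "m t \<noteq> 0" for t
    using m_zero[of t] that by (auto simp: realization_points_def)
  have sub: "realization_points V K \<subseteq> realization_points V ?K'"
    by (auto simp: realization_points_def)
  have sum_push: "sum (push (l, t)) V = sum t V" for l t
  proof -
    have "(\<Sum>w\<in>V. of_bool (w \<in> \<tau>) - real (card \<tau>) * of_bool (w = v)) = 0"
      using \<tau> V by (simp add: sum_subtractf sum_distrib_left[symmetric] of_bool_def sum.If_cases Int_absorb1)
    then show ?thesis
      by (simp add: push_def sum_subtractf sum_distrib_left[symmetric])
  qed
  have push_nonneg: "0 \<le> push (l, t) w" if l: "0 \<le> l" "l \<le> 1" and t: "t \<in> realization_points V ?K'" for l t w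
  proof -
    have lm: "0 \<le> l * m t" "l * m t \<le> m t"
      using l m_nonneg[OF t] by (auto simp: mult_left_le_one_le)
    have "0 \<le> t w" using realization_pointsD(2)[OF t] .
    then show ?thesis
      using \<tau> lm m_le[of w t] by (cases "w \<in> \<tau>"; cases "w = v") (auto simp: push_def)
  qed
  have push_supp: "{w. push (l, t) w \<noteq> 0} \<in> ?K' \<and> (l = 1 \<longrightarrow> {w. push (l, t) w \<noteq> 0} \<in> K)"
    if l: "0 \<le> l" "l \<le> 1" and t: "t \<in> realization_points V ?K'" for l t
  proof (cases "m t = 0")
    case True
    then have "push (l, t) = t" by (auto simp: push_def)
    moreover have "{w. t w \<noteq> 0} \<in> K" 
      using True m_att[of t] realization_pointsD(1)[OF t] by auto
    ultimately show ?thesis by auto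
  next
    case False
    let ?S = "{w. push (l, t) w \<noteq> 0}"
    have S: "?S \<subseteq> insert v \<tau>"
      using m_pos[OF t False] by (auto simp: push_def)
    show ?thesis
    proof (cases "l = 1")
      case True
      obtain w where w: "w \<in> \<tau>" "m t = t w" using m_att by blast
      then have "push (l, t) w = 0" using \<tau> True by (auto simp: push_def)
      with w \<tau> S have "?S \<subset> insert v \<tau> \<and> ?S \<noteq> \<tau>" by blast
      with free show ?thesis by (auto simp: free_face_def)
    next
      case False
      with l have "l < 1" by simp
      have "\<tau> \<subseteq> ?S"
      proof
        fix w assume w: "w \<in> \<tau>"
        have "m t > 0" using m_nonneg[OF t] \<open>m t \<noteq> 0\<close> by linarith
        then have "l * m t < m t" using \<open>l < 1\<close> by simp
        with m_le[OF w, of t] w \<tau> show "w \<in> ?S" by (auto simp: push_def)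
      qed
      with S False have "?S = \<tau> \<or> ?S = insert v \<tau>" by auto
      with False show ?thesis by auto
    qed
  qed
  have cm: "continuous_map ?X' euclideanreal m"
    unfolding m_def by (intro continuous_map_Min continuous_map_barycentric_coordinate \<tau>)
  have push_in: "push (l, t) \<in> realization_points V ?K'" "push (1, t) \<in> realization_points V K"
    if "0 \<le> l" "l \<le> 1" "t \<in> realization_points V ?K'" for l t
    using push_supp[OF that] push_supp[of 1 t] push_nonneg[of l t] push_nonneg[of 1 t] that sum_push
      realization_pointsD(3)[of t]
    by (auto simp: realization_points_def)
  have cpush: "continuous_map (prod_topology unit_interval ?X') ?X' push"
    unfolding continuous_map_into_geometric_realization
  proof (intro conjI allI)
    fix w
    have "continuous_map (prod_topology unit_interval ?X') euclideanreal
       (\<lambda>z. snd z w - fst z * m (snd z) * (of_bool (w \<in> \<tau>) - real (card \<tau>) * of_bool (w = v)))"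
      by (intro continuous_intros continuous_map_interval_fst
          continuous_map_compose_app[OF continuous_map_barycentric_coordinate continuous_map_snd]
          continuous_map_compose_app[OF cm continuous_map_snd])
    then show "continuous_map (prod_topology unit_interval ?X') euclideanreal (\<lambda>z. push z w)"
      by (simp add: push_def case_prod_unfold)
  qed (use push_in in auto)
  have "homotopic_with (\<lambda>x. True) ?X' ?X' id (\<lambda>t. push (1, t))"
  proof (subst homotopic_with, force, intro exI[of _ push] conjI ballI)
    show "continuous_map (prod_topology unit_interval ?X') ?X' push" by (fact cpush)
  qed (auto simp: push_def)
  moreover have "retraction_maps ?X' ?X (\<lambda>t. push (1, t)) id"
    unfolding retraction_maps_def
  proof (intro conjI ballI)
    have "continuous_map ?X' ?X' (\<lambda>t. push (1, t))"
      by (rule continuous_map_compose_app[OF cpush]) (simp add: continuous_map_pairwise o_def)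
    then show "continuous_map ?X' ?X (\<lambda>t. push (1, t))"
      unfolding continuous_map_into_geometric_realization using push_in(2)[of 0] by auto
    show "continuous_map ?X ?X' id"
      unfolding continuous_map_into_geometric_realization
      using sub by (auto intro: continuous_map_barycentric_coordinate)
    show "push (1, id t) = t" if "t \<in> topspace ?X" for t
      using m_zero[of t] that by (simp add: push_def)
  qed
  ultimately show ?thesis
    using deformation_retract_imp_homotopy_equivalent_space homotopic_with_symD by blast
qed

lemma realization_points_vertex:
  assumes V: "finite V" "v \<in> V"
  shows "\<exists>a. realization_points V {{}, {v}} = {a}"
proof -
  let ?a = "\<lambda>w. of_bool (w = v) :: real"
  have "realization_points V {{}, {v}} = {?a}"
  proof (intro subset_antisym subsetI)
    fix t assume t: "t \<in> realization_points V {{}, {v}}"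
    have "{w. t w \<noteq> 0} \<noteq> {}"
    proof
      assume "{w. t w \<noteq> 0} = {}"
      then have "sum t V = 0" by (intro sum.neutral) auto
      with realization_pointsD(3)[OF t] show False by simp
    qed
    with t have eq: "{w. t w \<noteq> 0} = {v}" by (auto simp: realization_points_def)
    then have "sum t V = sum t {v}"
      using V by (intro sum.mono_neutral_right) auto
    with t have "t v = 1" by (simp add: realization_points_def)
    with eq show "t \<in> {?a}" by (auto simp: fun_eq_iff)
  qed (use V in \<open>auto simp: realization_points_def of_bool_def\<close>)
  then show ?thesis by blast
qed

section \<open>Attaching a simplex\<close>

abbreviation proper_faces :: "'a set \<Rightarrow> 'a set set" where
  "proper_faces \<sigma> \<equiv> {\<rho>. \<rho> \<subset> \<sigma>}"

lemma realization_off_support: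
  assumes "t \<in> realization_points V K" "K \<subseteq> Pow \<sigma>" "w \<notin> \<sigma>"
  shows "t w = 0"
  using assms by (auto simp: realization_points_def)

lemma realization_sum:
  assumes "t \<in> realization_points V K" "K \<subseteq> Pow \<sigma>" "\<sigma> \<subseteq> V" "finite V"
  shows "sum t \<sigma> = 1"
proof -
  have "sum t V = sum t \<sigma>"
    using assms by (intro sum.mono_neutral_right) (auto intro: realization_off_support)
  with assms(1) show ?thesis by (simp add: realization_points_def)
qed

lemma realization_proper_faces:
  assumes \<sigma>: "finite V" "\<sigma> \<subseteq> V" "\<sigma> \<noteq> {}"
  shows "t \<in> realization_points V (proper_faces \<sigma>) \<longleftrightarrow>
     (\<forall>w. 0 \<le> t w) \<and> (\<forall>w. w \<notin> \<sigma> \<longrightarrow> t w = 0) \<and> sum t \<sigma> = 1 \<and> (\<exists>w\<in>\<sigma>. t w = 0)" (is "?L \<longleftrightarrow> ?R")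
proof
  assume ?L
  then show ?R
    using realization_sum[OF \<open>?L\<close>, of \<sigma>] realization_off_support[OF \<open>?L\<close>, of \<sigma>] \<sigma>
    by (auto simp: realization_points_def)
next
  assume R: ?R
  then have "sum t V = sum t \<sigma>"
    using \<sigma> by (intro sum.mono_neutral_right) auto
  with R show ?L
    by (auto simp: realization_points_def)
qed

text \<open>Closed in a cube, because "some coordinate on \<sigma> vanishes" is the closed condition
  that the minimum is 0. Compactness is the source of properness for the cone maps over this
  boundary.\<close>

lemma compact_realization_proper_faces:
  assumes \<sigma>: "finite V" "\<sigma> \<subseteq> V" "\<sigma> \<noteq> {}"
  shows "compact_space (geometric_realization V (proper_faces \<sigma>))"
proof -
  let ?P = "powertop_real UNIV :: ('a \<Rightarrow> real) topology"
  let ?C = "PiE UNIV (\<lambda>w. if w \<in> \<sigma> then {0..1} else {0}) :: ('a \<Rightarrow> real) set"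
  have fin: "finite \<sigma>" using \<sigma> finite_subset by blast
  have cmp: "compactin ?P ?C"
    by (auto simp: compactin_PiE)
  have c: "continuous_map ?P euclideanreal (\<lambda>t. t w)" for w
    by (rule continuous_map_product_projection) simp
  have "closedin ?P {t \<in> topspace ?P. sum t \<sigma> \<in> {1}}" "closedin ?P {t \<in> topspace ?P. Min (t ` \<sigma>) \<in> {0}}"
    by (intro closedin_continuous_map_preimage[of _ euclideanreal] continuous_map_sum continuous_map_Min fin c \<sigma>; simp)+
  from closed_Int_compactin[OF closedin_Int[OF this] cmp]
  have "compactin ?P ({t. sum t \<sigma> = 1} \<inter> {t. Min (t ` \<sigma>) = 0} \<inter> ?C)"
    by simp
  moreover have "({t. sum t \<sigma> = 1} \<inter> {t. Min (t ` \<sigma>) = 0} \<inter> ?C) = realization_points V (proper_faces \<sigma>)"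
  proof (rule equalityI; rule subsetI)
    fix t assume t: "t \<in> ({t. sum t \<sigma> = 1} \<inter> {t. Min (t ` \<sigma>) = 0} \<inter> ?C)"
    then have C: "t w \<in> (if w \<in> \<sigma> then {0..1} else {0})" for w by (auto simp: PiE_iff)
    have "Min (t ` \<sigma>) \<in> t ` \<sigma>" using fin \<sigma> by (intro Min_in) auto
    then have "0 \<in> t ` \<sigma>" using t by auto
    then have "\<exists>w\<in>\<sigma>. t w = 0" by auto
    moreover have "0 \<le> t w" "w \<notin> \<sigma> \<longrightarrow> t w = 0" for w using C[of w] by (auto split: if_splits)
    ultimately show "t \<in> realization_points V (proper_faces \<sigma>)"
      using t by (auto simp: realization_proper_faces[OF \<sigma>])
  next
    fix t assume "t \<in> realization_points V (proper_faces \<sigma>)"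
    then have t: "\<And>w. 0 \<le> t w" "\<And>w. w \<notin> \<sigma> \<Longrightarrow> t w = 0" "sum t \<sigma> = 1" "\<exists>w\<in>\<sigma>. t w = 0"
      by (auto simp: realization_proper_faces[OF \<sigma>])
    have "t w \<le> 1" if "w \<in> \<sigma>" for w
      using member_le_sum[OF that, of t] t fin by auto
    moreover have "Min (t ` \<sigma>) = 0"
      using t fin by (intro Min_eqI) (auto simp: image_iff) 
    ultimately show "t \<in> ({t. sum t \<sigma> = 1} \<inter> {t. Min (t ` \<sigma>) = 0} \<inter> ?C)"
      using t by (auto simp: PiE_iff)
  qed
  ultimately show ?thesis
    by (simp add: geometric_realization_alt compact_space_subtopology)
qed

text \<open>A simplex is the cone over its boundary with apex the barycentre. The bound on
  \<open>card \<sigma>\<close> makes the boundary non-empty, so that the barycentre itself is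
  reached by the cone map.\<close>

lemma mapping_cone_simplex:
  assumes V: "finite V" and K: "insert \<sigma> K \<subseteq> Pow V" "\<sigma> \<notin> K" "down_closed K" "proper_faces \<sigma> \<subseteq> K"
    and card: "2 \<le> card \<sigma>"
  shows "mapping_cone (geometric_realization V K) (geometric_realization V (proper_faces \<sigma>)) id
     (geometric_realization V (insert \<sigma> K)) id
     (\<lambda>(s, t) w. (1 - s) * t w + s * (of_bool (w \<in> \<sigma>) / real (card \<sigma>)))"
proof -
  let ?X = "geometric_realization V K" and ?B = "geometric_realization V (proper_faces \<sigma>)"
    and ?X' = "geometric_realization V (insert \<sigma> K)"
  let ?q = "\<lambda>(s, t) w. (1 - s) * t w + s * (of_bool (w \<in> \<sigma>) / real (card \<sigma>))"
  have \<sigma>: "\<sigma> \<subseteq> V" "\<sigma> \<noteq> {}" "finite \<sigma>"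
    using K V by (auto simp: down_closed_def intro: finite_subset)
  define n where "n = real (card \<sigma>)"
  have n: "n > 0" using \<sigma> by (auto simp: n_def card_gt_0_iff)
  note bd = realization_proper_faces[OF V \<sigma>(1,2)]
  have qv: "?q (s, b) w = (1 - s) * b w + (if w \<in> \<sigma> then s / n else 0)" for s b w
    by (simp add: n_def)
  have sub: "realization_points V K \<subseteq> realization_points V (insert \<sigma> K)"
    "realization_points V (proper_faces \<sigma>) \<subseteq> realization_points V K"
    using K by (auto simp: realization_points_def)
  have supp: "{w. ?q (s, b) w \<noteq> 0} = \<sigma>" if "0 < s" "s \<le> 1" "b \<in> realization_points V (proper_faces \<sigma>)" for s b
  proof -
    have "?q (s, b) w > 0" if "w \<in> \<sigma>" for w
      using that n \<open>0 < s\<close> \<open>s \<le> 1\<close> \<open>b \<in> _\<close> bd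
      by (auto simp: n_def intro!: add_nonneg_pos mult_nonneg_nonneg)
    moreover have "?q (s, b) w = 0" if "w \<notin> \<sigma>" for w
      using that \<open>b \<in> _\<close> bd by (simp add: qv)
    ultimately show ?thesis by fastforce
  qed
  have q_in: "?q (s, b) \<in> realization_points V (insert \<sigma> K)"
    if s: "0 \<le> s" "s \<le> 1" and b: "b \<in> realization_points V (proper_faces \<sigma>)" for s b
  proof (cases "s = 0")
    case True
    then have "?q (s, b) = b" by auto
    then show ?thesis using b sub by auto
  next
    case False
    have "sum (?q (s, b)) V = (1 - s) * sum b V + s * (\<Sum>w\<in>V. of_bool (w \<in> \<sigma>) / n)"
      by (simp add: sum.distrib sum_distrib_left n_def)
    also have "(\<Sum>w\<in>V. of_bool (w \<in> \<sigma>) / n) = 1"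
      using \<sigma> V n by (simp add: of_bool_def sum_divide_distrib[symmetric] sum.If_cases Int_absorb1 n_def)
    also have "sum b V = 1" using b by (simp add: realization_points_def)
    finally have sum: "sum (?q (s, b)) V = 1" by simp
    have "0 \<le> ?q (s, b) w" for w
      using s b bd n by (simp add: qv)
    then show ?thesis
      unfolding realization_points_def mem_Collect_eq
      using sum supp[of s b] False s b by simp
  qed
  have not_in_K: "?q (s, b) \<notin> realization_points V K"
    if "0 < s" "s \<le> 1" "b \<in> realization_points V (proper_faces \<sigma>)" for s b
    using supp[OF that] K by (auto simp: realization_points_def)
  show ?thesis
  proof
    show "continuous_map ?X ?X' id"
      unfolding continuous_map_into_geometric_realization
      using sub by (auto intro: continuous_map_barycentric_coordinate)
    \<comment> \<open>Inside the enlarged complex, the old one is the locus where the least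
      coordinate on \<sigma> is 0.\<close>
    have "closedin ?X' (realization_points V K)"
    proof -
      have "closedin ?X' {t \<in> topspace ?X'. Min (t ` \<sigma>) \<in> {0}}"
        by (intro closedin_continuous_map_preimage[of _ euclideanreal] continuous_map_Min \<sigma>
            continuous_map_barycentric_coordinate) simp
      moreover have "{t \<in> topspace ?X'. Min (t ` \<sigma>) \<in> {0}} = realization_points V K"
      proof (rule equalityI; rule subsetI)
        fix t assume t: "t \<in> {t \<in> topspace ?X'. Min (t ` \<sigma>) \<in> {0}}"
        have "Min (t ` \<sigma>) \<in> t ` \<sigma>" using \<sigma> by (intro Min_in) auto
        then have "0 \<in> t ` \<sigma>" using t by auto
        then have "{w. t w \<noteq> 0} \<noteq> \<sigma>" by auto
        with t show "t \<in> realization_points V K" by (auto simp: realization_points_def)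
      next
        fix t assume t: "t \<in> realization_points V K"
        then have "\<not> \<sigma> \<subseteq> {w. t w \<noteq> 0}"
          using K down_closedD[OF K(3) realization_pointsD(1)[OF t]] by auto
        then obtain w where "w \<in> \<sigma>" "t w = 0" by auto
        then have "Min (t ` \<sigma>) = 0"
          using realization_pointsD(2)[OF t] \<sigma> by (intro Min_eqI) (auto simp: image_iff)
        then show "t \<in> {t \<in> topspace ?X'. Min (t ` \<sigma>) \<in> {0}}"
          using t sub by auto
      qed
      ultimately show ?thesis by simp
    qed
    from closed_map_inclusion[OF this] have "closed_map ?X ?X' id"
      by (simp add: subtopology_geometric_realization subset_insertI)
    then show "proper_map ?X ?X' id"
      by (rule closed_injective_imp_proper_map) simp
    show cq: "continuous_map (prod_topology unit_interval ?B) ?X' ?q"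
      unfolding continuous_map_into_geometric_realization
    proof (intro conjI allI)
      fix w
      have "continuous_map (prod_topology unit_interval ?B) euclideanreal
         (\<lambda>z. (1 - fst z) * snd z w + fst z * (of_bool (w \<in> \<sigma>) / real (card \<sigma>)))"
        by (intro continuous_intros continuous_map_interval_fst
            continuous_map_compose_app[OF continuous_map_barycentric_coordinate continuous_map_snd])
      then show "continuous_map (prod_topology unit_interval ?B) euclideanreal (\<lambda>z. ?q z w)"
        by (simp add: case_prod_unfold)
    next
      show "?q ` topspace (prod_topology unit_interval ?B) \<subseteq> realization_points V (insert \<sigma> K)"
        using q_in by fastforce
    qed
    have "compact_space ?B" "compact_space unit_interval"
      using compact_realization_proper_faces[OF V \<sigma>(1,2)] by (auto simp: compact_space_subtopology)
    then show "proper_map (prod_topology unit_interval ?B) ?X' ?q"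
      by (intro continuous_imp_proper_map cq Hausdorff_imp_kc_space Hausdorff_geometric_realization)
         (simp add: compact_space_prod_topology)
    show "topspace ?X' = id ` topspace ?X \<union> ?q ` ({0..1} \<times> topspace ?B)"
    proof (rule equalityI; rule subsetI)
      fix t assume t: "t \<in> topspace ?X'"
      show "t \<in> id ` topspace ?X \<union> ?q ` ({0..1} \<times> topspace ?B)"
      proof (cases "t \<in> realization_points V K")
        case False
        with t have eq: "{w. t w \<noteq> 0} = \<sigma>" by (auto simp: realization_points_def)
        have t': "0 \<le> t w" for w using t by (auto simp: realization_points_def)
        have sum\<sigma>: "sum t \<sigma> = 1"
        proof -
          have "sum t V = sum t \<sigma>"
            using V \<sigma> eq by (intro sum.mono_neutral_right) auto
          with t show ?thesis by (simp add: realization_points_def)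
        qed
        \<comment> \<open>A point whose least coordinate on \<sigma> is \<open>m\<close> sits at
          height \<open>n * m\<close>: subtracting \<open>m\<close> everywhere and rescaling leaves
          a boundary point. Height 1 is the barycentre, where any boundary point will do.\<close>
        define m where "m = Min (t ` \<sigma>)"
        have m: "m \<le> t w" if "w \<in> \<sigma>" for w using that \<sigma> by (simp add: m_def)
        obtain w0 where w0: "w0 \<in> \<sigma>" "m = t w0"
          using Min_in[of "t ` \<sigma>"] \<sigma> by (auto simp: m_def image_iff)
        have "m > 0" using w0 eq t'[of w0] by auto
        have "n * m \<le> sum t \<sigma>"
          using sum_mono[of \<sigma> "\<lambda>_. m" t] m by (simp add: n_def)
        then have s: "0 \<le> n * m" "n * m \<le> 1" using sum\<sigma> \<open>m > 0\<close> n by auto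
        let ?b0 = "\<lambda>w. of_bool (w = w0) :: real"
        show ?thesis
        proof (cases "n * m = 1")
          case True
          have "t w = m" if "w \<in> \<sigma>" for w
          proof (rule ccontr)
            assume "t w \<noteq> m"
            with m[OF that] have "m < t w" by simp
            then have "sum (\<lambda>_. m) \<sigma> < sum t \<sigma>"
              using that m \<sigma> by (intro sum_strict_mono_ex1) auto
            with sum\<sigma> True show False by (simp add: n_def)
          qed
          then have tq: "t = ?q (1, b)" for b
            using eq True n \<sigma> by (auto simp: fun_eq_iff field_simps n_def)
          have "\<sigma> \<noteq> {w0}" using card by auto
          then have "\<exists>w1\<in>\<sigma>. w1 \<noteq> w0" using w0(1) by auto
            then have "?b0 \<in> topspace ?B"
              using w0 \<sigma> by (auto simp: bd of_bool_def)
            then have "?q (1, ?b0) \<in> ?q ` ({0..1} \<times> topspace ?B)" by (intro imageI) auto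
            then show ?thesis using tq[of ?b0] by auto
        next
          case False
          with s have s1: "n * m < 1" by simp
          define b where "b w = (if w \<in> \<sigma> then (t w - m) / (1 - n * m) else 0)" for w
          have "sum b \<sigma> = (sum t \<sigma> - n * m) / (1 - n * m)"
            by (simp add: b_def sum_divide_distrib[symmetric] sum_subtractf n_def)
          then have "b \<in> topspace ?B"
            using s1 m w0 sum\<sigma> by (auto simp: bd b_def)
          moreover have "t = ?q (n * m, b)"
          proof
            fix w
            show "t w = ?q (n * m, b) w"
              unfolding qv using s1 eq n by (cases "w \<in> \<sigma>") (auto simp: b_def)
          qed
          ultimately show ?thesis using s by auto
        qed
      qed auto
    qed (use sub q_in in auto)
    show "continuous_map ?B ?X id"
      unfolding continuous_map_into_geometric_realization
      using sub by (auto intro: continuous_map_barycentric_coordinate)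
    show "?q (0, b) = id (id b)" for b by auto
    show "?q (1, b) = ?q (1, b')" for b b' by auto
    show "?q (s, b) \<noteq> id x" if "0 < s" "s \<le> 1" "b \<in> topspace ?B" "x \<in> topspace ?X" for s b x
      using not_in_K[of s b] that by auto
    show "s = s' \<and> b = b'" if s: "0 < s" "s < 1" "0 < s'" "s' \<le> 1" and b: "b \<in> topspace ?B" "b' \<in> topspace ?B"
      and eq: "?q (s, b) = ?q (s', b')" for s b s' b'
    proof -
      \<comment> \<open>A boundary point has a zero coordinate, so the least coordinate of a cone
        point depends on the height only and recovers it.\<close>
      have min: "Min (?q (s, b) ` \<sigma>) = s / n" if "0 < s" "s \<le> 1" "b \<in> topspace ?B" for s b
      proof (rule Min_eqI)
        show "s / n \<le> y" if "y \<in> ?q (s, b) ` \<sigma>" for y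
          using that \<open>s \<le> 1\<close> \<open>b \<in> _\<close> by (auto simp: bd n_def)
        obtain w where "w \<in> \<sigma>" "b w = 0" using \<open>b \<in> _\<close> by (auto simp: bd)
        then show "s / n \<in> ?q (s, b) ` \<sigma>" by (auto simp: image_iff n_def intro!: bexI[of _ w])
      qed (use \<sigma> in auto)
      have "Min (?q (s, b) ` \<sigma>) = s / n" "Min (?q (s', b') ` \<sigma>) = s' / n"
        by (rule min; use s b in simp)+
      then have "s / n = s' / n" unfolding eq by (rule box_equals[OF refl])
      then have ss: "s = s'" using n by simp
      have "b w = b' w" for w
        using fun_cong[OF eq, of w] ss s by (simp add: qv)
      with ss show ?thesis by auto
    qed
  qed simp
qed

section \<open>Spheres and wedges\<close>

text \<open>Radial projection of the boundary of a simplex from its barycentre, in the coordinates of all but one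
  of its vertices.\<close>

lemma sphere_proper_faces:
  assumes V: "finite V" "\<sigma> \<subseteq> V" and card: "card \<sigma> = e + 2"
  obtains \<beta> where "continuous_map (geometric_realization V (proper_faces \<sigma>)) (nsphere e) \<beta>"
    "bij_betw \<beta> (realization_points V (proper_faces \<sigma>)) (topspace (nsphere e))"
proof -
  let ?B = "geometric_realization V (proper_faces \<sigma>)"
  have fin: "finite \<sigma>" and ne: "\<sigma> \<noteq> {}" using V card finite_subset by auto
  note bd = realization_proper_faces[OF V ne]
  obtain f where f: "bij_betw f {..Suc e} \<sigma>"
    using ex_bij_betw_nat_finite[OF fin] card by (auto simp: atLeast0LessThan lessThan_Suc_atMost)
  define n where "n = real (card \<sigma>)"
  have n: "n = real e + 2" "n > 0" using card by (auto simp: n_def)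
  define y where "y t j = (if j \<le> e then t (f j) - 1/n else 0)" for t j
  define r where "r t = sqrt (\<Sum>j\<le>e. (y t j)\<^sup>2)" for t
  define \<beta> where "\<beta> t j = y t j / r t" for t j
  have f\<sigma>: "f j \<in> \<sigma>" if "j \<le> Suc e" for j using f that by (auto simp: bij_betw_def)
  have \<sigma>f: "\<exists>j\<le>Suc e. w = f j" if "w \<in> \<sigma>" for w using f that by (auto simp: bij_betw_def image_iff)
  have sum\<sigma>: "sum g \<sigma> = (\<Sum>j\<le>e. g (f j)) + g (f (Suc e))" for g :: "'a \<Rightarrow> real"
    using sum.reindex_bij_betw[OF f, of g] by simp
  have last: "t (f (Suc e)) - 1/n = - (\<Sum>j\<le>e. y t j)" if "sum t \<sigma> = 1" for t
  proof -
    have "(\<Sum>j\<le>e. y t j) = (\<Sum>j\<le>e. t (f j)) - (real e + 1) / n"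
      by (simp add: y_def sum_subtractf add.commute)
    moreover have "(real e + 1) / n = 1 - 1/n" using n by (simp add: field_simps)
    ultimately show ?thesis using that sum\<sigma>[of t] by simp
  qed
  have r_pos: "r t > 0" if t: "t \<in> realization_points V (proper_faces \<sigma>)" for t
  proof (rule ccontr)
    assume "\<not> r t > 0"
    then have "(\<Sum>j\<le>e. (y t j)\<^sup>2) = 0"
      by (auto simp: r_def not_less intro!: antisym sum_nonneg)
    then have "y t j = 0" if "j \<le> e" for j using that by (simp add: sum_nonneg_eq_0_iff)
    moreover have "sum t \<sigma> = 1" using t bd by auto
    ultimately have "t (f j) = 1/n" if "j \<le> Suc e" for j
      using that last[of t] by (cases "j = Suc e") (auto simp: y_def)
    then have "t w = 1/n" if "w \<in> \<sigma>" for w using \<sigma>f[OF that] by auto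
    moreover obtain w where "w \<in> \<sigma>" "t w = 0" using t bd by auto
    ultimately show False using n by auto
  qed
  have r_sq: "(\<Sum>j\<le>e. (y t j)\<^sup>2) = (r t)\<^sup>2" for t
    by (simp add: r_def sum_nonneg)
  have \<beta>_in: "\<beta> t \<in> topspace (nsphere e)" if t: "t \<in> realization_points V (proper_faces \<sigma>)" for t
  proof -
    have "(\<Sum>j\<le>e. (\<beta> t j)\<^sup>2) = 1"
      using r_pos[OF t] r_sq[of t] by (simp add: \<beta>_def power_divide sum_divide_distrib[symmetric])
    then show ?thesis by (auto simp: nsphere \<beta>_def y_def)
  qed
  have cont: "continuous_map ?B (nsphere e) \<beta>"
    unfolding nsphere continuous_map_in_subtopology continuous_map_componentwise_UNIV
  proof (intro conjI allI)
    fix j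
    have cy: "continuous_map ?B euclideanreal (\<lambda>t. y t j)" for j
      by (cases "j \<le> e") (auto simp: y_def intro!: continuous_intros continuous_map_barycentric_coordinate)
    have "continuous_map ?B euclideanreal r"
      unfolding r_def by (intro continuous_intros cy) auto
    then show "continuous_map ?B euclideanreal (\<lambda>t. \<beta> t j)"
      unfolding \<beta>_def using r_pos by (intro continuous_map_real_divide cy) fastforce+
  qed (use \<beta>_in in \<open>auto simp: nsphere\<close>)
  \<comment> \<open>For two boundary points on one ray from the barycentre, a zero coordinate of the
    first forces the ratio to be at least 1. Exchanging the points bounds it from the other side, so
    they coincide.\<close>
  have scale: "c \<ge> 1" if c: "c > 0" and t: "t \<in> realization_points V (proper_faces \<sigma>)"
     "t' \<in> realization_points V (proper_faces \<sigma>)"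
     and eq: "\<And>w. w \<in> \<sigma> \<Longrightarrow> t w - 1/n = c * (t' w - 1/n)" for c t t'
  proof -
    obtain w where w: "w \<in> \<sigma>" "t w = 0" using t bd by auto
    have "0 \<le> c * t' w" using t bd c by auto
    moreover have "c * (t' w - 1/n) = c * t' w - c / n" by (simp add: right_diff_distrib)
    ultimately have "1/n \<le> c / n" using eq[OF w(1)] w(2) by linarith
    then show ?thesis using n by (simp add: field_simps)
  qed
  have inj: "inj_on \<beta> (realization_points V (proper_faces \<sigma>))"
  proof (rule inj_onI)
    fix t t' assume t: "t \<in> realization_points V (proper_faces \<sigma>)" and t': "t' \<in> realization_points V (proper_faces \<sigma>)"
      and eq: "\<beta> t = \<beta> t'"
    have s: "sum t \<sigma> = 1" "sum t' \<sigma> = 1" using t t' bd by auto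
    have main: "u w - 1/n = (r u / r u') * (u' w - 1/n)"
      if "u \<in> realization_points V (proper_faces \<sigma>)" "u' \<in> realization_points V (proper_faces \<sigma>)"
        "\<beta> u = \<beta> u'" "w \<in> \<sigma>" for u u' w
    proof -
      have "y u j = (r u / r u') * y u' j" for j
        using fun_cong[OF that(3), of j] r_pos[OF that(1)] r_pos[OF that(2)]
        by (simp add: \<beta>_def field_simps)
      then have yy: "y u = (\<lambda>j. (r u / r u') * y u' j)" by blast
      have su: "sum u \<sigma> = 1" "sum u' \<sigma> = 1" using that bd by auto
      obtain j where j: "j \<le> Suc e" "w = f j" using \<sigma>f \<open>w \<in> \<sigma>\<close> by auto
      show ?thesis
      proof (cases "j = Suc e")
        case True
        then have "u w - 1/n = - (\<Sum>j\<le>e. y u j)" using last[OF su(1)] j by simp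
        also have "\<dots> = (r u / r u') * (- (\<Sum>j\<le>e. y u' j))"
          by (subst yy) (simp add: sum_distrib_left)
        finally show ?thesis using last[OF su(2)] j True by simp
      next
        case False
        with j have "y u j = u w - 1/n" "y u' j = u' w - 1/n" by (auto simp: y_def)
        then show ?thesis using fun_cong[OF yy, of j] by simp
      qed
    qed
    have "r t / r t' \<ge> 1"
      using r_pos[OF t] r_pos[OF t'] by (intro scale[OF _ t t'] main[OF t t' eq]) auto
    moreover have "r t' / r t \<ge> 1"
      using r_pos[OF t] r_pos[OF t'] by (intro scale[OF _ t' t] main[OF t' t eq[symmetric]]) auto
    ultimately have "r t = r t'"
      using r_pos[OF t] r_pos[OF t'] by (simp add: field_simps)
    then have "t w = t' w" if "w \<in> \<sigma>" for w
      using main[OF t t' eq that] r_pos[OF t'] by simp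
    moreover have "t w = t' w" if "w \<notin> \<sigma>" for w
      using that t t' bd by auto
    ultimately show "t = t'" by blast
  qed
  have surj: "topspace (nsphere e) \<subseteq> \<beta> ` realization_points V (proper_faces \<sigma>)"
  proof
    fix x assume x: "x \<in> topspace (nsphere e)"
    then have x1: "(\<Sum>j\<le>e. (x j)\<^sup>2) = 1" and x0: "\<And>j. e < j \<Longrightarrow> x j = 0" by (auto simp: nsphere)
    \<comment> \<open>Completing \<open>x\<close> to entries of sum 0 gives a direction at the
      barycentre. With least entry \<open>- m\<close>, the ray leaves the simplex after the time
      \<open>1 / (n * m)\<close>, when the first coordinate reaches 0.\<close>
    define w where "w j = (if j \<le> e then x j else - (\<Sum>j\<le>e. x j))" for j
    have sumw: "(\<Sum>j\<le>e. w j) + w (Suc e) = 0" by (simp add: w_def)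
    define \<mu> where "\<mu> = Min (w ` {..Suc e})"
    define m where "m = - \<mu>"
    have "\<mu> \<le> w j" if "j \<le> Suc e" for j using that by (simp add: \<mu>_def)
    then have wm: "- m \<le> w j" if "j \<le> Suc e" for j using that by (simp add: m_def)
    have "\<mu> \<in> w ` {..Suc e}" unfolding \<mu>_def by (intro Min_in) auto
    then obtain j0 where j0: "j0 \<le> Suc e" "w j0 = - m" by (auto simp: m_def)
    have "m > 0"
    proof (rule ccontr)
      assume "\<not> m > 0"
      then have w0: "0 \<le> w j" if "j \<le> Suc e" for j using wm[OF that] by simp
      then have "0 \<le> (\<Sum>j\<le>e. w j)" "0 \<le> w (Suc e)" by (auto intro: sum_nonneg)
      then have "(\<Sum>j\<le>e. w j) = 0" using sumw by simp
      then have "w j = 0" if "j \<le> e" for j using that w0 by (subst (asm) sum_nonneg_eq_0_iff) auto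
      then have "x j = 0" if "j \<le> e" for j using that by (metis w_def)
      then show False using x1 by simp
    qed
    define g where "g = inv_into {..Suc e} f"
    have g: "g (f j) = j" if "j \<le> Suc e" for j
      using f that by (simp add: g_def bij_betw_def)
    define t where "t u = (if u \<in> \<sigma> then 1/n + w (g u) / (n * m) else 0)" for u
    have tf: "t (f j) = 1/n + w j / (n * m)" if "j \<le> Suc e" for j
      using that f\<sigma> g by (simp add: t_def)
    have nonneg: "0 \<le> t u" for u
    proof (cases "u \<in> \<sigma>")
      case True
      then obtain j where j: "j \<le> Suc e" "u = f j" using \<sigma>f by auto
      have "- 1 \<le> w j / m" using wm[OF j(1)] \<open>m > 0\<close> by (simp add: field_simps)
      then have "0 \<le> (1 + w j / m) / n" using n by simp
      also have "\<dots> = t u"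
        unfolding j(2) tf[OF j(1)] using n(2) \<open>m > 0\<close> by (simp add: field_simps)
      finally show ?thesis .
    qed (simp add: t_def)
    have "sum t \<sigma> = (\<Sum>j\<le>e. 1/n + w j / (n * m)) + (1/n + w (Suc e) / (n * m))"
      using sum\<sigma>[of t] tf by simp
    also have "\<dots> = (real e + 2) / n + ((\<Sum>j\<le>e. w j) + w (Suc e)) / (n * m)"
      by (simp add: sum.distrib sum_divide_distrib add_divide_distrib)
    finally have "sum t \<sigma> = 1" using sumw n by simp
    moreover have "t (f j0) = 0"
      unfolding tf[OF j0(1)] j0(2) using n(2) \<open>m > 0\<close> by simp
    ultimately have t: "t \<in> realization_points V (proper_faces \<sigma>)"
      using nonneg f\<sigma>[OF j0(1)] by (auto simp: bd t_def)
    have yt: "y t j = x j / (n * m)" for j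
      using tf[of j] x0[of j] by (auto simp: y_def w_def)
    have "(\<Sum>j\<le>e. (y t j)\<^sup>2) = (1 / (n * m))\<^sup>2"
      by (simp add: yt power_divide sum_divide_distrib[symmetric] x1)
    then have "r t = 1 / (n * m)" using n(2) \<open>m > 0\<close> by (simp add: r_def)
    then have "\<beta> t = x" using n(2) \<open>m > 0\<close> by (auto simp: \<beta>_def yt)
    with t show "x \<in> \<beta> ` realization_points V (proper_faces \<sigma>)" by blast
  qed
  have "bij_betw \<beta> (realization_points V (proper_faces \<sigma>)) (topspace (nsphere e))"
    using inj surj \<beta>_in by (auto simp: bij_betw_def)
  with cont show thesis by (rule that)
qed

section \<open>Closed sets in wedges, and spheres as suspensions\<close>

lemma closedin_sum_topology:
  "closedin (sum_topology X I) C \<longleftrightarrow>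
     C \<subseteq> Sigma I (topspace \<circ> X) \<and> (\<forall>i\<in>I. closedin (X i) {x. (i, x) \<in> C})"
proof -
  have "{x. (i, x) \<in> Sigma I (topspace \<circ> X) - C} = topspace (X i) - {x. (i, x) \<in> C}" if "i \<in> I" for i
    using that by auto
  then show ?thesis
    by (auto simp: closedin_def openin_sum_topology)
qed

lemma closedin_wedge:
  "closedin (wedge X b I) C \<longleftrightarrow>
     C \<subseteq> topspace (wedge X b I) \<and> (\<forall>i\<in>I. closedin (X i) {x \<in> topspace (X i). wedge_map b (i, x) \<in> C})"
proof -
  have "{z \<in> topspace (sum_topology X I). wedge_map b z \<in> topspace (wedge X b I) - C} =
     topspace (sum_topology X I) - {z \<in> topspace (sum_topology X I). wedge_map b z \<in> C}"
    by (auto simp: topspace_wedge)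
  then have "closedin (wedge X b I) C \<longleftrightarrow> C \<subseteq> topspace (wedge X b I) \<and>
     closedin (sum_topology X I) {z \<in> topspace (sum_topology X I). wedge_map b z \<in> C}"
    unfolding closedin_def openin_wedge topspace_wedge[symmetric] by auto
  also have "\<dots> \<longleftrightarrow> C \<subseteq> topspace (wedge X b I) \<and>
    (\<forall>i\<in>I. closedin (X i) {x \<in> topspace (X i). wedge_map b (i, x) \<in> C})"
    unfolding closedin_sum_topology by (auto intro!: arg_cong2[where f = closedin] cong: conj_cong) 
  finally show ?thesis .
qed

lemma sphere_basepoint_in [simp]: "sphere_basepoint \<in> topspace (nsphere d)"
  using in_topspace_nsphere[of d] by (simp add: sphere_basepoint_def[abs_def])

lemma Hausdorff_nsphere: "Hausdorff_space (nsphere d)"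
  unfolding nsphere_def by (intro Hausdorff_space_subtopology Hausdorff_Euclidean_space)

lemma topspace_wedge_of_spheres:
  "topspace (wedge_of_spheres N d) =
     insert None (Some ` (SIGMA i:{..<N}. topspace (nsphere (d i)) - {sphere_basepoint}))"
  unfolding wedge_of_spheres_def topspace_wedge
  by (auto simp: wedge_map_def image_iff split: if_splits)

lemma closedin_wedge_of_spheres:
  "closedin (wedge_of_spheres N d) C \<longleftrightarrow> C \<subseteq> topspace (wedge_of_spheres N d) \<and>
     (\<forall>i<N. closedin (nsphere (d i))
        {x \<in> topspace (nsphere (d i)). wedge_map (\<lambda>_. sphere_basepoint) (i, x) \<in> C})"
  unfolding wedge_of_spheres_def closedin_wedge by auto

text \<open>Latitude coordinates: the first coordinate falls from 1 to -1, and
  \<open>2 * sqrt (s * (1 - s))\<close> is the radius of the parallel, since the square of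
  \<open>1 - 2 * s\<close> plus \<open>4 * s * (1 - s)\<close> is 1. At \<open>s = 0\<close>
  everything collapses to \<open>sphere_basepoint\<close>, so a sphere is a cone whose base has been
  collapsed.\<close>

definition suspend :: "real \<Rightarrow> (nat \<Rightarrow> real) \<Rightarrow> nat \<Rightarrow> real" where
  "suspend s y j = (case j of 0 \<Rightarrow> 1 - 2 * s | Suc k \<Rightarrow> 2 * sqrt (s * (1 - s)) * y k)"

lemma suspend_in_nsphere:
  assumes "0 \<le> s" "s \<le> 1" "y \<in> topspace (nsphere e)"
  shows "suspend s y \<in> topspace (nsphere (Suc e))"
proof -
  have y: "(\<Sum>k\<le>e. (y k)\<^sup>2) = 1" "\<And>k. e < k \<Longrightarrow> y k = 0"
    using assms by (auto simp: nsphere)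
  have "(\<Sum>j\<le>Suc e. (suspend s y j)\<^sup>2) = (1 - 2 * s)\<^sup>2 + (\<Sum>k\<le>e. (2 * sqrt (s * (1 - s)) * y k)\<^sup>2)"
    by (subst sum.atMost_Suc_shift) (simp add: suspend_def)
  also have "(\<Sum>k\<le>e. (2 * sqrt (s * (1 - s)) * y k)\<^sup>2) = (2 * sqrt (s * (1 - s)))\<^sup>2 * (\<Sum>k\<le>e. (y k)\<^sup>2)"
    by (simp add: power_mult_distrib sum_distrib_left)
  also have "\<dots> = 4 * (s * (1 - s))"
    using assms by (simp add: y power_mult_distrib)
  finally have "(\<Sum>j\<le>Suc e. (suspend s y j)\<^sup>2) = 1"
    by (simp add: power2_eq_square algebra_simps)
  moreover have "suspend s y j = 0" if "Suc e < j" for j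
    using that y by (cases j) (auto simp: suspend_def)
  ultimately show ?thesis by (auto simp: nsphere)
qed

lemma suspend_surj:
  assumes x: "x \<in> topspace (nsphere (Suc e))"
  obtains s y where "0 \<le> s" "s \<le> 1" "y \<in> topspace (nsphere e)" "suspend s y = x"
proof -
  have x1: "(x 0)\<^sup>2 + (\<Sum>k\<le>e. (x (Suc k))\<^sup>2) = 1" and x0: "\<And>j. Suc e < j \<Longrightarrow> x j = 0"
    using x sum.atMost_Suc_shift[of "\<lambda>j. (x j)\<^sup>2" e] by (auto simp: nsphere)
  define s where "s = (1 - x 0) / 2"
  have "0 \<le> (\<Sum>k\<le>e. (x (Suc k))\<^sup>2)" by (intro sum_nonneg) auto
  then have "(x 0)\<^sup>2 \<le> 1" using x1 by linarith
  then have "\<bar>x 0\<bar> \<le> 1" by (simp add: abs_square_le_1)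
  then have s: "0 \<le> s" "s \<le> 1" by (auto simp: s_def)
  have ss: "(2 * sqrt (s * (1 - s)))\<^sup>2 = (\<Sum>k\<le>e. (x (Suc k))\<^sup>2)"
    using s x1 by (simp add: power_mult_distrib) (simp add: s_def power2_eq_square field_simps)
  define c where "c = 2 * sqrt (s * (1 - s))"
  show thesis
  proof (cases "c = 0")
    case True
    then have "(\<Sum>k\<le>e. (x (Suc k))\<^sup>2) = 0" using ss by (simp only: c_def[symmetric]) simp
    then have "x (Suc k) = 0" if "k \<le> e" for k using that by (simp add: sum_nonneg_eq_0_iff)
    then have x0': "x (Suc k) = 0" for k using x0[of "Suc k"] by (cases "k \<le> e") auto
    have "suspend s sphere_basepoint j = x j" for j
      using True x0' unfolding suspend_def c_def[symmetric] by (cases j) (auto simp: s_def field_simps)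
    then have "suspend s sphere_basepoint = x" by blast
    with s show thesis using that sphere_basepoint_in by blast
  next
    case False
    define y where "y k = x (Suc k) / c" for k
    have "(\<Sum>k\<le>e. (y k)\<^sup>2) = 1"
      using False ss by (simp add: y_def power_divide sum_divide_distrib[symmetric] c_def[symmetric])
        (metis divide_self_if power_not_zero)
    then have "y \<in> topspace (nsphere e)" using x0 by (auto simp: nsphere y_def)
    moreover have "suspend s y j = x j" for j
      using False unfolding suspend_def c_def[symmetric]
      by (cases j) (auto simp: y_def, simp add: s_def field_simps)
    then have "suspend s y = x" by blast
    ultimately show thesis using that s by blast
  qed
qed

lemma suspend_eq_basepoint:
  assumes "0 \<le> s" "suspend s y = sphere_basepoint"
  shows "s = 0"
  using fun_cong[OF assms(2), of 0] by (simp add: suspend_def sphere_basepoint_def)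

lemma suspend_inj:
  assumes "0 < s" "s < 1" "suspend s y = suspend s' y'"
  shows "s = s' \<and> y = y'"
proof -
  have "s = s'" using fun_cong[OF assms(3), of 0] by (simp add: suspend_def)
  moreover have "s * (1 - s) \<noteq> 0" using assms by simp
  ultimately have "y k = y' k" for k
    using fun_cong[OF assms(3), of "Suc k"] assms by (simp add: suspend_def)
  with \<open>s = s'\<close> show ?thesis by auto
qed

lemma suspend_1: "suspend 1 y = suspend 1 y'"
  by (auto simp: suspend_def fun_eq_iff split: nat.splits)

lemma suspend_0: "suspend 0 y = sphere_basepoint"
  by (auto simp: suspend_def sphere_basepoint_def fun_eq_iff split: nat.splits)

text \<open>A further sphere in a wedge is a cone attached along a constant map: the suspension
  parameter is the cone parameter, and the base goes to \<open>None\<close>. Compactness of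
  \<open>B\<close> and the Hausdorff property of the sphere make the suspension map proper.\<close>

lemma mapping_cone_wedge:
  fixes B :: "'b topology"
  assumes B: "compact_space B" and \<beta>: "continuous_map B (nsphere e) \<beta>" "bij_betw \<beta> (topspace B) (topspace (nsphere e))"
    and d: "\<And>i. i < N \<Longrightarrow> d' i = d i" "d' N = Suc e"
  shows "mapping_cone (wedge_of_spheres N d) B (\<lambda>_. None) (wedge_of_spheres (Suc N) d') id
     (\<lambda>(s, b). wedge_map (\<lambda>_. sphere_basepoint) (N, suspend s (\<beta> b)))"
proof -
  let ?W = "wedge_of_spheres N d" and ?W' = "wedge_of_spheres (Suc N) d'"
  let ?wm = "wedge_map (\<lambda>_::nat. sphere_basepoint)"
  let ?q = "\<lambda>(s, b). ?wm (N, suspend s (\<beta> b))"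
  have \<beta>in: "\<beta> b \<in> topspace (nsphere e)" if "b \<in> topspace B" for b
    using \<beta>(2) that by (auto simp: bij_betw_def)
  have top: "topspace ?W' = topspace ?W \<union> Some ` ({N} \<times> (topspace (nsphere (Suc e)) - {sphere_basepoint}))"
    using d by (auto simp: topspace_wedge_of_spheres lessThan_Suc)
  have N_disj: "?wm (N, x) \<in> topspace ?W \<longleftrightarrow> x = sphere_basepoint" for x
    by (auto simp: topspace_wedge_of_spheres wedge_map_def)
  have cs: "continuous_map (prod_topology unit_interval B) (nsphere (Suc e)) (\<lambda>(s, b). suspend s (\<beta> b))"
    unfolding nsphere[of "Suc e"] continuous_map_in_subtopology continuous_map_componentwise_UNIV
  proof (intro conjI allI)
    fix j
    have "continuous_map (prod_topology unit_interval B) euclideanreal (\<lambda>z. \<beta> (snd z) k)" for k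
      by (rule continuous_map_compose_app[OF continuous_map_nsphere_projection
           continuous_map_compose_app[OF \<beta>(1) continuous_map_snd]])
    then show "continuous_map (prod_topology unit_interval B) euclideanreal (\<lambda>x. (case x of (s, b) \<Rightarrow> suspend s (\<beta> b)) j)"
      by (cases j) (auto simp: case_prod_unfold suspend_def intro!: continuous_intros continuous_map_interval_fst)
  next
    show "(\<lambda>(s, b). suspend s (\<beta> b)) \<in> topspace (prod_topology unit_interval B) \<rightarrow>
       {x. (\<Sum>i\<le>Suc e. (x i)\<^sup>2) = 1 \<and> (\<forall>i>Suc e. x i = 0)}"
      using suspend_in_nsphere[OF _ _ \<beta>in] by (fastforce simp: nsphere)
  qed
  have cwm: "continuous_map (nsphere (Suc e)) ?W' (\<lambda>x. ?wm (N, x))"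
    unfolding continuous_map_closedin
  proof (intro conjI allI impI)
    show "(\<lambda>x. ?wm (N, x)) \<in> topspace (nsphere (Suc e)) \<rightarrow> topspace ?W'"
      using d by (auto simp: topspace_wedge_of_spheres wedge_map_def)
    fix C assume "closedin ?W' C"
    then show "closedin (nsphere (Suc e)) {x \<in> topspace (nsphere (Suc e)). ?wm (N, x) \<in> C}"
      using d by (auto simp: closedin_wedge_of_spheres)
  qed
  have IB: "compact_space (prod_topology unit_interval B)"
    using B by (simp add: compact_space_prod_topology compact_space_subtopology)
  show ?thesis
  proof
    \<comment> \<open>A subset of the old wedge meets the new sphere in at most the base point,
      which is closed there.\<close>
    have "closedin ?W' C" if "closedin ?W C" for C
      unfolding closedin_wedge_of_spheres
    proof (intro conjI allI impI)
      have C: "C \<subseteq> topspace ?W" using that closedin_subset by blast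
      then show "C \<subseteq> topspace ?W'" using top by blast
      fix i assume "i < Suc N"
      show "closedin (nsphere (d' i)) {x \<in> topspace (nsphere (d' i)). ?wm (i, x) \<in> C}"
      proof (cases "i = N")
        case True
        have "{x \<in> topspace (nsphere (d' i)). ?wm (i, x) \<in> C} \<subseteq> {sphere_basepoint}"
          using C N_disj True by blast
        then have "finite {x \<in> topspace (nsphere (d' i)). ?wm (i, x) \<in> C}"
          by (rule finite_subset) simp
        then show ?thesis
          by (intro closedin_Hausdorff_finite Hausdorff_nsphere) auto
      next
        case False
        with \<open>i < Suc N\<close> that d show ?thesis by (auto simp: closedin_wedge_of_spheres)
      qed
    qed
    then have "closed_map ?W ?W' id" by (auto simp: closed_map_def)
    then show "proper_map ?W ?W' id"
      by (rule closed_injective_imp_proper_map) simp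
    show "continuous_map ?W ?W' id"
      unfolding continuous_map_closedin
    proof (intro conjI allI impI)
      fix C assume C: "closedin ?W' C"
      have "closedin ?W (C \<inter> topspace ?W)"
        unfolding closedin_wedge_of_spheres
      proof (intro conjI allI impI)
        fix i assume "i < N"
        then have "?wm (i, x) \<in> topspace ?W" if "x \<in> topspace (nsphere (d i))" for x
          using that by (auto simp: topspace_wedge_of_spheres wedge_map_def)
        then have "{x \<in> topspace (nsphere (d i)). ?wm (i, x) \<in> C \<inter> topspace ?W} =
            {x \<in> topspace (nsphere (d' i)). ?wm (i, x) \<in> C}"
          using d \<open>i < N\<close> by auto
        then show "closedin (nsphere (d i)) {x \<in> topspace (nsphere (d i)). ?wm (i, x) \<in> C \<inter> topspace ?W}"
          unfolding closedin_wedge_of_spheres using C \<open>i < N\<close> d(1)[of i]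
          by (simp only: closedin_wedge_of_spheres) (auto simp: less_Suc_eq)
      qed auto
      then show "closedin ?W {x \<in> topspace ?W. id x \<in> C}"
        by (simp add: Int_def conj_commute)
    qed (use top in auto)
    have q: "?q = (\<lambda>x. ?wm (N, x)) \<circ> (\<lambda>(s, b). suspend s (\<beta> b))" by auto
    show cq: "continuous_map (prod_topology unit_interval B) ?W' ?q"
      unfolding q using cs cwm by (rule continuous_map_compose)
    show "proper_map (prod_topology unit_interval B) ?W' ?q"
      unfolding q
    proof (rule proper_map_compose)
      show "proper_map (prod_topology unit_interval B) (nsphere (Suc e)) (\<lambda>(s, b). suspend s (\<beta> b))"
        by (intro continuous_imp_proper_map IB cs Hausdorff_imp_kc_space Hausdorff_nsphere)
      show "proper_map (nsphere (Suc e)) ?W' (\<lambda>x. ?wm (N, x))"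
      proof (rule closed_injective_imp_proper_map)
        show "inj_on (\<lambda>x. ?wm (N, x)) (topspace (nsphere (Suc e)))"
          by (auto simp: inj_on_def wedge_map_def split: if_splits)
        have "closedin ?W' ((\<lambda>x. ?wm (N, x)) ` C)" if C: "closedin (nsphere (Suc e)) C" for C
          unfolding closedin_wedge_of_spheres
        proof (intro conjI allI impI)
          have Cs: "C \<subseteq> topspace (nsphere (Suc e))" using C closedin_subset by blast
          then show "(\<lambda>x. ?wm (N, x)) ` C \<subseteq> topspace ?W'"
            using d by (auto simp: topspace_wedge_of_spheres wedge_map_def)
          fix i assume "i < Suc N"
          show "closedin (nsphere (d' i)) {x \<in> topspace (nsphere (d' i)). ?wm (i, x) \<in> (\<lambda>x. ?wm (N, x)) ` C}"
          proof (cases "i = N")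
            case True
            then have "{x \<in> topspace (nsphere (d' i)). ?wm (i, x) \<in> (\<lambda>x. ?wm (N, x)) ` C} = C"
              using Cs d by (auto simp: wedge_map_def split: if_splits)
            then show ?thesis using C True d by simp
          next
            case False
            then have "{x \<in> topspace (nsphere (d' i)). ?wm (i, x) \<in> (\<lambda>x. ?wm (N, x)) ` C} \<subseteq> {sphere_basepoint}"
              by (auto simp: wedge_map_def split: if_splits)
            then have "finite {x \<in> topspace (nsphere (d' i)). ?wm (i, x) \<in> (\<lambda>x. ?wm (N, x)) ` C}"
              by (rule finite_subset) simp
            then show ?thesis
              by (intro closedin_Hausdorff_finite Hausdorff_nsphere) auto
          qed
        qed
        then show "closed_map (nsphere (Suc e)) ?W' (\<lambda>x. ?wm (N, x))"
          by (auto simp: closed_map_def)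
      qed
    qed
    show "topspace ?W' = id ` topspace ?W \<union> ?q ` ({0..1} \<times> topspace B)"
    proof (rule equalityI; rule subsetI)
      fix z assume z: "z \<in> topspace ?W'"
      show "z \<in> id ` topspace ?W \<union> ?q ` ({0..1} \<times> topspace B)"
      proof (cases "z \<in> topspace ?W")
        case False
        then obtain x where x: "x \<in> topspace (nsphere (Suc e))" "x \<noteq> sphere_basepoint" "z = Some (N, x)"
          using z top by auto
        obtain s y where sy: "0 \<le> s" "s \<le> 1" "y \<in> topspace (nsphere e)" "suspend s y = x"
          using suspend_surj[OF x(1)] by blast
        obtain b where "b \<in> topspace B" "\<beta> b = y"
          using \<beta>(2) sy(3) by (metis bij_betw_def imageE)
        then have "(s, b) \<in> {0..1} \<times> topspace B" "?q (s, b) = z"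
          using sy x by (auto simp: wedge_map_def)
        then show ?thesis by blast
      qed auto
    next
      fix z assume "z \<in> id ` topspace ?W \<union> ?q ` ({0..1} \<times> topspace B)"
      moreover have "?q ` ({0..1} \<times> topspace B) \<subseteq> topspace ?W'"
        using continuous_map_image_subset_topspace[OF cq] by simp
      ultimately show "z \<in> topspace ?W'" using top by auto
    qed
    show "continuous_map B ?W (\<lambda>_. None)"
      by (simp add: topspace_wedge_of_spheres)
    show "?q (0, b) = id None" for b
      by (simp add: suspend_0 wedge_map_def)
    show "?q (1, b) = ?q (1, b')" for b b'
      using suspend_1[of "\<beta> b" "\<beta> b'"] by simp
    show "s = s' \<and> b = b'" if s: "0 < s" "s < 1" "0 < s'" "s' \<le> 1" and b: "b \<in> topspace B" "b' \<in> topspace B"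
      and eq: "?q (s, b) = ?q (s', b')" for s b s' b'
    proof -
      have "suspend s (\<beta> b) = suspend s' (\<beta> b')"
        using eq by (auto simp: wedge_map_def split: if_splits)
      with s have "s = s'" "\<beta> b = \<beta> b'" using suspend_inj by blast+
      with b \<beta>(2) show ?thesis by (auto simp: bij_betw_def inj_on_def)
    qed
    show "?q (s, b) \<noteq> id x" if "0 < s" "s \<le> 1" "b \<in> topspace B" "x \<in> topspace ?W" for s b x
      using N_disj[of "suspend s (\<beta> b)"] suspend_eq_basepoint[of s "\<beta> b"] that by auto
  qed simp
qed

section \<open>Collapsible and buildable complexes\<close>

context mapping_cone
begin

text \<open>Each cone line leads back to the base. This is how path connectedness of the wedge
  survives the attachment of a sphere.\<close>

lemma path_component_cone:
  assumes "b \<in> topspace B" "0 \<le> s" "s \<le> 1"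
  shows "path_component_of X' (i (\<phi> b)) (q (s, b))"
  unfolding path_component_of_def
proof (intro exI conjI)
  have "continuous_map unit_interval (prod_topology unit_interval B) (\<lambda>u. (s * u, b))"
    using assms by (auto simp: continuous_map_pairwise o_def continuous_map_in_subtopology mult_le_one
        intro!: continuous_intros)
  from continuous_map_compose_app[OF cont_q this] show "pathin X' (\<lambda>u. q (s * u, b))"
    by (simp add: pathin_def)
qed (use assms q0 in auto)

end

inductive collapsible :: "'a set set \<Rightarrow> bool" where
  vertex: "collapsible {{}, {v}}"
| expansion: "\<lbrakk>collapsible K; free_face K \<tau> v\<rbrakk> \<Longrightarrow> collapsible (K \<union> {\<tau>, insert v \<tau>})"

text \<open>In \<open>attach\<close>, the subcomplex \<open>Z\<close> is used twice: its
  contractible realization makes the attaching map null-homotopic, and its acyclic chains bound the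
  new boundary. The sizes 2 and 3 are edges and triangles, which yield 1-spheres and
  2-spheres.\<close>

inductive buildable :: "'a set set \<Rightarrow> bool" where
  vertex: "buildable {{}, {v}}"
| expansion: "\<lbrakk>buildable K; free_face K \<tau> v\<rbrakk> \<Longrightarrow> buildable (K \<union> {\<tau>, insert v \<tau>})"
| attach: "\<lbrakk>buildable K; collapsible Z; Z \<subseteq> K; proper_faces \<sigma> \<subseteq> Z; \<sigma> \<notin> K; card \<sigma> \<in> {2, 3}\<rbrakk>
    \<Longrightarrow> buildable (insert \<sigma> K)"

lemma down_closed_vertex: "down_closed {{}, {v}}"
  by (auto simp: down_closed_def)

lemma collapsible_down_closed: "collapsible K \<Longrightarrow> down_closed K"
  by (induction rule: collapsible.induct) (blast intro: down_closed_expansion down_closed_vertex)+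

lemma buildable_down_closed: "buildable K \<Longrightarrow> down_closed K"
proof (induction rule: buildable.induct)
  case (attach K Z \<sigma>)
  then have "finite \<sigma>" by (auto intro: card_ge_0_finite)
  moreover have "J \<in> insert \<sigma> K" if "J \<subseteq> \<sigma>" for J
    using that attach by blast
  ultimately show ?case
    using attach.IH by (auto simp: down_closed_def)
qed (blast intro: down_closed_expansion down_closed_vertex)+

lemma collapsible_imp_buildable: "collapsible K \<Longrightarrow> buildable K"
  by (induction rule: collapsible.induct) (blast intro: buildable.intros)+

lemma contractible_collapsible:
  assumes "collapsible K" "finite V" "K \<subseteq> Pow V"
  shows "contractible_space (geometric_realization V K)"
  using assms
proof (induction rule: collapsible.induct)
  case (vertex v)
  then obtain a where a: "realization_points V {{}, {v}} = {a}"
    using realization_points_vertex[of V v] by auto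
  show ?case
    unfolding geometric_realization_alt a by (rule contractible_space_subtopology_singleton)
next
  case (expansion K \<tau> v)
  then show ?case
    using homotopy_equivalent_space_contractibility[OF homotopy_equivalent_expansion[of V K \<tau> v]]
      collapsible_down_closed by auto
qed

text \<open>The attaching inclusion factors through the contractible realization of
  \<open>Z\<close>, so after \<open>h\<close> it is homotopic to a constant, and a path in the wedge
  moves that constant to \<open>None\<close>. Both complexes are then mapping cones over the same
  \<open>?B\<close> with homotopic attaching maps. The second claim carries the path connectedness
  on.\<close>

lemma sphere_attachment:
  assumes V: "finite V" "insert \<sigma> K \<subseteq> Pow V" and K: "down_closed K"
    and Z: "collapsible Z" "Z \<subseteq> K" "proper_faces \<sigma> \<subseteq> Z"
    and \<sigma>: "\<sigma> \<notin> K" "card \<sigma> = e + 2"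
    and heq: "geometric_realization V K homotopy_equivalent_space wedge_of_spheres N d"
    and pc: "\<And>z. z \<in> topspace (wedge_of_spheres N d) \<Longrightarrow> path_component_of (wedge_of_spheres N d) None z"
  defines "d' \<equiv> d(N := Suc e)"
  shows "geometric_realization V (insert \<sigma> K) homotopy_equivalent_space wedge_of_spheres (Suc N) d'"
    and "z \<in> topspace (wedge_of_spheres (Suc N) d') \<Longrightarrow> path_component_of (wedge_of_spheres (Suc N) d') None z"
proof -
  let ?B = "geometric_realization V (proper_faces \<sigma>)" and ?W = "wedge_of_spheres N d"
    and ?X = "geometric_realization V K"
  have s: "\<sigma> \<subseteq> V" "\<sigma> \<noteq> {}" using V \<sigma> by auto
  have B: "compact_space ?B"
    using compact_realization_proper_faces V s by blast
  obtain \<beta> where \<beta>: "continuous_map ?B (nsphere e) \<beta>" "bij_betw \<beta> (topspace ?B) (topspace (nsphere e))"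
    using sphere_proper_faces[OF V(1) s(1) \<sigma>(2)] by auto
  have mW: "mapping_cone ?W ?B (\<lambda>_. None) (wedge_of_spheres (Suc N) d') id
     (\<lambda>(s, b). wedge_map (\<lambda>_. sphere_basepoint) (N, suspend s (\<beta> b)))"
    by (rule mapping_cone_wedge[OF B \<beta>]) (auto simp: d'_def)
  have mX: "mapping_cone ?X ?B id (geometric_realization V (insert \<sigma> K)) id
     (\<lambda>(s, t) w. (1 - s) * t w + s * (of_bool (w \<in> \<sigma>) / real (card \<sigma>)))"
    by (rule mapping_cone_simplex) (use V K Z \<sigma> in auto)
  obtain h k where hk: "continuous_map ?X ?W h" "continuous_map ?W ?X k"
    "homotopic_with (\<lambda>x. True) ?X ?X (k \<circ> h) id" "homotopic_with (\<lambda>x. True) ?W ?W (h \<circ> k) id"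
    using heq unfolding homotopy_equivalent_space_def by blast
  have "contractible_space (geometric_realization V Z)"
    using contractible_collapsible Z V by (metis dual_order.trans insert_subset)
  moreover have "continuous_map ?B (geometric_realization V Z) id"
    unfolding continuous_map_into_geometric_realization
    using Z by (auto intro: continuous_map_barycentric_coordinate simp: realization_points_def)
  moreover have "continuous_map (geometric_realization V Z) ?X id"
    unfolding continuous_map_into_geometric_realization
    using Z by (auto intro: continuous_map_barycentric_coordinate simp: realization_points_def)
  then have "continuous_map (geometric_realization V Z) ?W h"
    using continuous_map_compose hk(1) by fastforce
  ultimately obtain c where c: "homotopic_with (\<lambda>x. True) ?B ?W (h \<circ> id) (\<lambda>_. c)"
    using nullhomotopic_through_contractible_space by blast
  have "homotopic_with (\<lambda>x. True) ?B ?W (\<lambda>_. c) (\<lambda>_. None)"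
  proof (cases "?B = trivial_topology")
    case False
    then have "c \<in> topspace ?W"
      using homotopic_with_imp_continuous_maps[OF c] by (simp add: continuous_map_const)
    then show ?thesis
      using pc by (simp add: homotopic_constant_maps path_component_of_sym)
  qed (simp add: homotopic_constant_maps)
  with c have "homotopic_with (\<lambda>x. True) ?B ?W (h \<circ> id) (\<lambda>_. None)"
    by (rule homotopic_with_trans)
  from mapping_cone_homotopy_equivalent[OF mX mW hk this]
  show "geometric_realization V (insert \<sigma> K) homotopy_equivalent_space wedge_of_spheres (Suc N) d'" .
  interpret W: mapping_cone ?W ?B "\<lambda>_. None" "wedge_of_spheres (Suc N) d'" id
     "\<lambda>(s, b). wedge_map (\<lambda>_. sphere_basepoint) (N, suspend s (\<beta> b))"
    by (fact mW)
  assume "z \<in> topspace (wedge_of_spheres (Suc N) d')"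
  then consider "z \<in> topspace ?W"
    | s b where "0 \<le> s" "s \<le> 1" "b \<in> topspace ?B" "z = (\<lambda>(s, b). wedge_map (\<lambda>_. sphere_basepoint) (N, suspend s (\<beta> b))) (s, b)"
    using W.cover by fastforce
  then show "path_component_of (wedge_of_spheres (Suc N) d') None z"
  proof cases
    case 1
    then obtain g where "pathin ?W g" "g 0 = None" "g 1 = z"
      using pc by (auto simp: path_component_of_def)
    then show ?thesis
      using pathin_compose[OF _ W.cont_i] by (auto simp: path_component_of_def)
  next
    case 2
    then show ?thesis using W.path_component_cone by (metis id_apply)
  qed
qed

text \<open>The path condition strengthens the induction: a null-homotopy may end at any point of
  the wedge, and it has to be moved to \<open>None\<close> before the next sphere is attached
  there.\<close>

lemma buildable_wedge_of_spheres:
  assumes "buildable K" "finite V" "K \<subseteq> Pow V"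
  shows "\<exists>N d. (\<forall>i<N. d i \<in> {1, 2}) \<and>
     geometric_realization V K homotopy_equivalent_space wedge_of_spheres N d \<and>
     (\<forall>z\<in>topspace (wedge_of_spheres N d). path_component_of (wedge_of_spheres N d) None z)"
  using assms
proof (induction rule: buildable.induct)
  case (vertex v)
  then obtain a where a: "realization_points V {{}, {v}} = {a}"
    using realization_points_vertex[of V v] by auto
  have top: "topspace (wedge_of_spheres 0 d) = {None}" for d
    by (auto simp: topspace_wedge_of_spheres)
  have "geometric_realization V {{}, {v}} homotopy_equivalent_space wedge_of_spheres 0 d" for d
    unfolding homotopy_equivalent_space_def
  proof (intro exI[of _ "\<lambda>_. None"] exI[of _ "\<lambda>_. a"] conjI)
    show "homotopic_with (\<lambda>x. True) (geometric_realization V {{}, {v}}) (geometric_realization V {{}, {v}})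
        ((\<lambda>_. a) \<circ> (\<lambda>_. None)) id"
      by (rule homotopic_with_equal) (use a in auto)
    show "homotopic_with (\<lambda>x. True) (wedge_of_spheres 0 d) (wedge_of_spheres 0 d)
        ((\<lambda>_. None) \<circ> (\<lambda>_. a)) id"
      by (rule homotopic_with_equal) (use top[of d] in auto)
  qed (use a top[of d] in auto)
  moreover have "path_component_of (wedge_of_spheres 0 d) None None" for d
    by (simp add: path_component_of_refl top)
  ultimately show ?case
    by (intro exI[of _ 0] exI[of _ "\<lambda>_. 1"]) (auto simp: top)
next
  case (expansion K \<tau> v)
  then have "geometric_realization V (K \<union> {\<tau>, insert v \<tau>}) homotopy_equivalent_space geometric_realization V K"
    by (intro homotopy_equivalent_expansion) (auto intro: buildable_down_closed)
  note heq = this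
  from expansion obtain N d where d: "\<forall>i<N. d i \<in> {1, 2}"
     "geometric_realization V K homotopy_equivalent_space wedge_of_spheres N d"
     "\<forall>z\<in>topspace (wedge_of_spheres N d). path_component_of (wedge_of_spheres N d) None z"
    by auto
  show ?case
    using homotopy_eqv_trans[OF heq d(2)] d(1,3) by blast
next
  case (attach K Z \<sigma>)
  have "K \<subseteq> Pow V" using attach.prems by simp
  from attach.IH[OF attach.prems(1) this] obtain N d where d: "\<forall>i<N. d i \<in> {1, 2}"
     "geometric_realization V K homotopy_equivalent_space wedge_of_spheres N d"
     "\<forall>z\<in>topspace (wedge_of_spheres N d). path_component_of (wedge_of_spheres N d) None z"
    by blast
  from attach obtain e where e: "card \<sigma> = e + 2" "Suc e \<in> {1, 2}"
    by (cases "card \<sigma> = 2") auto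
  have K: "down_closed K" using buildable_down_closed[OF \<open>buildable K\<close>] .
  note facts = \<open>finite V\<close> \<open>insert \<sigma> K \<subseteq> Pow V\<close> K attach(2,3,4,5) e(1) d(2)
  have 1: "geometric_realization V (insert \<sigma> K) homotopy_equivalent_space wedge_of_spheres (Suc N) (d(N := Suc e))"
    by (rule sphere_attachment(1)[of V \<sigma> K Z e N d]; (fact facts | use d(3) in blast))
  have 2: "path_component_of (wedge_of_spheres (Suc N) (d(N := Suc e))) None z"
    if "z \<in> topspace (wedge_of_spheres (Suc N) (d(N := Suc e)))" for z
    by (rule sphere_attachment(2)[of V \<sigma> K Z e N d]; (fact facts that | use d(3) in blast))
  have 3: "\<forall>i<Suc N. (d(N := Suc e)) i \<in> {1, 2}"
    using d(1) e(2) by (simp add: less_Suc_eq)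
  show ?case
    using 1 2 3 by blast
qed

section \<open>Combinatorics of collapsible complexes\<close>

lemma proper_faces_edge_subset:
  assumes "down_closed K" "{a} \<in> K" "{b} \<in> K"
  shows "proper_faces {a, b} \<subseteq> K"
proof
  fix \<rho> assume "\<rho> \<in> proper_faces {a, b}"
  then have "\<rho> \<subseteq> {a} \<or> \<rho> \<subseteq> {b}" by auto
  then show "\<rho> \<in> K" using assms down_closedD by blast
qed

lemma proper_faces_triangle_subset:
  assumes "down_closed K" "{a, b} \<in> K" "{b, c} \<in> K" "{a, c} \<in> K"
  shows "proper_faces {a, b, c} \<subseteq> K"
proof
  fix \<rho> assume "\<rho> \<in> proper_faces {a, b, c}"
  then have "\<rho> \<subseteq> {a, b} \<or> \<rho> \<subseteq> {b, c} \<or> \<rho> \<subseteq> {a, c}" by auto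
  then show "\<rho> \<in> K" using assms down_closedD by blast
qed

lemma free_face_vertex:
  assumes "down_closed K" "{a} \<in> K" "{b} \<notin> K"
  shows "free_face K {b} a"
proof -
  have "\<rho> \<in> K" if "\<rho> \<subset> {a, b}" "\<rho> \<noteq> {b}" for \<rho>
  proof -
    have "\<rho> \<subseteq> {a}" using that by auto
    then show ?thesis using assms down_closedD by blast
  qed
  then show ?thesis using assms by (auto simp: free_face_def)
qed

lemma free_face_edge:
  assumes "down_closed K" "a \<noteq> v" "b \<noteq> v" "{a, v} \<in> K" "{b, v} \<in> K" "{a, b} \<notin> K"
  shows "free_face K {a, b} v"
proof -
  have "\<rho> \<in> K" if "\<rho> \<subset> {v, a, b}" "\<rho> \<noteq> {a, b}" for \<rho>
  proof -
    have "a \<notin> \<rho> \<or> b \<notin> \<rho>"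
      using that by (cases "v \<in> \<rho>") blast+
    then have "\<rho> \<subseteq> {b, v} \<or> \<rho> \<subseteq> {a, v}"
      using that by blast
    then show ?thesis
      using down_closedD[OF assms(1) assms(4)] down_closedD[OF assms(1) assms(5)] by blast
  qed
  then show ?thesis using assms by (auto simp: free_face_def)
qed

lemma obtain_maximal_subset:
  assumes "finite H" "K \<subseteq> H" "P K"
  obtains M where "P M" "K \<subseteq> M" "M \<subseteq> H" "\<And>N. P N \<Longrightarrow> M \<subseteq> N \<Longrightarrow> N \<subseteq> H \<Longrightarrow> N = M"
proof -
  let ?S = "{M. P M \<and> K \<subseteq> M \<and> M \<subseteq> H}"
  have "finite ?S" by (rule finite_subset[of _ "Pow H"]) (use assms in auto)
  moreover have "?S \<noteq> {}" using assms by auto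
  ultimately obtain M where "M \<in> ?S" "\<forall>N\<in>?S. M \<subseteq> N \<longrightarrow> M = N"
    using finite_has_maximal[of ?S] by blast
  then show thesis by (intro that[of M]) auto
qed

text \<open>An expansion still possible inside \<open>H\<close> would enlarge a maximal
  \<open>M\<close>. So an edge of \<open>H\<close> with one end in \<open>M\<close> has its other
  end there too, and two sides in \<open>M\<close> of a triangle of \<open>H\<close> bring the
  third.\<close>

lemma maximal_collapsible:
  assumes H: "finite H" "down_closed H" and K: "collapsible K" "K \<subseteq> H"
  obtains M where "collapsible M" "K \<subseteq> M" "M \<subseteq> H"
    "\<And>a b. \<lbrakk>{a, b} \<in> H; {a} \<in> M\<rbrakk> \<Longrightarrow> {b} \<in> M"
    "\<And>a b v. \<lbrakk>{a, b, v} \<in> H; a \<noteq> v; b \<noteq> v; {a, v} \<in> M; {b, v} \<in> M\<rbrakk> \<Longrightarrow> {a, b} \<in> M"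
proof -
  obtain M where M: "collapsible M" "K \<subseteq> M" "M \<subseteq> H"
    and max: "\<And>N. collapsible N \<Longrightarrow> M \<subseteq> N \<Longrightarrow> N \<subseteq> H \<Longrightarrow> N = M"
    using obtain_maximal_subset[of H K collapsible] H K by blast
  have dc: "down_closed M" using M collapsible_down_closed by blast
  have *: "\<tau> \<in> M" if "free_face M \<tau> v" "insert v \<tau> \<in> H" for \<tau> v
  proof -
    have "\<tau> \<in> H" using that(2) H(2) by (auto intro: down_closedD)
    then have "M \<union> {\<tau>, insert v \<tau>} = M"
      using that M by (intro max collapsible.expansion) auto
    then show ?thesis by auto
  qed
  show thesis
  proof (rule that[OF M])
    fix a b assume "{a, b} \<in> H" "{a} \<in> M"
    then show "{b} \<in> M"
      using free_face_vertex[OF dc, of a b] *[of "{b}" a] by (cases "{b} \<in> M") auto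
  next
    fix a b v assume "{a, b, v} \<in> H" "a \<noteq> v" "b \<noteq> v" "{a, v} \<in> M" "{b, v} \<in> M"
    then show "{a, b} \<in> M"
      using free_face_edge[OF dc, of a v b] *[of "{a, b}" v] by (cases "{a, b} \<in> M") (auto simp: insert_commute)
  qed
qed

text \<open>If \<open>f\<close> is maximal in \<open>L\<close>, then \<open>insert v f\<close> has
  \<open>f\<close> as a free face over the cone on the rest of \<open>L\<close>. Each face of the
  base thus enters together with its cone, by one expansion.\<close>

lemma collapsible_cone:
  assumes "finite L" "down_closed L" "v \<notin> \<Union>L"
  shows "collapsible (L \<union> insert v ` L)"
  using assms
proof (induction "card L" arbitrary: L rule: less_induct)
  case less
  show ?case
  proof (cases "L = {{}}")
    case True
    then show ?thesis using collapsible.vertex[of v] by (simp add: insert_commute)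
  next
    case False
    have "L \<noteq> {}" using less.prems by (auto simp: down_closed_def)
    then obtain f where f: "f \<in> L" "\<And>g. g \<in> L \<Longrightarrow> f \<subseteq> g \<Longrightarrow> f = g"
      using finite_has_maximal[OF less.prems(1)] by blast
    have "f \<noteq> {}" using False f \<open>L \<noteq> {}\<close> by auto
    let ?L = "L - {f}"
    have dc: "down_closed ?L"
      unfolding down_closed_def
    proof (intro conjI ballI allI impI)
      show "{} \<in> ?L" using less.prems \<open>f \<noteq> {}\<close> by (auto simp: down_closed_def)
      fix I assume I: "I \<in> ?L"
      then show "finite I" using less.prems by (auto simp: down_closed_def)
      fix J assume "J \<subseteq> I"
      then show "J \<in> ?L" using I f down_closedD[OF less.prems(2)] by blast
    qed
    have "card ?L < card L" using f less.prems by (meson card_Diff1_less)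
    then have "collapsible (?L \<union> insert v ` ?L)"
      using less.hyps[of ?L] less.prems dc by auto
    moreover have "free_face (?L \<union> insert v ` ?L) f v"
      unfolding free_face_def
    proof (intro conjI allI impI)
      show "finite f" using f less.prems by (auto simp: down_closed_def)
      show "v \<notin> f" using f less.prems by auto
      then show "f \<notin> ?L \<union> insert v ` ?L" by auto
      fix \<rho> assume \<rho>: "\<rho> \<subset> insert v f \<and> \<rho> \<noteq> f"
      show "\<rho> \<in> ?L \<union> insert v ` ?L"
      proof (cases "v \<in> \<rho>")
        case True
        have "\<rho> - {v} \<subseteq> f" "\<rho> - {v} \<noteq> f" using \<rho> True by auto
        then have "\<rho> - {v} \<in> ?L" using down_closedD[OF less.prems(2) f(1)] by auto
        moreover have "\<rho> = insert v (\<rho> - {v})" using True by auto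
        ultimately show ?thesis by blast
      next
        case False
        then have "\<rho> \<subseteq> f" using \<rho> by auto
        then show ?thesis using \<rho> down_closedD[OF less.prems(2) f(1)] by auto
      qed
    qed
    ultimately have "collapsible ((?L \<union> insert v ` ?L) \<union> {f, insert v f})"
      by (rule collapsible.expansion)
    moreover have "(?L \<union> insert v ` ?L) \<union> {f, insert v f} = L \<union> insert v ` L"
      using f by auto
    ultimately show ?thesis by simp
  qed
qed

text \<open>The closed star of \<open>v\<close> is the cone from \<open>v\<close> over its
  link.\<close>

lemma collapsible_star:
  assumes "finite K" "down_closed K" "{v} \<in> K"
  shows "collapsible {f. insert v f \<in> K}"
proof -
  let ?L = "{f. v \<notin> f \<and> insert v f \<in> K}"
  have sub: "f \<in> K" if "insert v f \<in> K" for f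
    using that assms down_closedD by blast
  have "down_closed ?L"
    unfolding down_closed_def
  proof (intro conjI ballI allI impI)
    fix I J assume "I \<in> ?L" "J \<subseteq> I"
    then show "J \<in> ?L" using assms(2) down_closedD[of K "insert v I" "insert v J"] by auto
  qed (use assms in \<open>auto simp: down_closed_def\<close>)
  moreover have "finite ?L" by (rule finite_subset[OF _ assms(1)]) (use sub in auto)
  ultimately have "collapsible (?L \<union> insert v ` ?L)" by (intro collapsible_cone) auto
  moreover have "?L \<union> insert v ` ?L = {f. insert v f \<in> K}"
  proof (intro subset_antisym subsetI)
    fix f assume f: "f \<in> {f. insert v f \<in> K}"
    show "f \<in> ?L \<union> insert v ` ?L"
    proof (cases "v \<in> f")
      case True
      then have "f - {v} \<in> ?L" using f by (simp add: insert_absorb)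
      moreover have "f = insert v (f - {v})" using True by auto
      ultimately show ?thesis by blast
    qed (use f in auto)
  qed auto
  ultimately show ?thesis by simp
qed

section \<open>Maximal buildable subcomplexes and fillable triangles\<close>

lemma buildable_attach_edges:
  assumes "finite C" "buildable K"
    "\<And>e. e \<in> C \<Longrightarrow> card e = 2 \<and> (\<exists>Z. collapsible Z \<and> Z \<subseteq> K \<and> proper_faces e \<subseteq> Z)"
  shows "buildable (K \<union> C)"
  using assms
proof (induction rule: finite_induct)
  case (insert e C)
  then have IH: "buildable (K \<union> C)" by auto
  obtain Z where Z: "collapsible Z" "Z \<subseteq> K" "proper_faces e \<subseteq> Z" "card e = 2"
    using insert.prems(2)[of e] by auto
  show ?case
  proof (cases "e \<in> K \<union> C")
    case True
    then have "K \<union> insert e C = K \<union> C" by auto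
    with IH show ?thesis by simp
  next
    case False
    have "buildable (insert e (K \<union> C))"
      by (rule buildable.attach[OF IH Z(1)]) (use Z False in auto)
    then show ?thesis by simp
  qed
qed simp

text \<open>Maximality is taken among the buildable complexes in which every edge \<open>e\<close>
  of \<open>E\<close> comes with its designated triangle \<open>insert (t e) e\<close>. Plain
  maximality would not tell through which triangle an edge was introduced, and the spanning tree
  arguments need just these triangles. Expansions along \<open>t\<close> and fillings keep the
  condition, because the triangles they add have three vertices and so lie outside
  \<open>E\<close>.\<close>

lemma maximal_buildable:
  assumes H: "finite H" "down_closed H" and K: "buildable K" "K \<subseteq> H"
    and E: "\<And>e. e \<in> E \<Longrightarrow> card e = 2 \<and> t e \<notin> e \<and> insert (t e) e \<in> H" "E \<inter> K = {}"
  obtains M where "buildable M" "K \<subseteq> M" "M \<subseteq> H"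
    "\<And>e. \<lbrakk>e \<in> E; e \<in> M\<rbrakk> \<Longrightarrow> insert (t e) e \<in> M"
    "\<And>a b. \<lbrakk>{a, b} \<in> E; {a, t {a, b}} \<in> M; {b, t {a, b}} \<in> M\<rbrakk> \<Longrightarrow> {a, b} \<in> M"
    "\<And>a b c Z. \<lbrakk>{a, b, c} \<in> H; card {a, b, c} = 3; collapsible Z; Z \<subseteq> M;
        {a, b} \<in> Z; {b, c} \<in> Z; {a, c} \<in> Z\<rbrakk> \<Longrightarrow> {a, b, c} \<in> M"
proof -
  define P where "P M \<longleftrightarrow> buildable M \<and> (\<forall>e\<in>E. e \<in> M \<longrightarrow> insert (t e) e \<in> M)" for M
  have "P K" using K E(2) by (auto simp: P_def)
  then obtain M where PM: "P M" and MH: "K \<subseteq> M" "M \<subseteq> H"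
    and max: "\<And>N. P N \<Longrightarrow> M \<subseteq> N \<Longrightarrow> N \<subseteq> H \<Longrightarrow> N = M"
    by (rule obtain_maximal_subset[OF H(1) K(2)]) blast
  have M: "buildable M" "\<And>e. e \<in> E \<Longrightarrow> e \<in> M \<Longrightarrow> insert (t e) e \<in> M" "K \<subseteq> M" "M \<subseteq> H"
    using PM MH by (auto simp: P_def)
  have dc: "down_closed M" using M buildable_down_closed by blast
  show thesis
  proof (rule that)
    fix a b assume ab: "{a, b} \<in> E" "{a, t {a, b}} \<in> M" "{b, t {a, b}} \<in> M"
    show "{a, b} \<in> M"
    proof (rule ccontr)
      assume n: "{a, b} \<notin> M"
      let ?v = "t {a, b}"
      let ?N = "M \<union> {{a, b}, insert ?v {a, b}}"
      have v: "a \<noteq> ?v" "b \<noteq> ?v" "a \<noteq> b" using E(1)[OF ab(1)] by auto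
      have "buildable ?N"
        using M free_face_edge[OF dc v(1,2) ab(2,3) n] by (blast intro: buildable.expansion)
      moreover have "insert ?v {a, b} \<notin> E"
      proof
        assume "insert ?v {a, b} \<in> E"
        then have "card (insert ?v {a, b}) = 2" using E(1) by blast
        then show False using v by simp
      qed
      then have "\<forall>e\<in>E. e \<in> ?N \<longrightarrow> insert (t e) e \<in> ?N" using M by auto
      moreover have "?N \<subseteq> H" using M E(1)[OF ab(1)] H(2) by (auto intro: down_closedD)
      ultimately have "?N = M" by (intro max) (auto simp: P_def)
      then show False using n by auto
    qed
  next
    fix a b c Z assume A: "{a, b, c} \<in> H" "card {a, b, c} = 3" "collapsible Z" "Z \<subseteq> M"
        "{a, b} \<in> Z" "{b, c} \<in> Z" "{a, c} \<in> Z"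
    show "{a, b, c} \<in> M"
    proof (rule ccontr)
      assume n: "{a, b, c} \<notin> M"
      have "proper_faces {a, b, c} \<subseteq> Z"
        by (rule proper_faces_triangle_subset[OF collapsible_down_closed[OF A(3)] A(5,6,7)])
      then have "buildable (insert {a, b, c} M)"
        by (rule buildable.attach[OF M(1) A(3,4) _ n]) (use A(2) in simp_all)
      moreover have "{a, b, c} \<notin> E" using E(1)[of "{a, b, c}"] A(2) by auto
      then have "\<forall>e\<in>E. e \<in> insert {a, b, c} M \<longrightarrow> insert (t e) e \<in> insert {a, b, c} M" using M by auto
      ultimately have "insert {a, b, c} M = M" using M(4) A(1) by (intro max) (auto simp: P_def)
      then show False using n by auto
    qed
  qed (use M in auto)
qed

text \<open>Three triangles of a tetrahedron meet in \<open>v\<close>, and the star of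
  \<open>v\<close> is a cone containing the boundary of the fourth. Hence the fourth can be
  attached.\<close>

lemma tetrahedron_boundary_collapsible:
  assumes "finite K" "down_closed K" "{v, a, b} \<in> K" "{v, b, c} \<in> K" "{v, a, c} \<in> K"
  obtains Z where "collapsible Z" "Z \<subseteq> K" "{a, b} \<in> Z" "{b, c} \<in> Z" "{a, c} \<in> Z"
proof (rule that)
  show "collapsible {f. insert v f \<in> K}"
    using assms by (intro collapsible_star) (auto intro: down_closedD)
  show "{f. insert v f \<in> K} \<subseteq> K" using assms(2) down_closedD by blast
qed (use assms in auto)

text \<open>The cone from \<open>x\<close> over a spanning tree becomes, together with part of the cone from \<open>y\<close> over the whole graph,
  a collapsible complex containing the boundary of the triangle with vertices \<open>x\<close>, \<open>u\<close>, \<open>w\<close>.\<close>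

lemma suspension_collapsible:
  fixes \<delta> :: "'a \<Rightarrow> nat"
  assumes K: "finite K" "down_closed K" and A: "finite A" "x \<notin> A" "y \<notin> A" "x \<noteq> y" "r \<in> A"
    and p: "\<And>u. u \<in> A \<Longrightarrow> u \<noteq> r \<Longrightarrow> p u \<in> A \<and> \<delta> (p u) < \<delta> u \<and> {x, u, p u} \<in> K \<and> {y, u, p u} \<in> K"
    and r: "{x, r} \<in> K" "{y, r} \<in> K"
    and uw: "u \<in> A" "w \<in> A" "{y, u, w} \<in> K"
  obtains Z where "collapsible Z" "Z \<subseteq> K" "{x, u} \<in> Z" "{u, w} \<in> Z" "{x, w} \<in> Z"
proof -
  define L where "L = {{}} \<union> (\<lambda>a. {a}) ` A \<union> (\<lambda>a. {a, p a}) ` (A - {r})"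
  have dcL: "down_closed L"
    unfolding down_closed_def
  proof (intro conjI ballI allI impI)
    show "{} \<in> L" by (simp add: L_def)
    fix I assume I: "I \<in> L"
    then show "finite I" by (auto simp: L_def)
    fix J assume J: "J \<subseteq> I"
    from I consider "I = {}" | a where "a \<in> A" "I = {a}" | a where "a \<in> A" "a \<noteq> r" "I = {a, p a}"
      by (auto simp: L_def)
    then show "J \<in> L"
    proof cases
      case 3
      have "J = {} \<or> J = {a} \<or> J = {p a} \<or> J = {a, p a}" using J 3 by blast
      then show ?thesis using 3 p by (auto simp: L_def)
    qed (use J in \<open>auto simp: L_def subset_singleton_iff\<close>)
  qed
  have finL: "finite L" using A by (simp add: L_def)
  have xL: "x \<notin> \<Union>L" using A p by (auto simp: L_def)
  have yL: "y \<notin> \<Union>L" using A p by (auto simp: L_def)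
  let ?Z1 = "L \<union> insert x ` L"
  have Z1: "collapsible ?Z1" using collapsible_cone[OF finL dcL xL] .
  have xf: "insert x f \<in> K" if f: "f \<in> L" for f
  proof -
    have "{x} \<in> K" using r(1) K(2) by (auto intro: down_closedD)
    moreover have "{x, a} \<in> K" if "a \<in> A" for a
    proof (cases "a = r")
      case False
      then have "{x, a, p a} \<in> K" using p that by blast
      then show ?thesis using K(2) by (auto intro: down_closedD)
    qed (use r in simp)
    ultimately show ?thesis using f p by (auto simp: L_def)
  qed
  have Z1K: "?Z1 \<subseteq> K"
  proof
    fix f assume "f \<in> ?Z1"
    then obtain g where "g \<in> L" "f \<subseteq> insert x g" by auto
    then show "f \<in> K" using down_closedD[OF K(2) xf] by blast
  qed
  have dcZ1: "down_closed ?Z1" using Z1 collapsible_down_closed by blast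
  \<comment> \<open>One edge from \<open>y\<close> to the root leaves the cone from \<open>x\<close>
    collapsible. Closing up under expansions then draws the edges from \<open>y\<close> to all of
    \<open>A\<close>, descending the tree, and finally the edge between \<open>u\<close> and
    \<open>w\<close> across the triangle at \<open>y\<close>.\<close>
  let ?Z2 = "?Z1 \<union> {{y}, {r, y}}"
  have "{r} \<in> ?Z1" using A by (auto simp: L_def)
  moreover have "{y} \<notin> ?Z1" using yL A by auto
  ultimately have "collapsible ?Z2"
    using collapsible.expansion[OF Z1 free_face_vertex[OF dcZ1, of r y]] by (simp add: insert_commute)
  moreover have "?Z2 \<subseteq> K"
    using Z1K r(2) K(2) by (auto intro: down_closedD simp: insert_commute)
  ultimately obtain M where M: "collapsible M" "?Z2 \<subseteq> M" "M \<subseteq> K"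
    and closed: "\<And>a b v. \<lbrakk>{a, b, v} \<in> K; a \<noteq> v; b \<noteq> v; {a, v} \<in> M; {b, v} \<in> M\<rbrakk> \<Longrightarrow> {a, b} \<in> M"
    by (rule maximal_collapsible[OF K]) blast
  have xM: "{x, a} \<in> M" if "a \<in> A" for a
    using that M(2) by (auto simp: L_def)
  have yM: "{y, a} \<in> M" if "a \<in> A" for a
    using that
  proof (induction "\<delta> a" arbitrary: a rule: less_induct)
    case less
    show ?case
    proof (cases "a = r")
      case True
      then show ?thesis using M(2) by (auto simp: insert_commute)
    next
      case False
      then have pa: "p a \<in> A" "\<delta> (p a) < \<delta> a" "{y, a, p a} \<in> K" using p less.prems by auto
      then have "{y, p a} \<in> M" using less.hyps by blast
      moreover have "{a, p a} \<in> M" using False less.prems M(2) by (auto simp: L_def)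
      moreover have "a \<noteq> p a" "y \<noteq> p a" using pa A by auto
      ultimately show ?thesis using closed[of y a "p a"] pa by blast
    qed
  qed
  have "{u, w} \<in> M"
    using closed[of u w y] uw yM[of u] yM[of w] A by (auto simp: insert_commute)
  with M xM uw show thesis by (intro that[of M]) auto
qed

text \<open>A breadth-first forest: \<delta> is the distance from the root and \<open>p\<close> a
  predecessor on a shortest path. The arbitrary choice of a root depends only on which points reach
  \<open>a\<close>, so it is constant on components.\<close>

lemma spanning_forest:
  fixes R :: "'a \<Rightarrow> 'a \<Rightarrow> bool" and z :: 'a
  assumes "symp R"
  obtains root p and \<delta> :: "'a \<Rightarrow> nat" where
    "\<And>a. R\<^sup>*\<^sup>* (root a) a" "\<And>a b. R a b \<Longrightarrow> root a = root b" "root z = z"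
    "\<And>a. root (root a) = root a"
    "\<And>a. a \<noteq> root a \<Longrightarrow> R (p a) a \<and> \<delta> (p a) < \<delta> a"
proof -
  have sym: "R\<^sup>*\<^sup>* a b \<Longrightarrow> R\<^sup>*\<^sup>* b a" for a b
    using assms by (meson symp_rtranclp sympD)
  define root where "root a = (if R\<^sup>*\<^sup>* z a then z else (SOME b. R\<^sup>*\<^sup>* b a))" for a
  have root: "R\<^sup>*\<^sup>* (root a) a" for a
    unfolding root_def by (auto intro: someI[of "\<lambda>b. R\<^sup>*\<^sup>* b a" a])
  have eq: "root a = root b" if "R\<^sup>*\<^sup>* a b" for a b
  proof -
    have "R\<^sup>*\<^sup>* c a \<longleftrightarrow> R\<^sup>*\<^sup>* c b" for c
      using that sym by (meson rtranclp_trans)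
    then show ?thesis by (simp add: root_def)
  qed
  define \<delta> where "\<delta> a = (LEAST n. (R ^^ n) (root a) a)" for a
  have ex: "\<exists>n. (R ^^ n) (root a) a" for a
    using root[of a] by (simp add: rtranclp_is_Sup_relpowp)
  have par: "\<exists>b. R b a \<and> \<delta> b < \<delta> a" if "a \<noteq> root a" for a
  proof -
    have \<delta>: "(R ^^ \<delta> a) (root a) a"
      unfolding \<delta>_def using ex by (rule LeastI_ex)
    with that obtain n where n: "\<delta> a = Suc n" by (cases "\<delta> a") auto
    with \<delta> obtain b where b: "(R ^^ n) (root a) b" "R b a" by (auto elim: relpowp_Suc_E)
    then have "root b = root a" using eq by blast
    then have "\<delta> b \<le> n" using b unfolding \<delta>_def by (auto intro: Least_le)
    with b n show ?thesis by auto
  qed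
  then obtain p where "\<And>a. a \<noteq> root a \<Longrightarrow> R (p a) a \<and> \<delta> (p a) < \<delta> a"
    by metis
  moreover have "root z = z" by (simp add: root_def)
  moreover have "root (root a) = root a" for a using eq[OF root] .
  ultimately show thesis
    using root eq by (intro that[of root p \<delta>]) blast+
qed

section \<open>Complexes given by a collinearity relation\<close>

text \<open>Read \<open>col a b\<close> as: some row that is not identically zero vanishes on both.
  In \<open>tri\<close>, such a row is 1 at \<open>c\<close>, since otherwise it would make
  \<open>a\<close> and \<open>c\<close> collinear. In \<open>non_tri\<close>, a row vanishing on two
  of the three vanishes on all, and \<open>d\<close> is a point where it is 1. Twins are kept out,
  since every two vertices are to span an edge.\<close>

locale collinearity_complex =
  fixes W :: "'a set" and H :: "'a set set" and col :: "'a \<Rightarrow> 'a \<Rightarrow> bool" and o' :: 'a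
  assumes W: "finite W" "o' \<in> W" and H: "down_closed H" "H \<subseteq> Pow W"
    and dim: "\<And>f. f \<in> H \<Longrightarrow> card f \<le> 3"
    and edges: "\<And>a b. a \<in> W \<Longrightarrow> b \<in> W \<Longrightarrow> {a, b} \<in> H"
    and col_sym: "col a b \<Longrightarrow> col b a" and col_in: "col a b \<Longrightarrow> a \<in> W \<and> b \<in> W \<and> a \<noteq> b"
    and tri: "\<lbrakk>col a b; \<not> col a c; c \<in> W; c \<noteq> a\<rbrakk> \<Longrightarrow> {a, b, c} \<in> H"
    and tri_col: "\<lbrakk>{a, b, c} \<in> H; card {a, b, c} = 3\<rbrakk> \<Longrightarrow> col a b \<or> col b c \<or> col a c"
    and non_tri: "\<lbrakk>{a, b, c} \<notin> H; card {a, b, c} = 3; col a b \<or> col b c \<or> col a c; {a, b, c} \<subseteq> W\<rbrakk> \<Longrightarrow>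
      \<exists>d. d \<notin> {a, b, c} \<and> {a, b, d} \<in> H \<and> {b, c, d} \<in> H \<and> {a, c, d} \<in> H"
begin

lemma finite_H: "finite H"
  using H W by (meson finite_Pow_iff finite_subset)

theorem buildable_H: "buildable H"
proof -
  have "symp col" using col_sym by (auto simp: symp_def)
  then obtain root p and \<delta> :: "'a \<Rightarrow> nat" where
    root_conn: "\<And>a. col\<^sup>*\<^sup>* (root a) a" and root_eq: "\<And>a b. col a b \<Longrightarrow> root a = root b"
    and root_o: "root o' = o'" and root_root: "\<And>a. root (root a) = root a"
    and parent: "\<And>a. a \<noteq> root a \<Longrightarrow> col (p a) a \<and> \<delta> (p a) < \<delta> a"
    by (rule spanning_forest[where z = o']) blast
  have root_p: "root (p a) = root a" "p a \<in> W" "p a \<noteq> a" "col a (p a)" if "a \<noteq> root a" for a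
    using parent[OF that] root_eq col_in col_sym by blast+
  have root_W: "root a \<in> W" if "a \<in> W" for a
    using root_conn[of a] that col_in by (cases rule: converse_rtranclpE) auto
  \<comment> \<open>For such a pair, a face \<open>{o', a, c}\<close> is impossible: it would
    contain a collinear pair and put two of its vertices into the same component.\<close>
  define cross where "cross a c \<longleftrightarrow> root a \<noteq> root c \<and> root a \<noteq> o' \<and> root c \<noteq> o'" for a c
  have cross_sym: "cross a c \<Longrightarrow> cross c a" for a c by (auto simp: cross_def)
  \<comment> \<open>Maximising inside the faces without crossing pairs keeps every crossing edge out
    of \<open>K1\<close>, so that these edges can be introduced later in a controlled way.\<close>
  define Hc where "Hc = {f \<in> H. \<forall>a\<in>f. \<forall>c\<in>f. \<not> cross a c}"
  have Hc: "down_closed Hc" "finite Hc" "Hc \<subseteq> H"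
    using H(1) finite_H by (auto simp: Hc_def down_closed_def) blast
  define star where "star = {f. insert o' f \<in> H}"
  have star_H: "star \<subseteq> H" unfolding star_def using H(1) down_closedD by blast
  have star_Hc: "star \<subseteq> Hc"
  proof
    fix f assume f: "f \<in> star"
    have "\<not> cross a c" if "a \<in> f" "c \<in> f" for a c
    proof
      assume cr: "cross a c"
      then have "a \<noteq> c" "a \<noteq> o'" "c \<noteq> o'" using root_o by (auto simp: cross_def)
      then have "card {o', a, c} = 3" by auto
      moreover have "{o', a, c} \<in> H" using f that H(1) by (auto simp: star_def intro: down_closedD)
      ultimately have "col o' a \<or> col a c \<or> col o' c" by (intro tri_col)
      then show False using cr root_eq root_o by (metis cross_def)
    qed
    then show "f \<in> Hc" using f star_H by (auto simp: Hc_def)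
  qed
  have col_star: "collapsible star"
    unfolding star_def using finite_H H(1) edges[of o' o'] W by (intro collapsible_star) auto
  obtain K1 where K1: "collapsible K1" "star \<subseteq> K1" "K1 \<subseteq> Hc"
    and closed1: "\<And>a b v. \<lbrakk>{a, b, v} \<in> Hc; a \<noteq> v; b \<noteq> v; {a, v} \<in> K1; {b, v} \<in> K1\<rbrakk> \<Longrightarrow> {a, b} \<in> K1"
    by (rule maximal_collapsible[OF Hc(2,1) col_star star_Hc]) blast
  have K1H: "K1 \<subseteq> H" using K1 Hc by blast
  have dcK1: "down_closed K1" using K1 collapsible_down_closed by blast
  have o_edge: "{o', a} \<in> K1" if "a \<in> W" for a
    using K1(2) edges[of o' a] that W by (auto simp: star_def)
  have vertex1: "{a} \<in> K1" if "a \<in> W" for a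
    using o_edge[OF that] dcK1 by (auto intro: down_closedD)
  have in_Hc: "{a, b, c} \<in> Hc" if "{a, b, c} \<in> H" "\<not> cross a b" "\<not> cross b c" "\<not> cross a c" for a b c
    using that cross_sym by (auto simp: Hc_def cross_def)
  \<comment> \<open>The triangle \<open>{a, p a, b}\<close> carries the edge from \<open>p a\<close>
    to \<open>a\<close>. Its side \<open>{a, p a}\<close> already lies in the star of
    \<open>o'\<close>, because \<open>a\<close> is collinear with its parent but not with
    \<open>o'\<close>.\<close>
  have slide_edge: "{a, b} \<in> K1"
    if a: "a \<in> W" "b \<in> W" "a \<noteq> b" "a \<noteq> o'" "\<not> col a b" "\<not> col a o'" "\<not> cross a b" "a \<noteq> root a" "{p a, b} \<in> K1" for a b
  proof -
    note pa = root_p[OF \<open>a \<noteq> root a\<close>]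
    have ne: "p a \<noteq> b" "p a \<noteq> o'" using pa a by auto
    have "{a, p a, b} \<in> H" using tri[OF pa(4), of b] a by auto
    moreover have "\<not> cross a (p a)" "\<not> cross (p a) b" using pa a by (auto simp: cross_def)
    ultimately have "{a, p a, b} \<in> Hc" using a by (intro in_Hc) auto
    moreover have "{a, p a, o'} \<in> H" using tri[OF pa(4), of o'] a W by auto
    then have "{a, p a} \<in> K1" using K1(2) by (auto simp: star_def insert_commute)
    ultimately show ?thesis
      using closed1[of a b "p a"] pa ne a by (auto simp: insert_commute)
  qed
  have edge1: "{a, b} \<in> K1" if "a \<in> W" "b \<in> W" "a \<noteq> b" "\<not> cross a b" for a b
    using that
  proof (induction "\<delta> a + \<delta> b" arbitrary: a b rule: less_induct)
    case less
    note ab = less.prems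
    consider "a = o' \<or> b = o'" | "{o', a, b} \<in> H"
      | "a \<noteq> o'" "b \<noteq> o'" "{o', a, b} \<notin> H" "col o' a \<or> col a b \<or> col o' b"
      | "a \<noteq> o'" "b \<noteq> o'" "\<not> col o' a" "\<not> col a b" "\<not> col o' b" by blast
    then show ?case
    proof cases
      case 1
      then show ?thesis using o_edge ab by (auto simp: insert_commute)
    next
      case 2
      then show ?thesis using K1(2) by (auto simp: star_def)
    next
      case 3
      then have "card {o', a, b} = 3" "{o', a, b} \<subseteq> W" using ab W by auto
      \<comment> \<open>The point \<open>d\<close> off the common zero set spans star triangles with
        \<open>o'\<close> and each of \<open>a\<close>, \<open>b\<close>. Two sides of
        \<open>{a, b, d}\<close> are therefore present, and the third follows by an
        expansion.\<close>
      with 3 obtain d where d: "d \<notin> {o', a, b}" "{o', a, d} \<in> H" "{a, b, d} \<in> H" "{o', b, d} \<in> H"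
        using non_tri[of o' a b] by blast
      then have K: "{a, d} \<in> K1" "{b, d} \<in> K1" using K1(2) by (auto simp: star_def)
      then have "\<not> cross a d" "\<not> cross b d" using K1(3) by (auto simp: Hc_def)
      then have "{a, b, d} \<in> Hc" using d ab by (intro in_Hc)
      then show ?thesis using closed1[of a b d] K d by blast
    next
      case 4
      have sym: "\<not> col a o'" "\<not> col b o'" "\<not> col b a" using 4 col_sym by blast+
      show ?thesis
      proof (cases "a = root a")
        case False
        note pa = root_p[OF False]
        have "{p a, b} \<in> K1"
          using pa parent[OF False] ab 4 by (intro less.hyps) (auto simp: cross_def)
        then show ?thesis using slide_edge[of a b] ab 4 sym False by blast
      next
        case a: True
        show ?thesis
        proof (cases "b = root b")
          case False
          note pb = root_p[OF False]
          have "{p b, a} \<in> K1"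
            using pb parent[OF False] ab sym by (intro less.hyps) (auto simp: cross_def)
          then have "{b, a} \<in> K1" using slide_edge[of b a] ab 4 sym False cross_sym by blast
          then show ?thesis by (simp add: insert_commute)
        next
          \<comment> \<open>Two roots that do not cross are equal or include \<open>o'\<close>, both
            excluded here.\<close>
          case True
          with a 4 ab show ?thesis by (auto simp: cross_def)
        qed
      qed
    qed
  qed
  define C where "C = {{a, c} | a c. a \<in> W \<and> c \<in> W \<and> a = root a \<and> c = root c \<and> cross a c}"
  have CH: "C \<subseteq> H" using edges by (auto simp: C_def)
  have ne: "a \<noteq> c" if "cross a c" for a c using that by (auto simp: cross_def)
  have K2: "buildable (K1 \<union> C)"
  proof (rule buildable_attach_edges)
    show "finite C" using CH finite_H finite_subset by blast
    show "buildable K1" using K1 collapsible_imp_buildable by blast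
    show "card e = 2 \<and> (\<exists>Z. collapsible Z \<and> Z \<subseteq> K1 \<and> proper_faces e \<subseteq> Z)" if eC: "e \<in> C" for e
    proof -
      obtain a c where e: "e = {a, c}" "a \<in> W" "c \<in> W" "cross a c" using eC by (auto simp: C_def)
      then have "proper_faces e \<subseteq> K1" using vertex1 dcK1 by (simp add: proper_faces_edge_subset)
      moreover have "card e = 2" using e ne by (auto simp: card_2_iff)
      ultimately show ?thesis using K1 by blast
    qed
  qed
  define E where "E = {{a, c} | a c. a \<in> W \<and> c \<in> W \<and> a \<noteq> root a \<and> cross a c}"
  \<comment> \<open>If neither end is a root, the edge could be slid at either of them;
    \<open>t\<close> settles on one. The other possibility has to be recovered in
    \<open>slide\<close>.\<close>
  define t where "t e = p (SOME a. \<exists>c. e = {a, c} \<and> a \<in> W \<and> c \<in> W \<and> a \<noteq> root a \<and> cross a c)" for e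
  have tE: "\<exists>a c. e = {a, c} \<and> a \<in> W \<and> c \<in> W \<and> a \<noteq> root a \<and> cross a c \<and> t e = p a" if "e \<in> E" for e
  proof -
    let ?P = "\<lambda>a. \<exists>c. e = {a, c} \<and> a \<in> W \<and> c \<in> W \<and> a \<noteq> root a \<and> cross a c"
    have "\<exists>a. ?P a" using that by (auto simp: E_def)
    then have "?P (SOME a. ?P a)" by (rule someI_ex)
    then show ?thesis unfolding t_def by blast
  qed
  have slide_H: "{p a, a, c} \<in> H" "p a \<noteq> c" if "a \<in> W" "c \<in> W" "a \<noteq> root a" "cross a c" for a c
  proof -
    note pa = root_p[OF that(3)]
    show "p a \<noteq> c" using pa that by (auto simp: cross_def)
    have "\<not> col a c" using that root_eq by (auto simp: cross_def)
    then show "{p a, a, c} \<in> H" using tri[OF pa(4), of c] that ne by (auto simp: insert_commute)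
  qed
  have E1: "card e = 2 \<and> t e \<notin> e \<and> insert (t e) e \<in> H" if eE: "e \<in> E" for e
  proof -
    obtain a c where e: "e = {a, c}" "a \<in> W" "c \<in> W" "a \<noteq> root a" "cross a c" "t e = p a"
      using tE[OF eE] by blast
    then show ?thesis
      using slide_H[of a c] root_p(3)[of a] ne[of a c] by (auto simp: card_2_iff)
  qed
  have E2: "E \<inter> (K1 \<union> C) = {}"
  proof -
    have "{a, c} \<notin> K1" if "cross a c" for a c using that K1(3) by (auto simp: Hc_def)
    moreover have "{a, c} \<notin> C" if "a \<noteq> root a" for a c
      using that by (auto simp: C_def doubleton_eq_iff)
    ultimately show ?thesis by (auto simp: E_def)
  qed
  have K2H: "K1 \<union> C \<subseteq> H" using K1H CH by blast
  obtain K3 where K3: "buildable K3" "K1 \<union> C \<subseteq> K3" "K3 \<subseteq> H"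
    and slide3: "\<And>e. \<lbrakk>e \<in> E; e \<in> K3\<rbrakk> \<Longrightarrow> insert (t e) e \<in> K3"
    and edge3: "\<And>a b. \<lbrakk>{a, b} \<in> E; {a, t {a, b}} \<in> K3; {b, t {a, b}} \<in> K3\<rbrakk> \<Longrightarrow> {a, b} \<in> K3"
    and tri3: "\<And>a b c Z. \<lbrakk>{a, b, c} \<in> H; card {a, b, c} = 3; collapsible Z; Z \<subseteq> K3;
        {a, b} \<in> Z; {b, c} \<in> Z; {a, c} \<in> Z\<rbrakk> \<Longrightarrow> {a, b, c} \<in> K3"
    by (rule maximal_buildable[OF finite_H H(1) K2 K2H E1 E2]) blast+
  have dcK3: "down_closed K3" using K3 buildable_down_closed by blast
  have finK3: "finite K3" using K3 finite_H finite_subset by blast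
  have cross_edge: "{a, c} \<in> K3" if "a \<in> W" "c \<in> W" "cross a c" for a c
    using that
  proof (induction "\<delta> a + \<delta> c" arbitrary: a c rule: less_induct)
    case less
    show ?case
    proof (cases "a = root a \<and> c = root c")
      case True
      then have "{a, c} \<in> C" using less.prems by (auto simp: C_def)
      then show ?thesis using K3 by blast
    next
      case False
      then have "{a, c} \<in> E" using less.prems cross_sym by (auto simp: E_def)
      then obtain a' c' where e: "{a, c} = {a', c'}" "a' \<in> W" "c' \<in> W" "a' \<noteq> root a'" "cross a' c'"
        "t {a, c} = p a'" using tE by metis
      note pa = root_p[OF e(4)]
      have sum: "\<delta> a + \<delta> c = \<delta> a' + \<delta> c'" using e(1) by (auto simp: doubleton_eq_iff)
      have "{p a', c'} \<in> K3"
        using sum parent[OF e(4)] pa e by (intro less.hyps) (auto simp: cross_def)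
      moreover have "{a', p a'} \<in> K3"
        using edge1[of a' "p a'"] pa e K3 by (auto simp: cross_def)
      ultimately have "{a', c'} \<in> K3"
        using edge3[of a' c'] \<open>{a, c} \<in> E\<close> e by (simp add: insert_commute)
      then show ?thesis using e by simp
    qed
  qed
  have slide: "{p a, a, c} \<in> K3" if "a \<in> W" "c \<in> W" "a \<noteq> root a" "cross a c" for a c
    using that
  proof (induction "\<delta> a + \<delta> c" arbitrary: a c rule: less_induct)
    case less
    note ac = less.prems
    have E: "{a, c} \<in> E" using ac by (auto simp: E_def)
    then obtain a' c' where e: "{a, c} = {a', c'}" "a' \<noteq> root a'" "t {a, c} = p a'" using tE by metis
    have ins: "insert (t {a, c}) {a, c} \<in> K3" using slide3[OF E] cross_edge ac by blast
    show ?case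
    proof (cases "a' = a")
      case True
      then show ?thesis using ins e by simp
    next
      case False
      then have c: "c \<noteq> root c" "t {a, c} = p c" using e by (auto simp: doubleton_eq_iff)
      note pa = root_p[OF ac(3)] and pc = root_p[OF c(1)]
      \<comment> \<open>Here \<open>t\<close> has chosen \<open>c\<close>. Of the tetrahedron on
        \<open>a\<close>, \<open>p a\<close>, \<open>c\<close>, \<open>p c\<close>, the three
        triangles at \<open>p c\<close> are present, one by that choice and two by induction, so the
        missing one can be attached.\<close>
      have "{p a, a, p c} \<in> K3"
        using ac pc parent[OF c(1)] by (intro less.hyps) (auto simp: cross_def)
      moreover have "{p c, c, p a} \<in> K3"
        using ac pa c parent[OF ac(3)] by (intro less.hyps) (auto simp: cross_def)
      ultimately obtain Z where "collapsible Z" "Z \<subseteq> K3" "{p a, a} \<in> Z" "{a, c} \<in> Z" "{p a, c} \<in> Z"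
        using tetrahedron_boundary_collapsible[of K3 "p c" "p a" a c] finK3 dcK3 ins c(2)
        by (auto simp: insert_commute)
      moreover have "card {p a, a, c} = 3" using pa slide_H(2)[OF ac] ne[OF ac(4)] by auto
      ultimately show ?thesis using tri3[of "p a" a c Z] slide_H(1)[OF ac] by blast
    qed
  qed
  have cross_tri: "{c, a, b} \<in> K3" if ab: "col a b" and c: "c \<in> W" "cross c a" for a b c
  proof -
    \<comment> \<open>The suspension argument over the component of \<open>a\<close>, with apexes
      \<open>c\<close> and \<open>o'\<close>. The component avoids \<open>o'\<close>, so none of its
      points is collinear with \<open>o'\<close>, and all its collinear pairs span triangles of the
      star; over the tree edges, \<open>slide\<close> provides the cone from
      \<open>c\<close>.\<close>
    let ?A = "{u \<in> W. root u = root a}"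
    have abW: "a \<in> W" "b \<in> W" "a \<noteq> b" using col_in[OF ab] by auto
    have cu: "cross u c" if "u \<in> ?A" for u using that c by (auto simp: cross_def)
    have oH: "{o', u, w} \<in> K3" if "u \<in> ?A" "col u w" for u w
    proof -
      have "\<not> col u o'" using that c root_eq[of u o'] root_o by (auto simp: cross_def)
      moreover have "o' \<noteq> u" using that c root_o by (auto simp: cross_def)
      ultimately have "{u, w, o'} \<in> H" using tri[OF that(2), of o'] W by blast
      then have "{o', u, w} \<in> star" by (simp add: star_def insert_commute)
      then show ?thesis using K1 K3 by blast
    qed
    have "finite ?A" using W by auto
    moreover have "c \<notin> ?A" "o' \<notin> ?A" "c \<noteq> o'" "root a \<in> ?A"
      using c root_o root_root root_W[OF abW(1)] by (auto simp: cross_def)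
    moreover have "p u \<in> ?A \<and> \<delta> (p u) < \<delta> u \<and> {c, u, p u} \<in> K3 \<and> {o', u, p u} \<in> K3"
      if "u \<in> ?A" "u \<noteq> root a" for u
    proof -
      have u: "u \<noteq> root u" using that by auto
      note pu = root_p[OF u]
      have "{p u, u, c} \<in> K3" using slide[of u c] that c u cu by auto
      then have "{c, u, p u} \<in> K3" by (simp add: insert_commute)
      then show ?thesis using pu parent[OF u] that oH[of u "p u"] by auto
    qed
    moreover have "{c, root a} \<in> K3"
      using cross_edge[of c "root a"] c root_root root_W[OF abW(1)] by (auto simp: cross_def)
    moreover have "{o', root a} \<in> K3" using o_edge[OF root_W[OF abW(1)]] K3 by blast
    moreover have "a \<in> ?A" "b \<in> ?A" "{o', a, b} \<in> K3" using abW root_eq[OF ab] oH ab by auto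
    ultimately obtain Z where "collapsible Z" "Z \<subseteq> K3" "{c, a} \<in> Z" "{a, b} \<in> Z" "{c, b} \<in> Z"
      by (rule suspension_collapsible[OF finK3 dcK3]) blast
    moreover have "c \<noteq> a" "c \<noteq> b" using \<open>c \<notin> ?A\<close> \<open>a \<in> ?A\<close> \<open>b \<in> ?A\<close> by auto
    then have "card {c, a, b} = 3" using abW by auto
    moreover have "\<not> col a c" using c root_eq[of a c] by (auto simp: cross_def)
    then have "{a, b, c} \<in> H" using tri[OF ab] c \<open>c \<noteq> a\<close> by blast
    ultimately show ?thesis using tri3[of c a b Z] by (auto simp: insert_commute)
  qed
  have "f \<in> K3" if f: "f \<in> H" for f
  proof -
    have fW: "f \<subseteq> W" using f H by auto
    have "finite f" using fW W finite_subset by blast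
    consider "card f = 0" | "card f = 1" | "card f = 2" | "card f = 3" using dim[OF f] by linarith
    then show ?thesis
    proof cases
      case 1
      then show ?thesis using \<open>finite f\<close> dcK3 by (auto simp: down_closed_def)
    next
      case 2
      then obtain a where "f = {a}" using card_1_singletonE by blast
      then show ?thesis using vertex1 K3 fW by blast
    next
      case 3
      then obtain a b where "f = {a, b}" "a \<noteq> b" by (auto simp: card_2_iff)
      then show ?thesis using edge1[of a b] cross_edge[of a b] K3 fW by blast
    next
      case 4
      then obtain a b c where abc: "f = {a, b, c}" "a \<noteq> b" "b \<noteq> c" "a \<noteq> c" by (auto simp: card_3_iff)
      show ?thesis
      proof (cases "cross a b \<or> cross b c \<or> cross a c")
        case False
        then have "{a, b} \<in> K1" "{b, c} \<in> K1" "{a, c} \<in> K1" using edge1 abc fW by auto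
        \<comment> \<open>Without a crossing pair the whole boundary lies in \<open>K1\<close>,
          which is itself collapsible and serves as \<open>Z\<close>.\<close>
        then show ?thesis using tri3[of a b c K1] abc f 4 K1 K3 by auto
      next
        case True
        have W3: "a \<in> W" "b \<in> W" "c \<in> W" using abc fW by auto
        \<comment> \<open>A collinear pair stays within one component, so any crossing in the triple
          involves the remaining vertex and then holds with both ends of the pair.\<close>
        have "col a b \<or> col b c \<or> col a c" using tri_col f 4 abc by blast
        then consider "col a b" | "col b c" | "col a c" by blast
        then show ?thesis
        proof cases
          case 1
          then have "cross c a" using True root_eq[OF 1] by (auto simp: cross_def)
          then have "{c, a, b} \<in> K3" using cross_tri[OF 1] W3 by blast
          then show ?thesis using abc by (simp add: insert_commute)
        next
          case 2
          then have "cross a b" using True root_eq[OF 2] by (auto simp: cross_def)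
          then have "{a, b, c} \<in> K3" using cross_tri[OF 2] W3 by blast
          then show ?thesis using abc by (simp add: insert_commute)
        next
          case 3
          then have "cross b a" using True root_eq[OF 3] by (auto simp: cross_def)
          then have "{b, a, c} \<in> K3" using cross_tri[OF 3] W3 by blast
          then show ?thesis using abc by (simp add: insert_commute)
        qed
      qed
    qed
  qed
  then have "K3 = H" using K3 by blast
  then show ?thesis using K3 by simp
qed

end

section \<open>Boolean representable complexes\<close>

text \<open>The new vertex has the same link as \<open>a\<close> and spans no edge with it. As faces
  have at most three vertices, this link is a graph, with vertices \<open>L\<close> and edges
  \<open>R\<close>. The cone from \<open>x\<close> over it costs one attached edge for each
  component other than that of \<open>z\<close>, and attached triangles only off the spanning
  trees.\<close>

lemma twin_extension:
  assumes H: "finite H" "down_closed H" and dim: "\<And>f. f \<in> H \<Longrightarrow> card f \<le> 3"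
    and U: "finite U" "buildable {f \<in> H. f \<subseteq> U}" "a \<in> U" "x \<notin> U"
    and x: "{x} \<in> H" "{a, x} \<notin> H"
    and twin: "\<And>f. a \<notin> f \<Longrightarrow> x \<notin> f \<Longrightarrow> insert x f \<in> H \<longleftrightarrow> insert a f \<in> H"
    and z: "z \<in> U" "z \<noteq> a" "{a, z} \<in> H"
  shows "buildable {f \<in> H. f \<subseteq> insert x U}"
proof -
  define K where "K = {f \<in> H. f \<subseteq> U}"
  define H' where "H' = {f \<in> H. f \<subseteq> insert x U}"
  have K: "buildable K" "down_closed K" "K \<subseteq> H'"
    using U buildable_down_closed by (auto simp: K_def H'_def)
  have H': "finite H'" "down_closed H'"
    using H by (auto simp: H'_def down_closed_def)
  have [simp]: "a \<noteq> x" "x \<noteq> a" using U by auto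
  define R where "R u w \<longleftrightarrow> u \<in> U \<and> w \<in> U \<and> u \<noteq> a \<and> w \<noteq> a \<and> u \<noteq> w \<and> {a, u, w} \<in> H" for u w
  have R: "symp R" by (auto simp: symp_def R_def insert_commute)
  define L where "L = {u \<in> U. u \<noteq> a \<and> {a, u} \<in> H}"
  have RL: "u \<in> L \<and> w \<in> L" if "R u w" for u w
    using that H(2) by (auto simp: R_def L_def intro: down_closedD)
  obtain root p and \<delta> :: "'a \<Rightarrow> nat" where
    root_conn: "\<And>u. R\<^sup>*\<^sup>* (root u) u" and root_eq: "\<And>u w. R u w \<Longrightarrow> root u = root w"
    and root_z: "root z = z" and root_root: "\<And>u. root (root u) = root u"
    and parent: "\<And>u. u \<noteq> root u \<Longrightarrow> R (p u) u \<and> \<delta> (p u) < \<delta> u"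
    by (rule spanning_forest[where z = z, OF R]) blast
  have root_L: "root u \<in> L" if "u \<in> L" for u
    using root_conn[of u] that RL by (cases rule: converse_rtranclpE) auto
  have zL: "z \<in> L" using z by (auto simp: L_def)
  have LU: "u \<in> U" "u \<noteq> a" "u \<noteq> x" if "u \<in> L" for u using that U by (auto simp: L_def)
  have xL: "{x, u} \<in> H'" if "u \<in> L" for u
    using twin[of "{u}"] LU[OF that] that by (auto simp: H'_def L_def)
  have xR: "{x, u, w} \<in> H'" if "R u w" for u w
    using twin[of "{u, w}"] that U by (auto simp: H'_def R_def)
  \<comment> \<open>The first edge at \<open>x\<close> is an expansion, since it brings in the
    vertex \<open>x\<close>. That is why the component of \<open>z\<close> contributes no
    1-sphere.\<close>
  define K1 where "K1 = K \<union> {{x}, {z, x}}"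
  have "{z} \<in> K" using z H(2) by (auto simp: K_def intro: down_closedD)
  moreover have xK: "x \<notin> f" if "f \<in> K" for f using that U by (auto simp: K_def)
  ultimately have "free_face K {x} z" using K(2) by (intro free_face_vertex) auto
  then have K1: "buildable K1" unfolding K1_def by (intro buildable.expansion K)
  have dcK1: "down_closed K1" using K1 buildable_down_closed by blast
  have K1H: "K1 \<subseteq> H'" using K(3) xL[OF zL] x by (auto simp: K1_def H'_def insert_commute)
  have finK1: "finite K1" using K1H H' finite_subset by blast
  have aL: "{a, u} \<in> K1" if "u \<in> L" for u using that U by (auto simp: K1_def K_def L_def)
  have aK: "{a} \<in> K1" using aL[OF zL] dcK1 by (auto intro: down_closedD)
  \<comment> \<open>Growing from \<open>a\<close>, this subcomplex reaches every vertex of the link,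
    and \<open>x\<close> through \<open>z\<close>. It therefore contains both ends of each edge
    about to be attached.\<close>
  obtain Z where Z: "collapsible Z" "{{}, {a}} \<subseteq> Z" "Z \<subseteq> K1"
    and Zv: "\<And>u w. \<lbrakk>{u, w} \<in> K1; {u} \<in> Z\<rbrakk> \<Longrightarrow> {w} \<in> Z"
    by (rule maximal_collapsible[OF finK1 dcK1 collapsible.vertex[of a]])
      (use aK dcK1 in \<open>auto simp: down_closed_def\<close>)
  have ZL: "{u} \<in> Z" if "u \<in> L" for u using Zv[OF aL[OF that]] Z by auto
  have "{x} \<in> Z" using Zv[of z x] ZL[OF zL] by (simp add: K1_def)
  define C where "C = {{x, u} | u. u \<in> L \<and> u = root u}"
  have "C \<subseteq> H'" using xL by (auto simp: C_def)
  then have finC: "finite C" using H' finite_subset by blast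
  have K2: "buildable (K1 \<union> C)"
  proof (rule buildable_attach_edges[OF finC K1])
    fix e assume "e \<in> C"
    then obtain u where u: "e = {x, u}" "u \<in> L" by (auto simp: C_def)
    then have "proper_faces e \<subseteq> Z"
      using proper_faces_edge_subset[OF collapsible_down_closed[OF Z(1)] \<open>{x} \<in> Z\<close> ZL] by blast
    moreover have "card e = 2" using u LU(3)[of u] by auto
    ultimately show "card e = 2 \<and> (\<exists>Z. collapsible Z \<and> Z \<subseteq> K1 \<and> proper_faces e \<subseteq> Z)"
      using Z by blast
  qed
  define E where "E = {{x, u} | u. u \<in> L \<and> u \<noteq> root u}"
  define t where "t e = p (THE u. e = {x, u})" for e
  have t: "t {x, u} = p u" if "u \<in> L" for u
  proof -
    have "(THE u'. {x, u} = {x, u'}) = u" by (rule the_equality) (auto simp: doubleton_eq_iff)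
    then show ?thesis by (simp add: t_def)
  qed
  have pL: "p u \<in> L" "{x, u, p u} \<in> H'" "p u \<noteq> u" if "u \<noteq> root u" for u
    using RL[of "p u" u] xR[of "p u" u] parent[OF that] by (auto simp: insert_commute R_def)
  have E1: "card e = 2 \<and> t e \<notin> e \<and> insert (t e) e \<in> H'" if eE: "e \<in> E" for e
  proof -
    obtain u where u: "e = {x, u}" "u \<in> L" "u \<noteq> root u" using eE by (auto simp: E_def)
    have ne: "x \<noteq> u" "x \<noteq> p u" "p u \<noteq> u"
      using LU(3)[OF u(2)] LU(3)[OF pL(1)[OF u(3)]] pL(3)[OF u(3)] by blast+
    have "insert (p u) {x, u} = {x, u, p u}" by blast
    with ne show ?thesis
      unfolding u(1) t[OF u(2)] using pL(2)[OF u(3)] by simp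
  qed
  have E2: "E \<inter> (K1 \<union> C) = {}"
  proof -
    have "{x, u} \<notin> K1 \<union> C" if "u \<noteq> root u" "u \<in> L" for u
      using that LU(3)[OF that(2)] xK[of "{x, u}"] root_z by (auto simp: K1_def C_def doubleton_eq_iff)
    then show ?thesis by (auto simp: E_def)
  qed
  have K2H: "K1 \<union> C \<subseteq> H'" using K1H \<open>C \<subseteq> H'\<close> by blast
  obtain K3 where K3: "buildable K3" "K1 \<union> C \<subseteq> K3" "K3 \<subseteq> H'"
    and slide3: "\<And>e. \<lbrakk>e \<in> E; e \<in> K3\<rbrakk> \<Longrightarrow> insert (t e) e \<in> K3"
    and edge3: "\<And>u w. \<lbrakk>{u, w} \<in> E; {u, t {u, w}} \<in> K3; {w, t {u, w}} \<in> K3\<rbrakk> \<Longrightarrow> {u, w} \<in> K3"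
    and tri3: "\<And>u w c Z. \<lbrakk>{u, w, c} \<in> H'; card {u, w, c} = 3; collapsible Z; Z \<subseteq> K3;
        {u, w} \<in> Z; {w, c} \<in> Z; {u, c} \<in> Z\<rbrakk> \<Longrightarrow> {u, w, c} \<in> K3"
    by (rule maximal_buildable[OF H' K2 K2H E1 E2]) blast+
  have dcK3: "down_closed K3" using K3 buildable_down_closed by blast
  have finK3: "finite K3" using K3 H' finite_subset by blast
  have K3K: "K \<subseteq> K3" using K3 by (auto simp: K1_def)
  have xu: "{x, u} \<in> K3" if "u \<in> L" for u
    using that
  proof (induction "\<delta> u" arbitrary: u rule: less_induct)
    case less
    show ?case
    proof (cases "u = root u")
      case True
      then have "{x, u} \<in> C" using less.prems by (auto simp: C_def)
      then show ?thesis using K3 by blast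
    next
      case False
      then have "{x, p u} \<in> K3" using less.hyps parent[OF False] pL[OF False] by blast
      moreover have "R (p u) u" using parent[OF False] by blast
      then have "{u, p u} \<in> K" using H(2) by (auto simp: K_def R_def insert_commute intro: down_closedD)
      moreover have "{x, u} \<in> E" using less.prems False by (auto simp: E_def)
      ultimately show ?thesis using edge3[of x u] t[OF less.prems] K3K by auto
    qed
  qed
  have slide: "{x, u, p u} \<in> K3" if "u \<in> L" "u \<noteq> root u" for u
  proof -
    have "{x, u} \<in> E" using that by (auto simp: E_def)
    then have "insert (t {x, u}) {x, u} \<in> K3" using slide3 xu that by blast
    then show ?thesis using t that by (simp add: insert_commute)
  qed
  have tri: "{x, u, w} \<in> K3" if Ruw: "R u w" for u w
  proof -
    \<comment> \<open>The suspension argument over one component of the link: the cone from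
      \<open>a\<close> is complete, and the one from \<open>x\<close> is already there over the
      spanning tree.\<close>
    let ?A = "{v \<in> L. root v = root u}"
    have uwL: "u \<in> L" "w \<in> L" using RL[OF Ruw] by auto
    have aR: "{a, v, v'} \<in> K3" if "R v v'" for v v'
      using that U K3K by (auto simp: R_def K_def)
    have "finite ?A" using U by (auto simp: L_def)
    moreover have "x \<notin> ?A" "a \<notin> ?A" "root u \<in> ?A"
      using LU root_root root_L[OF uwL(1)] by auto
    moreover have "p v \<in> ?A \<and> \<delta> (p v) < \<delta> v \<and> {x, v, p v} \<in> K3 \<and> {a, v, p v} \<in> K3"
      if "v \<in> ?A" "v \<noteq> root u" for v
    proof -
      have v: "v \<noteq> root v" "v \<in> L" using that by auto
      then show ?thesis
        using parent[OF v(1)] pL[OF v(1)] root_eq[of "p v" v] slide[OF v(2,1)] aR[of v "p v"] that R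
        by (auto dest: sympD)
    qed
    moreover have "{x, root u} \<in> K3" using xu root_L uwL by blast
    moreover have "{a, root u} \<in> K3" using aL root_L uwL K3 by blast
    moreover have "u \<in> ?A" "w \<in> ?A" "{a, u, w} \<in> K3" using uwL root_eq[OF Ruw] aR Ruw by auto
    ultimately obtain Z where "collapsible Z" "Z \<subseteq> K3" "{x, u} \<in> Z" "{u, w} \<in> Z" "{x, w} \<in> Z"
      by (rule suspension_collapsible[OF finK3 dcK3 _ _ _ \<open>x \<noteq> a\<close>]) blast
    moreover have "card {x, u, w} = 3" using LU[OF uwL(1)] LU[OF uwL(2)] Ruw by (auto simp: R_def)
    ultimately show ?thesis using tri3[of x u w Z] xR[OF Ruw] by blast
  qed
  have "f \<in> K3" if f: "f \<in> H'" for f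
  proof (cases "x \<in> f")
    case False
    then have "f \<in> K" using f by (auto simp: K_def H'_def)
    then show ?thesis using K3K by blast
  next
    case True
    define g where "g = f - {x}"
    have fg: "f = insert x g" "x \<notin> g" using True by (auto simp: g_def)
    have fH: "f \<in> H" "g \<subseteq> U" using f by (auto simp: H'_def g_def)
    then have "finite g" using U finite_subset by blast
    have "a \<notin> g"
    proof
      assume "a \<in> g"
      then have "{a, x} \<subseteq> f" using fg by auto
      then show False using fH x H(2) down_closedD by blast
    qed
    then have gH: "insert a g \<in> H" using twin[of g] fg fH by simp
    have "card g \<le> 2" using dim[OF fH(1)] fg \<open>finite g\<close> by simp
    then consider "card g = 0" | "card g = 1" | "card g = 2" by linarith
    then show ?thesis
    proof cases
      case 1
      then have "g = {}" using \<open>finite g\<close> by simp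
      then have "f = {x}" using fg by simp
      then show ?thesis using K3 by (auto simp: K1_def)
    next
      case 2
      then obtain u where "g = {u}" using card_1_singletonE by blast
      then have "u \<in> L" "f = {x, u}" using gH fH \<open>a \<notin> g\<close> fg by (auto simp: L_def)
      then show ?thesis using xu by simp
    next
      case 3
      then obtain u w where uw: "g = {u, w}" "u \<noteq> w" by (auto simp: card_2_iff)
      then have "R u w" using gH fH \<open>a \<notin> g\<close> by (auto simp: R_def)
      then show ?thesis using tri uw fg by simp
    qed
  qed
  then have "K3 = H'" using K3 by blast
  then show ?thesis using K3 by (simp add: H'_def)
qed

section \<open>Independent column sets of a boolean matrix\<close>

lemma bij_betw_Suc_shift:
  assumes "bij_betw h {..<Suc m} S"
  shows "bij_betw (h \<circ> Suc) {..<m} (S - {h 0})"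
proof -
  have inj: "inj_on h {..<Suc m}" and im: "h ` {..<Suc m} = S" using assms by (auto simp: bij_betw_def)
  have split: "{..<Suc m} = insert 0 (Suc ` {..<m})"
    by (auto simp: image_iff less_Suc_eq_0_disj)
  have "inj_on (h \<circ> Suc) {..<m}" using inj by (auto simp: inj_on_def)
  moreover have "(h \<circ> Suc) ` {..<m} = S - {h 0}"
  proof -
    have "S = insert (h 0) (h ` Suc ` {..<m})" using im split by auto
    moreover have "h 0 \<notin> h ` Suc ` {..<m}" using inj by (auto simp: inj_on_def)
    ultimately show ?thesis by (simp add: image_comp)
  qed
  ultimately show ?thesis by (simp add: bij_betw_def)
qed

text \<open>Peeling off the first row and column of the unitriangular form: that row has its only 1
  in the first column. Conversely, the row \<open>r\<close> is new to \<open>Y\<close>, since it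
  vanishes on \<open>X - {y}\<close> while every row of \<open>Y\<close> has a 1 on the
  diagonal.\<close>

lemma M_independent_remove:
  assumes "X \<noteq> {}"
  shows "M_independent M R X \<longleftrightarrow>
     (\<exists>y\<in>X. \<exists>r\<in>R. M r y \<and> (\<forall>z\<in>X - {y}. \<not> M r z) \<and> M_independent M R (X - {y}))"
    (is "?L \<longleftrightarrow> ?R")
proof
  assume ?L
  then obtain Y where Y: "Y \<subseteq> R" and "boolean_nonsingular M Y X"
    unfolding M_independent_def by blast
  then obtain n :: nat and f g where fg: "bij_betw f {..<n} Y" "bij_betw g {..<n} X"
    and diag: "\<forall>i<n. M (f i) (g i)" and upper: "\<forall>i j. i < j \<and> j < n \<longrightarrow> \<not> M (f i) (g j)"
    unfolding boolean_nonsingular_def by blast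
  have "n \<noteq> 0" using fg(2) assms by (auto simp: bij_betw_def)
  then obtain m where n: "n = Suc m" by (cases n) auto
  have gX: "bij_betw (g \<circ> Suc) {..<m} (X - {g 0})" and fY: "bij_betw (f \<circ> Suc) {..<m} (Y - {f 0})"
    using fg bij_betw_Suc_shift unfolding n by blast+
  have "M_independent M R (X - {g 0})"
    unfolding M_independent_def boolean_nonsingular_def
  proof (intro exI[of _ "Y - {f 0}"] conjI exI[of _ m] exI[of _ "f \<circ> Suc"] exI[of _ "g \<circ> Suc"] allI impI)
  qed (use Y fY gX diag upper n in auto)
  moreover have "g 0 \<in> X" "f 0 \<in> R" using fg Y n by (auto simp: bij_betw_def)
  moreover have "\<not> M (f 0) z" if "z \<in> X - {g 0}" for z
  proof -
    have "z \<in> (g \<circ> Suc) ` {..<m}" using gX that by (simp add: bij_betw_def)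
    then show ?thesis using upper n by auto
  qed
  moreover have "M (f 0) (g 0)" using diag n by simp
  ultimately show ?R by blast
next
  assume ?R
  then obtain y r where y: "y \<in> X" "r \<in> R" "M r y" "\<And>z. z \<in> X - {y} \<Longrightarrow> \<not> M r z"
    and ind: "M_independent M R (X - {y})" by blast
  obtain Y where Y: "Y \<subseteq> R" and "boolean_nonsingular M Y (X - {y})"
    using ind unfolding M_independent_def by blast
  then obtain n :: nat and f g where fg: "bij_betw f {..<n} Y" "bij_betw g {..<n} (X - {y})"
    and diag: "\<forall>i<n. M (f i) (g i)" and upper: "\<forall>i j. i < j \<and> j < n \<longrightarrow> \<not> M (f i) (g j)"
    unfolding boolean_nonsingular_def by blast
  have gin: "g i \<in> X - {y}" if "i < n" for i using fg(2) that by (auto simp: bij_betw_def)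
  have rY: "r \<notin> Y"
  proof
    assume "r \<in> Y"
    then obtain i where "i < n" "r = f i" using fg(1) by (auto simp: bij_betw_def)
    then show False using diag y(4) gin by blast
  qed
  show ?L
    unfolding M_independent_def boolean_nonsingular_def
  proof (intro exI[of _ "insert r Y"] conjI exI[of _ "Suc n"] exI[of _ "case_nat r f"] exI[of _ "case_nat y g"] allI impI)
    have split: "{..<Suc n} = insert 0 (Suc ` {..<n})"
      by (auto simp: image_iff less_Suc_eq_0_disj)
    show "insert r Y \<subseteq> R" using y Y by simp
    show "bij_betw (case_nat r f) {..<Suc n} (insert r Y)"
      unfolding split using fg(1) rY
      by (auto simp: bij_betw_def inj_on_def image_image)
    show "bij_betw (case_nat y g) {..<Suc n} (X)"
      unfolding split using fg(2) y(1)
      by (auto simp: bij_betw_def inj_on_def image_image)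
    show "M (case_nat r f i) (case_nat y g i)" if "i < Suc n" for i
      using that y(3) diag by (cases i) auto
    show "\<not> M (case_nat r f i) (case_nat y g j)" if "i < j \<and> j < Suc n" for i j
      using that y(4) gin upper by (cases i; cases j) auto
  qed
qed

lemma M_independent_image:
  assumes "M_independent M R X" "inj_on h X" "\<And>x r. x \<in> X \<Longrightarrow> r \<in> R \<Longrightarrow> M r (h x) = M r x"
  shows "M_independent M R (h ` X)"
proof -
  obtain Y where Y: "Y \<subseteq> R" and "boolean_nonsingular M Y X"
    using assms(1) unfolding M_independent_def by blast
  then obtain n :: nat and f g where fg: "bij_betw f {..<n} Y" "bij_betw g {..<n} X"
    and diag: "\<forall>i<n. M (f i) (g i)" and upper: "\<forall>i j. i < j \<and> j < n \<longrightarrow> \<not> M (f i) (g j)"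
    unfolding boolean_nonsingular_def by blast
  have fi: "f i \<in> R" and gi: "g i \<in> X" if "i < n" for i
    using fg Y that by (auto simp: bij_betw_def)
  have eq: "M (f i) ((h \<circ> g) j) = M (f i) (g j)" if "i < n" "j < n" for i j
    using assms(3) fi gi that by simp
  have hg: "bij_betw (h \<circ> g) {..<n} (h ` X)"
    using fg(2) assms(2) by (intro bij_betw_trans[OF fg(2)]) (auto simp: bij_betw_def)
  have "boolean_nonsingular M Y (h ` X)"
    unfolding boolean_nonsingular_def
  proof (intro exI conjI allI impI)
    show "bij_betw f {..<n} Y" "bij_betw (h \<circ> g) {..<n} (h ` X)" by fact+
    show "M (f i) ((h \<circ> g) i)" if "i < n" for i using diag eq that by simp
    show "\<not> M (f i) ((h \<circ> g) j)" if "i < j \<and> j < n" for i j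
      using upper eq[of i j] that by simp
  qed
  with Y show ?thesis unfolding M_independent_def by blast
qed

section \<open>From the matrix to a buildable complex\<close>

theorem buildable_boolean_representable:
  assumes asc: "abstract_simplicial_complex V H" and brep: "boolean_representable V H" and cdim: "complex_dim H = 2"
  shows "buildable H"
proof -
  obtain R :: "nat set" and M where Hdef: "H = {X. X \<subseteq> V \<and> M_independent M R X}"
    using brep unfolding boolean_representable_def by blast
  have V: "finite V" "V \<noteq> {}" "H \<subseteq> Pow V" "\<And>v. v \<in> V \<Longrightarrow> {v} \<in> H"
    and sub: "\<And>I J. I \<in> H \<Longrightarrow> J \<subseteq> I \<Longrightarrow> J \<in> H"
    using asc unfolding abstract_simplicial_complex_def by blast+
  have finH: "finite H" using V by (meson finite_Pow_iff finite_subset)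
  have "{} \<in> H" using V sub by blast
  then have dc: "down_closed H"
    using V sub unfolding down_closed_def by (metis Pow_iff finite_subset subsetD)
  have removeH: "\<exists>y\<in>X. \<exists>r\<in>R. M r y \<and> (\<forall>z\<in>X - {y}. \<not> M r z)" if "X \<in> H" "X \<noteq> {}" for X
    using that M_independent_remove[of X M R] by (auto simp: Hdef)
  have insertH: "insert y X \<in> H" if "X \<in> H" "y \<in> V" "r \<in> R" "M r y" "\<forall>z\<in>X. \<not> M r z" for X y r
  proof -
    have "y \<notin> X" using that by auto
    then have "insert y X - {y} = X" by auto
    then have "M_independent M R (insert y X)"
      using that M_independent_remove[of "insert y X" M R] by (auto simp: Hdef)
    then show ?thesis using that by (auto simp: Hdef)
  qed
  have card_le: "card f \<le> 3" if "f \<in> H" for f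
  proof -
    have "int (card f) - 1 \<le> complex_dim H"
      unfolding complex_dim_def using finH that by (intro Max_ge) auto
    then show ?thesis using cdim by simp
  qed
  obtain F where F: "F \<in> H" "card F = 3"
  proof -
    have "complex_dim H \<in> (\<lambda>I. int (card I) - 1) ` H"
      unfolding complex_dim_def using finH \<open>{} \<in> H\<close> by (intro Max_in) auto
    then show thesis using cdim that by auto
  qed
  define twin where "twin u w \<longleftrightarrow> (\<forall>r\<in>R. M r u = M r w)" for u w
  have edge: "{a, b} \<in> H \<longleftrightarrow> \<not> twin a b" if "a \<in> V" "b \<in> V" "a \<noteq> b" for a b
  proof
    assume "{a, b} \<in> H"
    then obtain y r where "y \<in> {a, b}" "r \<in> R" "M r y" "\<forall>z\<in>{a, b} - {y}. \<not> M r z"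
      using removeH[of "{a, b}"] by blast
    then show "\<not> twin a b" using that(3) by (auto simp: twin_def)
  next
    assume "\<not> twin a b"
    then obtain r where r: "r \<in> R" "M r a \<noteq> M r b" by (auto simp: twin_def)
    show "{a, b} \<in> H"
    proof (cases "M r a")
      case True
      then show ?thesis using insertH[of "{b}" a r] V(4) that r by auto
    next
      case False
      then show ?thesis using insertH[of "{a}" b r] V(4) that r by (auto simp: insert_commute)
    qed
  qed
  define rep where "rep v = (SOME w. w \<in> V \<and> twin v w)" for v
  have rep: "rep v \<in> V" "twin v (rep v)" if "v \<in> V" for v
  proof -
    have "v \<in> V \<and> twin v v" using that by (simp add: twin_def)
    then have "rep v \<in> V \<and> twin v (rep v)" unfolding rep_def by (rule someI)
    then show "rep v \<in> V" "twin v (rep v)" by auto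
  qed
  have rep_eq: "rep u = rep w" if "twin u w" for u w
  proof -
    have "twin u = twin w" using that by (auto simp: twin_def fun_eq_iff)
    then show ?thesis by (simp add: rep_def)
  qed
  define W where "W = rep ` V"
  have WV: "W \<subseteq> V" using rep by (auto simp: W_def)
  have finW: "finite W" using V by (simp add: W_def)
  have W_twin: "a = b" if ab: "a \<in> W" "b \<in> W" "twin a b" for a b
  proof -
    obtain u v where uv: "a = rep u" "b = rep v" "u \<in> V" "v \<in> V" using ab by (auto simp: W_def)
    then have "twin u v" using ab rep(2)[of u] rep(2)[of v] by (simp add: twin_def)
    then show ?thesis using uv rep_eq by simp
  qed
  have W_edge: "{a, b} \<in> H" if "a \<in> W" "b \<in> W" for a b
    using edge[of a b] W_twin[of a b] V(4)[of a] WV that by (cases "a = b") auto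
  \<comment> \<open>The 1 demanded of the row supplies the point off the line that
    \<open>non_tri\<close> asks for.\<close>
  define col where "col a b \<longleftrightarrow> a \<in> W \<and> b \<in> W \<and> a \<noteq> b \<and> (\<exists>r\<in>R. \<not> M r a \<and> \<not> M r b \<and> (\<exists>v\<in>V. M r v))" for a b
  have face: "{u, v, w} \<in> H" if "u \<in> W" "v \<in> W" "w \<in> W" "r \<in> R" "\<not> M r u" "\<not> M r v" "M r w" for u v w r
  proof -
    have "insert w {u, v} \<in> H" using insertH[of "{u, v}" w r] W_edge[of u v] that WV by auto
    then show ?thesis by (simp add: insert_commute)
  qed
  define HW where "HW = {f \<in> H. f \<subseteq> W}"
  obtain o' where "o' \<in> W" using V by (auto simp: W_def)
  interpret collinearity_complex W HW col o'
  proof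
    show "finite W" "o' \<in> W" by fact+
    show "down_closed HW" using dc unfolding down_closed_def HW_def by blast
    show "HW \<subseteq> Pow W" by (auto simp: HW_def)
    show "card f \<le> 3" if "f \<in> HW" for f using that card_le by (auto simp: HW_def)
    show "{a, b} \<in> HW" if "a \<in> W" "b \<in> W" for a b using W_edge that by (auto simp: HW_def)
    show "col b a" if "col a b" for a b using that by (auto simp: col_def)
    show "a \<in> W \<and> b \<in> W \<and> a \<noteq> b" if "col a b" for a b using that by (auto simp: col_def)
    show "{a, b, c} \<in> HW" if ab: "col a b" and ac: "\<not> col a c" "c \<in> W" "c \<noteq> a" for a b c
    proof -
      obtain r v where r: "r \<in> R" "\<not> M r a" "\<not> M r b" "v \<in> V" "M r v" and W: "a \<in> W" "b \<in> W"
        using ab by (auto simp: col_def)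
      then have "M r c" using ac by (auto simp: col_def)
      then show ?thesis using face[of a b c r] r W ac by (auto simp: HW_def)
    qed
    show "col a b \<or> col b c \<or> col a c" if f: "{a, b, c} \<in> HW" "card {a, b, c} = 3" for a b c
    proof -
      have ne: "a \<noteq> b" "b \<noteq> c" "a \<noteq> c" using f(2) by (auto simp: card_insert_if split: if_splits)
      obtain y r where y: "y \<in> {a, b, c}" "r \<in> R" "M r y" "\<forall>z\<in>{a, b, c} - {y}. \<not> M r z"
        using removeH[of "{a, b, c}"] f by (auto simp: HW_def)
      have W: "a \<in> W" "b \<in> W" "c \<in> W" using f by (auto simp: HW_def)
      then have "y \<in> V" using y WV by auto
      then show ?thesis using y W ne unfolding col_def by blast
    qed
    show "\<exists>d. d \<notin> {a, b, c} \<and> {a, b, d} \<in> HW \<and> {b, c, d} \<in> HW \<and> {a, c, d} \<in> HW"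
      if n: "{a, b, c} \<notin> HW" "card {a, b, c} = 3" "col a b \<or> col b c \<or> col a c" "{a, b, c} \<subseteq> W" for a b c
    proof -
      have W: "a \<in> W" "b \<in> W" "c \<in> W" using n by auto
      have nH: "{a, b, c} \<notin> H" using n by (auto simp: HW_def)
      obtain r v where r: "r \<in> R" "v \<in> V" "M r v" and two: "(\<not> M r a \<and> \<not> M r b) \<or> (\<not> M r b \<and> \<not> M r c) \<or> (\<not> M r a \<and> \<not> M r c)"
        using n(3) unfolding col_def by blast
      have perm: "{b, c, a} = {a, b, c}" "{a, c, b} = {a, b, c}" by auto
      \<comment> \<open>A row vanishing on exactly two of the three columns would make the triple a
        face, so this row vanishes on all three.\<close>
      have zero: "\<not> M r a" "\<not> M r b" "\<not> M r c"
        using two face[OF W(1,2,3) r(1)] face[OF W(2,3,1) r(1)] face[OF W(1,3,2) r(1)] nH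
        unfolding perm by blast+
      let ?d = "rep v"
      have d: "?d \<in> W" "M r ?d" using r rep(2)[of v] by (auto simp: W_def twin_def)
      then have "?d \<notin> {a, b, c}" using zero by auto
      moreover have "{a, b, ?d} \<in> HW" "{b, c, ?d} \<in> HW" "{a, c, ?d} \<in> HW"
        using face[OF _ _ d(1) r(1) _ _ d(2)] W zero d by (auto simp: HW_def)
      ultimately show ?thesis by blast
    qed
  qed
  have twins_added: "buildable {f \<in> H. f \<subseteq> W \<union> T}" if "finite T" "T \<subseteq> V - W" for T
    using that
  proof (induction rule: finite_induct)
    case empty
    then show ?case using buildable_H by (simp add: HW_def)
  next
    case (insert x T)
    let ?U = "W \<union> T" and ?a = "rep x"
    have x: "x \<in> V" "x \<notin> W" using insert.prems by auto
    have "?a \<in> W" using x by (simp add: W_def)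
    then have a: "?a \<in> W" "twin x ?a" "?a \<noteq> x" using x rep by auto
    have swap: "insert v' f \<in> H" if f: "insert v f \<in> H" "v' \<in> V" "twin v v'" "v \<notin> f" "v' \<notin> f" for v v' f
    proof -
      let ?h = "\<lambda>u. if u = v then v' else u"
      have "M_independent M R (?h ` insert v f)"
        using f by (intro M_independent_image) (auto simp: Hdef inj_on_def twin_def)
      moreover have "?h ` insert v f = insert v' f" using f by auto
      moreover have "insert v' f \<subseteq> V" using f by (auto simp: Hdef)
      ultimately show ?thesis by (simp add: Hdef)
    qed
    \<comment> \<open>This is where dimension 2 guarantees two twin classes: a face with three
      vertices contains a pair that are not twins. The link of \<open>?a\<close> is thus not empty,
      and \<open>x\<close> can be connected through it.\<close>
    have "\<exists>z\<in>W. z \<noteq> ?a"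
    proof -
      obtain u v w where uv: "F = {u, v, w}" "u \<noteq> v" using F(2) by (auto simp: card_3_iff)
      then have "{u, v} \<in> H" "u \<in> V" "v \<in> V" using F(1) V sub[of F "{u, v}"] by auto
      then have "\<not> twin u v" using edge uv by blast
      then have "rep u \<noteq> rep v" using rep(2)[OF \<open>u \<in> V\<close>] rep(2)[OF \<open>v \<in> V\<close>] by (auto simp: twin_def)
      then show ?thesis using \<open>u \<in> V\<close> \<open>v \<in> V\<close> unfolding W_def by (metis imageI)
    qed
    then obtain z where z: "z \<in> W" "z \<noteq> ?a" by blast
    have "buildable {f \<in> H. f \<subseteq> insert x ?U}"
    proof (rule twin_extension[OF finH dc card_le])
      show "finite ?U" using finW insert.hyps by simp
      show "buildable {f \<in> H. f \<subseteq> ?U}" using insert by simp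
      show "?a \<in> ?U" "x \<notin> ?U" using a x insert.hyps by auto
      show "{x} \<in> H" using V x by blast
      show "{?a, x} \<notin> H" using edge[of ?a x] a x WV by (auto simp: twin_def)
      show "insert x f \<in> H \<longleftrightarrow> insert ?a f \<in> H" if "?a \<notin> f" "x \<notin> f" for f
        using swap[of x f ?a] swap[of ?a f x] a x that WV by (auto simp: twin_def)
      show "z \<in> ?U" "z \<noteq> ?a" "{?a, z} \<in> H" using z a W_edge by auto
    qed
    then show ?case by simp
  qed
  have "W \<union> (V - W) = V" using WV by auto
  then have "{f \<in> H. f \<subseteq> W \<union> (V - W)} = H" using V by auto
  then show ?thesis using twins_added[of "V - W"] V by simp
qed

section \<open>Simplicial homology\<close>

lemma int_poly_mapping_eq_uminusD:
  fixes x :: "'a \<Rightarrow>\<^sub>0 int"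
  assumes "x = - x"
  shows "x = 0"
proof (rule poly_mapping_eqI)
  fix k
  have "Poly_Mapping.lookup x k = - Poly_Mapping.lookup x k" using assms by (metis lookup_uminus)
  then show "Poly_Mapping.lookup x k = Poly_Mapping.lookup 0 k" by simp
qed

text \<open>The augmented complex: \<^const>\<open>face_boundary\<close> maps a vertex to the empty face, and \<open>chains K n\<close>
  consists of the chains of dimension \<open>n - 1\<close>.\<close>

definition chains :: "'a set set \<Rightarrow> nat \<Rightarrow> ('a set \<Rightarrow>\<^sub>0 int) set" where
  "chains K n = {c. Poly_Mapping.keys c \<subseteq> {I \<in> K. card I = n}}"

lemma chains_simps:
  "0 \<in> chains K n" "frag_of I \<in> chains K n \<longleftrightarrow> I \<in> K \<and> card I = n"
  by (auto simp: chains_def)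

lemma chains_add: "c \<in> chains K n \<Longrightarrow> d \<in> chains K n \<Longrightarrow> c + d \<in> chains K n"
  using keys_add[of c d] by (auto simp: chains_def)

lemma chains_diff: "c \<in> chains K n \<Longrightarrow> d \<in> chains K n \<Longrightarrow> c - d \<in> chains K n"
  using keys_diff[of c d] by (auto simp: chains_def)

lemma chains_cmul: "c \<in> chains K n \<Longrightarrow> frag_cmul m c \<in> chains K n"
  using keys_cmul[of m c] by (auto simp: chains_def)

lemma chains_mono: "K \<subseteq> K' \<Longrightarrow> chains K n \<subseteq> chains K' n"
  by (auto simp: chains_def)

lemma chains_not_in: "c \<in> chains K n \<Longrightarrow> I \<notin> K \<or> card I \<noteq> n \<Longrightarrow> Poly_Mapping.lookup c I = 0"
  by (auto simp: chains_def in_keys_iff)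

lemma frag_split_insert:
  assumes "Poly_Mapping.keys c \<subseteq> insert x S"
  obtains d m where "Poly_Mapping.keys d \<subseteq> S" "c = d + frag_cmul m (frag_of x)"
proof -
  define d where "d = c - frag_cmul (Poly_Mapping.lookup c x) (frag_of x)"
  have "Poly_Mapping.lookup d x = 0" by (simp add: d_def lookup_minus)
  then have "x \<notin> Poly_Mapping.keys d" by (simp add: in_keys_iff)
  moreover have "Poly_Mapping.keys d \<subseteq> Poly_Mapping.keys c \<union> {x}"
    unfolding d_def using keys_diff[of c "frag_cmul (Poly_Mapping.lookup c x) (frag_of x)"]
      keys_cmul[of "Poly_Mapping.lookup c x" "frag_of x"] by auto
  ultimately have "Poly_Mapping.keys d \<subseteq> S" using assms by blast
  then show thesis by (rule that[of d "Poly_Mapping.lookup c x"]) (simp add: d_def)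
qed

locale ordered_vertices =
  fixes V :: "'a set" and r :: "'a rel"
  assumes V: "finite V" and r: "linear_order_on V r"
begin

abbreviation bdry :: "('a set \<Rightarrow>\<^sub>0 int) \<Rightarrow> 'a set \<Rightarrow>\<^sub>0 int" where
  "bdry \<equiv> frag_extend (face_boundary r)"

definition position :: "'a set \<Rightarrow> 'a \<Rightarrow> nat" where
  "position I v = card {u \<in> I. u \<noteq> v \<and> (u, v) \<in> r}"

lemma face_boundary_position:
  "face_boundary r I = (\<Sum>v\<in>I. frag_cmul ((-1) ^ position I v) (frag_of (I - {v})))"
  by (simp add: face_boundary_def position_def)

lemma antisym_r: "(u, v) \<in> r \<Longrightarrow> (v, u) \<in> r \<Longrightarrow> u = v"
  using r by (auto simp: linear_order_on_def partial_order_on_def antisym_def)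

lemma total_r: "u \<in> V \<Longrightarrow> v \<in> V \<Longrightarrow> u \<noteq> v \<Longrightarrow> (u, v) \<in> r \<or> (v, u) \<in> r"
  using r by (auto simp: linear_order_on_def total_on_def)

text \<open>Deleting the lower of two vertices shifts the upper one, but not conversely. This single
  shift is the sign that makes the double boundary cancel.\<close>

lemma position_remove_below:
  assumes "finite I" "w \<in> I" "w \<noteq> v" "(w, v) \<in> r"
  shows "position I v = Suc (position (I - {w}) v)" "position (I - {v}) w = position I w"
proof -
  have "{u \<in> I. u \<noteq> v \<and> (u, v) \<in> r} = insert w {u \<in> I - {w}. u \<noteq> v \<and> (u, v) \<in> r}"
    using assms by auto
  then show "position I v = Suc (position (I - {w}) v)"
    using assms by (simp add: position_def)
  have "{u \<in> I - {v}. u \<noteq> w \<and> (u, w) \<in> r} = {u \<in> I. u \<noteq> w \<and> (u, w) \<in> r}"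
    using antisym_r assms by blast
  then show "position (I - {v}) w = position I w" by (simp add: position_def)
qed

text \<open>Deleting two vertices in either order gives opposite terms, so the double sum equals its
  own negative; integer chains have no 2-torsion.\<close>

lemma boundary_boundary_face:
  assumes "I \<subseteq> V"
  shows "bdry (face_boundary r I) = 0"
proof -
  have fin: "finite I" using assms V finite_subset by blast
  define T where "T v w = frag_cmul ((-1) ^ (position I v + position (I - {v}) w)) (frag_of (I - {v} - {w}))" for v w
  have "bdry (face_boundary r I) = (\<Sum>v\<in>I. frag_cmul ((-1) ^ position I v) (face_boundary r (I - {v})))"
    unfolding face_boundary_position[of I] frag_extend_sum[OF fin]
    by (simp add: frag_extend_cmul)
  also have "\<dots> = (\<Sum>v\<in>I. \<Sum>w\<in>I - {v}. T v w)"
    by (simp add: face_boundary_position frag_cmul_sum T_def power_add)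
  also have "\<dots> = (\<Sum>(v, w)\<in>(SIGMA v:I. I - {v}). T v w)"
    using fin by (subst sum.Sigma) auto
  finally have S: "bdry (face_boundary r I) = (\<Sum>(v, w)\<in>(SIGMA v:I. I - {v}). T v w)" .
  have anti: "T w v = - T v w" if "v \<in> I" "w \<in> I" "v \<noteq> w" for v w
  proof -
    have *: "T w v = - T v w" if "v \<in> I" "w \<in> I" "v \<noteq> w" "(w, v) \<in> r" for v w
      using position_remove_below[OF fin, of w v] that
      by (simp add: T_def Diff_insert2[symmetric] insert_commute add.commute)
    then show ?thesis using total_r[of v w] *[of v w] *[of w v] that assms by fastforce
  qed
  have "(\<Sum>(v, w)\<in>(SIGMA v:I. I - {v}). T v w) = (\<Sum>(v, w)\<in>(SIGMA v:I. I - {v}). T w v)"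
    by (rule sum.reindex_bij_witness[of _ prod.swap prod.swap]) auto
  also have "\<dots> = (\<Sum>(v, w)\<in>(SIGMA v:I. I - {v}). - T v w)"
    by (rule sum.cong) (auto intro: anti)
  also have "\<dots> = - (\<Sum>(v, w)\<in>(SIGMA v:I. I - {v}). T v w)"
    by (simp add: case_prod_unfold sum_negf)
  finally show ?thesis
    unfolding S by (rule int_poly_mapping_eq_uminusD)
qed

lemma boundary_boundary:
  assumes "c \<in> chains K n" "K \<subseteq> Pow V"
  shows "bdry (bdry c) = 0"
proof -
  have "Poly_Mapping.keys c \<subseteq> Pow V" using assms by (auto simp: chains_def)
  then show ?thesis
    by (induction rule: frag_induction) (auto simp: frag_extend_diff boundary_boundary_face)
qed

lemma keys_face_boundary: "Poly_Mapping.keys (face_boundary r I) \<subseteq> (\<lambda>v. I - {v}) ` I"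
proof
  fix J assume "J \<in> Poly_Mapping.keys (face_boundary r I)"
  also have "Poly_Mapping.keys (face_boundary r I) \<subseteq>
      (\<Union>v\<in>I. Poly_Mapping.keys (frag_cmul ((-1) ^ position I v) (frag_of (I - {v}))))"
    unfolding face_boundary_position by (rule keys_sum)
  finally obtain v where "v \<in> I" "J \<in> Poly_Mapping.keys (frag_cmul ((-1) ^ position I v) (frag_of (I - {v})))"
    by (rule UN_E)
  then show "J \<in> (\<lambda>v. I - {v}) ` I" by (simp add: keys_frag_of)
qed

lemma face_boundary_chains:
  assumes "card I = Suc n" "proper_faces I \<subseteq> K"
  shows "face_boundary r I \<in> chains K n"
proof -
  have "finite I" using assms(1) by (simp add: card_ge_0_finite)
  then have "I - {v} \<in> K \<and> card (I - {v}) = n" if "v \<in> I" for v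
    using that assms by (simp add: subset_iff_psubset_eq) blast
  then show ?thesis using keys_face_boundary[of I] unfolding chains_def by blast
qed

lemma boundary_chains:
  assumes "down_closed K" "c \<in> chains K (Suc n)"
  shows "bdry c \<in> chains K n"
proof -
  have "Poly_Mapping.keys c \<subseteq> {I \<in> K. card I = Suc n}" using assms by (simp add: chains_def)
  then show ?thesis
  proof (induction rule: frag_induction)
    case (one I)
    then have "proper_faces I \<subseteq> K" using assms down_closedD by blast
    then show ?case using one by (simp add: face_boundary_chains)
  qed (auto simp: chains_simps frag_extend_diff intro: chains_diff)
qed

lemma lookup_face_boundary:
  assumes "finite I" "v \<in> I"
  shows "Poly_Mapping.lookup (face_boundary r I) (I - {v}) = (-1) ^ position I v"
proof -
  have "Poly_Mapping.lookup (face_boundary r I) (I - {v}) =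
      (\<Sum>w\<in>I. (-1) ^ position I w * Poly_Mapping.lookup (frag_of (I - {w})) (I - {v}))"
    by (simp add: face_boundary_position lookup_sum)
  also have "\<dots> = (\<Sum>w\<in>I. if w = v then (-1) ^ position I v else 0)"
  proof (rule sum.cong)
    fix w assume "w \<in> I"
    then have "I - {w} = I - {v} \<longleftrightarrow> w = v" using assms by auto
    then show "(-1) ^ position I w * Poly_Mapping.lookup (frag_of (I - {w})) (I - {v}) =
        (if w = v then (-1) ^ position I v else 0)"
      by auto
  qed simp
  finally show ?thesis using assms by simp
qed

definition cycles :: "'a set set \<Rightarrow> nat \<Rightarrow> ('a set \<Rightarrow>\<^sub>0 int) set" where
  "cycles K n = {c \<in> chains K n. bdry c = 0}"

definition boundaries :: "'a set set \<Rightarrow> nat \<Rightarrow> ('a set \<Rightarrow>\<^sub>0 int) set" where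
  "boundaries K n = bdry ` chains K (Suc n)"

abbreviation combine :: "(('a set \<Rightarrow>\<^sub>0 int) \<Rightarrow>\<^sub>0 int) \<Rightarrow> 'a set \<Rightarrow>\<^sub>0 int" where
  "combine \<equiv> frag_extend (\<lambda>z. z)"

text \<open>A free basis of reduced homology in dimension \<open>n - 1\<close>, given by
  representing cycles: they generate modulo boundaries and satisfy no relation there. Fixing cycles
  instead of an isomorphism type lets the same set be carried along while the complex grows.\<close>

definition homology_basis :: "'a set set \<Rightarrow> nat \<Rightarrow> ('a set \<Rightarrow>\<^sub>0 int) set \<Rightarrow> bool" where
  "homology_basis K n S \<longleftrightarrow> S \<subseteq> cycles K n \<and>
     (\<forall>c\<in>cycles K n. \<exists>f. Poly_Mapping.keys f \<subseteq> S \<and> c - combine f \<in> boundaries K n) \<and>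
     (\<forall>f. Poly_Mapping.keys f \<subseteq> S \<and> combine f \<in> boundaries K n \<longrightarrow> f = 0)"

lemma cycles_diff: "c \<in> cycles K n \<Longrightarrow> d \<in> cycles K n \<Longrightarrow> c - d \<in> cycles K n"
  by (auto simp: cycles_def frag_extend_diff chains_diff)

lemma cycles_cmul: "c \<in> cycles K n \<Longrightarrow> frag_cmul m c \<in> cycles K n"
  by (auto simp: cycles_def frag_extend_cmul chains_cmul)

lemma boundaries_add: "c \<in> boundaries K n \<Longrightarrow> d \<in> boundaries K n \<Longrightarrow> c + d \<in> boundaries K n"
  unfolding boundaries_def by (auto simp: frag_extend_add[symmetric] chains_add)

lemma boundaries_diff: "c \<in> boundaries K n \<Longrightarrow> d \<in> boundaries K n \<Longrightarrow> c - d \<in> boundaries K n"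
  unfolding boundaries_def by (auto simp: frag_extend_diff[symmetric] chains_diff)

lemma boundaries_mono: "K \<subseteq> K' \<Longrightarrow> boundaries K n \<subseteq> boundaries K' n"
  using chains_mono[of K K' "Suc n"] by (auto simp: boundaries_def)

lemma combine_cycles: "Poly_Mapping.keys f \<subseteq> S \<Longrightarrow> S \<subseteq> cycles K n \<Longrightarrow> combine f \<in> cycles K n"
proof (induction rule: frag_induction)
  case zero
  then show ?case by (simp add: cycles_def chains_simps)
qed (auto simp: frag_extend_diff intro: cycles_diff)

lemma face_boundary_vertex: "face_boundary r {v} = frag_of {}"
proof -
  have none: "{u \<in> {v}. u \<noteq> v \<and> (u, v) \<in> r} = {}" by auto
  have "position {v} v = 0" unfolding position_def none by simp
  then show ?thesis by (simp add: face_boundary_position)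
qed

lemma homology_basis_vertex: "homology_basis {{}, {v}} n {}"
proof -
  have "c \<in> boundaries {{}, {v}} n" if c: "c \<in> cycles {{}, {v}} n" for c
  proof -
    have c': "c \<in> chains {{}, {v}} n" "bdry c = 0" using c by (auto simp: cycles_def)
    consider "n = 0" | "n = 1" | "n \<ge> 2" by linarith
    then show ?thesis
    proof cases
      case 1
      then have "Poly_Mapping.keys c \<subseteq> insert {} {}" using c' by (auto simp: chains_def)
      then obtain d m where "Poly_Mapping.keys d \<subseteq> {}" "c = d + frag_cmul m (frag_of {})"
        by (rule frag_split_insert)
      then have "c = bdry (frag_cmul m (frag_of {v}))" by (simp add: frag_extend_cmul face_boundary_vertex)
      moreover have "frag_cmul m (frag_of {v}) \<in> chains {{}, {v}} (Suc n)"
        using 1 by (intro chains_cmul) (simp add: chains_simps)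
      ultimately show ?thesis by (auto simp: boundaries_def)
    next
      case 2
      then have "Poly_Mapping.keys c \<subseteq> insert {v} {}" using c' by (auto simp: chains_def)
      then obtain d m where "Poly_Mapping.keys d \<subseteq> {}" "c = d + frag_cmul m (frag_of {v})"
        by (rule frag_split_insert)
      then have "c = 0" using c'(2) by (auto simp: frag_extend_cmul face_boundary_vertex)
      then show ?thesis unfolding boundaries_def by (auto simp: chains_simps intro!: image_eqI[of _ _ 0])
    next
      case 3
      then have none: "{I \<in> {{}, {v}}. card I = n} = {}" by auto
      have "c = 0" using c'(1) unfolding chains_def none by simp
      then show ?thesis unfolding boundaries_def by (auto simp: chains_simps intro!: image_eqI[of _ _ 0])
    qed
  qed
  then show ?thesis by (auto simp: homology_basis_def intro!: exI[of _ 0])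
qed

text \<open>The elementary collapse induces a chain retraction \<open>\<pi>\<close> with chain homotopy \<open>h\<close>.\<close>

lemma homology_basis_expansion:
  assumes K: "down_closed K" "K \<union> {\<tau>, insert v \<tau>} \<subseteq> Pow V" and free: "free_face K \<tau> v"
    and S: "homology_basis K n S"
  shows "homology_basis (K \<union> {\<tau>, insert v \<tau>}) n S"
proof -
  let ?K' = "K \<union> {\<tau>, insert v \<tau>}" and ?\<sigma> = "insert v \<tau>"
  have \<tau>: "finite \<tau>" "v \<notin> \<tau>" "\<tau> \<notin> K" "\<And>\<rho>. \<rho> \<subset> ?\<sigma> \<Longrightarrow> \<rho> \<noteq> \<tau> \<Longrightarrow> \<rho> \<in> K"
    using free by (auto simp: free_face_def)
  have \<sigma>K: "?\<sigma> \<notin> K" using down_closedD[OF K(1), of ?\<sigma> \<tau>] \<tau> by auto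
  have dc': "down_closed ?K'" using down_closed_expansion[OF K(1) free] .
  define \<epsilon> where "\<epsilon> = ((-1) ^ position ?\<sigma> v :: int)"
  have \<epsilon>: "\<epsilon> * \<epsilon> = 1" by (simp add: \<epsilon>_def flip: power_add)
  have coeff: "Poly_Mapping.lookup (face_boundary r ?\<sigma>) \<tau> = \<epsilon>"
    using lookup_face_boundary[of ?\<sigma> v] \<tau> by (simp add: \<epsilon>_def)
  \<comment> \<open>The incidence number \<epsilon> of \<tau> in its simplex is its own inverse, so
    the boundary of \<open>h (frag_of \<tau>)\<close> contains \<tau> with coefficient 1.
    Subtracting it in \<pi> removes \<tau>.\<close>
  define h where "h = frag_extend (\<lambda>I. if I = \<tau> then frag_cmul \<epsilon> (frag_of ?\<sigma>) else 0)"
  have h_K: "h c = 0" if "c \<in> chains K m" for c m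
    unfolding h_def using that \<tau> by (intro frag_extend_eq_0) (auto simp: chains_def)
  have h_chains: "h c \<in> chains ?K' (Suc m)" if "c \<in> chains ?K' m" for c m
  proof -
    have "Poly_Mapping.keys c \<subseteq> {I \<in> ?K'. card I = m}" using that by (simp add: chains_def)
    then show ?thesis
    proof (induction rule: frag_induction)
      case (one I)
      show ?case
      proof (cases "I = \<tau>")
        case True
        have "frag_of ?\<sigma> \<in> chains ?K' (Suc m)" using one True \<tau>(1,2) by (simp add: chains_simps)
        then show ?thesis using True by (simp add: h_def chains_cmul)
      qed (simp add: h_def chains_simps)
    next
      case (diff a b)
      then show ?case by (simp only: h_def frag_extend_diff chains_diff)
    qed (simp add: h_def chains_simps)
  qed
  define \<pi> where "\<pi> c = c - bdry (h c) - h (bdry c)" for c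
  have \<pi>_diff: "\<pi> (a - b) = \<pi> a - \<pi> b" for a b
    by (simp add: \<pi>_def h_def frag_extend_diff)
  have \<pi>_face: "\<pi> (frag_of I) \<in> chains K (card I)" if I: "I \<in> ?K'" for I
  proof -
    consider "I \<in> K" | "I = \<tau>" | "I = ?\<sigma>" using I by auto
    then show ?thesis
    proof cases
      case 1
      have "proper_faces I \<subseteq> K" using 1 K(1) down_closedD by blast
      have "I \<noteq> \<tau>" using 1 \<tau> by auto
      have "h (face_boundary r I) = 0"
        unfolding h_def
      proof (intro frag_extend_eq_0)
        fix J assume "J \<in> Poly_Mapping.keys (face_boundary r I)"
        then have "J \<in> K" using keys_face_boundary[of I] down_closedD[OF K(1) 1] by blast
        then show "(if J = \<tau> then frag_cmul \<epsilon> (frag_of ?\<sigma>) else 0) = 0" using \<tau> by auto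
      qed
      then have "\<pi> (frag_of I) = frag_of I" using \<open>I \<noteq> \<tau>\<close> by (simp add: \<pi>_def h_def)
      then show ?thesis using 1 by (simp add: chains_simps)
    next
      case 2
      have "h (face_boundary r \<tau>) = 0"
        unfolding h_def
      proof (intro frag_extend_eq_0)
        fix J assume "J \<in> Poly_Mapping.keys (face_boundary r \<tau>)"
        then have "J \<noteq> \<tau>" using keys_face_boundary[of \<tau>] by blast
        then show "(if J = \<tau> then frag_cmul \<epsilon> (frag_of ?\<sigma>) else 0) = 0" by auto
      qed
      then have eq: "\<pi> (frag_of I) = frag_of \<tau> - frag_cmul \<epsilon> (face_boundary r ?\<sigma>)"
        using 2 by (simp add: \<pi>_def h_def frag_extend_cmul)
      have "Poly_Mapping.lookup (\<pi> (frag_of I)) \<tau> = 0"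
        unfolding eq by (simp add: lookup_minus coeff \<epsilon>)
      then have "\<tau> \<notin> Poly_Mapping.keys (\<pi> (frag_of I))" by (simp add: in_keys_iff)
      moreover have "Poly_Mapping.keys (\<pi> (frag_of I)) \<subseteq> {\<tau>} \<union> Poly_Mapping.keys (face_boundary r ?\<sigma>)"
        unfolding eq using keys_diff[of "frag_of \<tau>" "frag_cmul \<epsilon> (face_boundary r ?\<sigma>)"]
          keys_cmul[of \<epsilon> "face_boundary r ?\<sigma>"] by auto
      moreover have "J \<in> K \<and> card J = card \<tau>" if J: "J \<in> Poly_Mapping.keys (face_boundary r ?\<sigma>)" "J \<noteq> \<tau>" for J
      proof -
        obtain w where w: "w \<in> ?\<sigma>" "J = ?\<sigma> - {w}" using subsetD[OF keys_face_boundary J(1)] by (rule imageE)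
        then have "J \<subset> ?\<sigma>" by auto
        moreover have "card J = card \<tau>" using w \<tau> by (simp add: card_Diff_singleton)
        ultimately show ?thesis using \<tau>(4) \<open>J \<noteq> \<tau>\<close> by blast
      qed
      ultimately show ?thesis using 2 unfolding chains_def by blast
    next
      case 3
      have "?\<sigma> \<noteq> \<tau>" using \<tau> by auto
      have "h (face_boundary r ?\<sigma>) = (\<Sum>w\<in>?\<sigma>. frag_cmul ((-1) ^ position ?\<sigma> w) (h (frag_of (?\<sigma> - {w}))))"
        unfolding face_boundary_position using \<tau>(1)
        by (subst h_def) (simp only: frag_extend_sum finite_insert o_def frag_extend_cmul h_def)
      also have "\<dots> = (\<Sum>w\<in>?\<sigma>. if w = v then frag_of ?\<sigma> else 0)"
      proof (rule sum.cong)
        fix w assume "w \<in> ?\<sigma>"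
        then have "?\<sigma> - {w} = \<tau> \<longleftrightarrow> w = v" using \<tau> by auto
        then show "frag_cmul ((-1) ^ position ?\<sigma> w) (h (frag_of (?\<sigma> - {w}))) = (if w = v then frag_of ?\<sigma> else 0)"
          using \<epsilon> by (simp add: h_def \<epsilon>_def)
      qed simp
      also have "\<dots> = frag_of ?\<sigma>" using \<tau> by simp
      finally have "\<pi> (frag_of I) = 0" using 3 \<open>?\<sigma> \<noteq> \<tau>\<close> by (simp add: \<pi>_def h_def)
      then show ?thesis by (simp add: chains_simps)
    qed
  qed
  have \<pi>_chains: "\<pi> c \<in> chains K m" if "c \<in> chains ?K' m" for c m
  proof -
    have "Poly_Mapping.keys c \<subseteq> {I \<in> ?K'. card I = m}" using that by (simp add: chains_def)
    then show ?thesis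
    proof (induction rule: frag_induction)
      case (one I)
      then show ?case using \<pi>_face[of I] by blast
    next
      case zero
      then show ?case by (simp add: \<pi>_def h_def chains_simps)
    qed (auto simp: \<pi>_diff intro: chains_diff)
  qed
  have sub: "K \<subseteq> ?K'" by auto
  have KV: "K \<subseteq> Pow V" using K by auto
  show ?thesis
    unfolding homology_basis_def
  proof (intro conjI ballI allI impI)
    show "S \<subseteq> cycles ?K' n"
      using S chains_mono[OF sub] by (auto simp: homology_basis_def cycles_def)
  next
    fix c assume c: "c \<in> cycles ?K' n"
    then have cc: "c \<in> chains ?K' n" "bdry c = 0" by (auto simp: cycles_def)
    have \<pi>c: "\<pi> c = c - bdry (h c)" using cc by (simp add: \<pi>_def h_def)
    have hb: "bdry (h c) \<in> boundaries ?K' n" using h_chains[OF cc(1)] by (auto simp: boundaries_def)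
    have "bdry (\<pi> c) = 0"
      using boundary_boundary[OF h_chains[OF cc(1)] K(2)] cc by (simp add: \<pi>c frag_extend_diff)
    then have "\<pi> c \<in> cycles K n" using \<pi>_chains[OF cc(1)] by (simp add: cycles_def)
    then obtain f where f: "Poly_Mapping.keys f \<subseteq> S" "\<pi> c - combine f \<in> boundaries K n"
      using S by (auto simp: homology_basis_def)
    have "\<pi> c - combine f + bdry (h c) \<in> boundaries ?K' n"
      using f boundaries_mono[OF sub] hb by (blast intro: boundaries_add)
    then have "c - combine f \<in> boundaries ?K' n" by (simp add: \<pi>c)
    with f show "\<exists>f. Poly_Mapping.keys f \<subseteq> S \<and> c - combine f \<in> boundaries ?K' n" by blast
  next
    fix f assume f: "Poly_Mapping.keys f \<subseteq> S \<and> combine f \<in> boundaries ?K' n"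
    then obtain e where e: "e \<in> chains ?K' (Suc n)" "combine f = bdry e" by (auto simp: boundaries_def)
    have "combine f \<in> cycles K n" using f S combine_cycles by (auto simp: homology_basis_def)
    then have cf: "combine f \<in> chains K n" "bdry (combine f) = 0" by (auto simp: cycles_def)
    \<comment> \<open>The boundary of \<open>e\<close> is a chain of \<open>K\<close>, where
      \<open>h\<close> vanishes, so \<open>\<pi> e\<close> has the same boundary as \<open>e\<close>
      but lies in \<open>K\<close>.\<close>
    have he: "h (bdry e) = 0" using h_K[OF cf(1)] e by simp
    have "bdry (bdry (h e)) = 0" by (rule boundary_boundary[OF h_chains[OF e(1)] K(2)])
    then have "bdry (\<pi> e) = bdry e" using he by (simp add: \<pi>_def frag_extend_diff)
    then have "combine f \<in> boundaries K n"
      using \<pi>_chains[OF e(1)] e(2) by (auto simp: boundaries_def intro!: image_eqI[of _ _ "\<pi> e"])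
    then show "f = 0" using f S by (auto simp: homology_basis_def)
  qed
qed

lemma homology_basis_collapsible:
  assumes "collapsible K" "K \<subseteq> Pow V"
  shows "homology_basis K n {}"
  using assms
proof (induction rule: collapsible.induct)
  case (vertex v)
  then show ?case by (simp add: homology_basis_vertex)
next
  case (expansion K \<tau> v)
  then show ?case using homology_basis_expansion[of K \<tau> v n "{}"] collapsible_down_closed by auto
qed

text \<open>The boundary of \<sigma> is a cycle of the acyclic \<open>Z\<close>, hence the boundary
  of a chain \<open>e\<close> there: no new boundaries arise. The one new cycle is
  \<open>frag_of \<sigma> - e\<close>, and its coefficient 1 at \<sigma>, where all old chains
  vanish, makes it independent of the others.\<close>

lemma homology_basis_attach:
  assumes K: "down_closed K" "insert \<sigma> K \<subseteq> Pow V" and Z: "collapsible Z" "Z \<subseteq> K" "proper_faces \<sigma> \<subseteq> Z"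
    and \<sigma>: "\<sigma> \<notin> K" "card \<sigma> = Suc p" and S: "homology_basis K n S"
  shows "\<exists>S'. homology_basis (insert \<sigma> K) n S' \<and> (n \<noteq> Suc p \<longrightarrow> S' = S)"
proof -
  let ?K' = "insert \<sigma> K"
  have ZV: "Z \<subseteq> Pow V" using Z(2) K(2) by blast
  have fb: "face_boundary r \<sigma> \<in> chains Z p" by (rule face_boundary_chains[OF \<sigma>(2) Z(3)])
  have "bdry (face_boundary r \<sigma>) = 0" using K(2) by (intro boundary_boundary_face) simp
  with fb have "face_boundary r \<sigma> \<in> cycles Z p" by (simp add: cycles_def)
  then have "face_boundary r \<sigma> \<in> boundaries Z p"
    using homology_basis_collapsible[OF Z(1) ZV, of p] by (auto simp: homology_basis_def)
  then obtain e where "e \<in> chains Z (Suc p)" and e: "face_boundary r \<sigma> = bdry e" by (auto simp: boundaries_def)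
  then have eK: "e \<in> chains K (Suc p)" using chains_mono[OF Z(2)] by blast
  have same: "chains ?K' m = chains K m" if "m \<noteq> Suc p" for m
    using that \<sigma> by (auto simp: chains_def)
  have split: "\<exists>d m. d \<in> chains K (Suc p) \<and> c = d + frag_cmul m (frag_of \<sigma>)" if c: "c \<in> chains ?K' (Suc p)" for c
  proof -
    have "Poly_Mapping.keys c \<subseteq> insert \<sigma> {I \<in> K. card I = Suc p}" using c by (auto simp: chains_def)
    then show ?thesis by (rule frag_split_insert) (auto simp: chains_def)
  qed
  have sub: "K \<subseteq> ?K'" by auto
  have bnd: "boundaries ?K' n = boundaries K n"
  proof (cases "n = p")
    case True
    have "bdry c \<in> boundaries K p" if cK: "c \<in> chains ?K' (Suc p)" for c
    proof -
      obtain d m where d: "d \<in> chains K (Suc p)" "c = d + frag_cmul m (frag_of \<sigma>)" using split[OF cK] by blast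
      then have "bdry c = bdry (d + frag_cmul m e)" by (simp add: frag_extend_add frag_extend_cmul e)
      moreover have "d + frag_cmul m e \<in> chains K (Suc p)" using d eK by (intro chains_add chains_cmul)
      ultimately show ?thesis by (auto simp: boundaries_def)
    qed
    then show ?thesis using True boundaries_mono[OF sub, of p] by (auto simp: boundaries_def)
  next
    case False
    then show ?thesis by (simp add: boundaries_def same)
  qed
  show ?thesis
  proof (cases "n = Suc p")
    case False
    then have "cycles ?K' n = cycles K n" by (simp add: cycles_def same)
    then have "homology_basis ?K' n S" using S bnd by (simp add: homology_basis_def)
    then show ?thesis by blast
  next
    case True
    define z where "z = frag_of \<sigma> - e"
    have "bdry z = 0" by (simp add: z_def frag_extend_diff e)
    moreover have "z \<in> chains ?K' n"
      unfolding z_def using True eK \<sigma> chains_mono[OF sub] by (intro chains_diff) (auto simp: chains_simps)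
    ultimately have z: "z \<in> cycles ?K' n" by (simp add: cycles_def)
    have z\<sigma>: "Poly_Mapping.lookup z \<sigma> = 1"
      using chains_not_in[OF eK] \<sigma> by (simp add: z_def lookup_minus)
    have "homology_basis ?K' n (insert z S)"
      unfolding homology_basis_def bnd
    proof (intro conjI ballI allI impI)
      show "insert z S \<subseteq> cycles ?K' n"
        using z S chains_mono[OF sub] by (auto simp: homology_basis_def cycles_def)
    next
      fix c assume c: "c \<in> cycles ?K' n"
      then have "c \<in> chains ?K' (Suc p)" using True by (simp add: cycles_def)
      then obtain d m where d: "d \<in> chains K (Suc p)" "c = d + frag_cmul m (frag_of \<sigma>)"
        using split by blast
      have "c - frag_cmul m z = d + frag_cmul m e"
        unfolding d(2) z_def by (rule poly_mapping_eqI) (simp add: lookup_add lookup_minus algebra_simps)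
      moreover have "d + frag_cmul m e \<in> chains K n" using d eK True by (auto intro!: chains_add chains_cmul)
      moreover have "bdry (c - frag_cmul m z) = 0"
        using cycles_diff[OF c cycles_cmul[OF z]] by (simp add: cycles_def)
      ultimately have "c - frag_cmul m z \<in> cycles K n" by (simp add: cycles_def)
      then obtain f where f: "Poly_Mapping.keys f \<subseteq> S" "c - frag_cmul m z - combine f \<in> boundaries K n"
        using S by (auto simp: homology_basis_def)
      have "combine (f + frag_cmul m (frag_of z)) = combine f + frag_cmul m z"
        by (simp add: frag_extend_add frag_extend_cmul)
      then have "c - combine (f + frag_cmul m (frag_of z)) \<in> boundaries K n"
        using f(2) by (simp add: algebra_simps)
      moreover have "Poly_Mapping.keys (f + frag_cmul m (frag_of z)) \<subseteq> insert z S"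
        using f(1) keys_add[of f "frag_cmul m (frag_of z)"] keys_cmul[of m "frag_of z"] by auto
      ultimately show "\<exists>f. Poly_Mapping.keys f \<subseteq> insert z S \<and> c - combine f \<in> boundaries K n" by blast
    next
      fix f assume f: "Poly_Mapping.keys f \<subseteq> insert z S \<and> combine f \<in> boundaries K n"
      then have "Poly_Mapping.keys f \<subseteq> insert z S" by blast
      then obtain d m where d: "Poly_Mapping.keys d \<subseteq> S" "f = d + frag_cmul m (frag_of z)"
        by (rule frag_split_insert)
      have cd: "combine d \<in> chains K n"
        using combine_cycles[OF d(1)] S by (auto simp: homology_basis_def cycles_def)
      obtain e' where e': "e' \<in> chains K (Suc n)" "combine f = bdry e'" using f by (auto simp: boundaries_def)
      then have "combine f \<in> chains K n" using boundary_chains[OF K(1)] by simp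
      then have "Poly_Mapping.lookup (combine f) \<sigma> = 0" using chains_not_in \<sigma> by blast
      moreover have "Poly_Mapping.lookup (combine d) \<sigma> = 0" using cd chains_not_in \<sigma> by blast
      ultimately have "m = 0"
        by (simp add: d(2) frag_extend_add frag_extend_cmul lookup_add z\<sigma>)
      then have "f = d" using d by simp
      then show "f = 0" using f d S by (auto simp: homology_basis_def)
    qed
    then show ?thesis using True by blast
  qed
qed

text \<open>Since \<open>n\<close> counts vertices, attached edges and triangles contribute at 2 and
  3 only. The emptiness for \<open>n \<le> 1\<close> expresses connectedness, which the unreduced
  group in dimension 0 needs.\<close>

lemma homology_basis_buildable:
  assumes "buildable K" "K \<subseteq> Pow V"
  shows "\<exists>S. homology_basis K n S \<and> (n \<le> 1 \<longrightarrow> S = {})"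
  using assms
proof (induction rule: buildable.induct)
  case (vertex v)
  then show ?case using homology_basis_vertex by blast
next
  case (expansion K \<tau> v)
  then obtain S where "homology_basis K n S" "n \<le> 1 \<longrightarrow> S = {}" by auto
  then show ?case
    using homology_basis_expansion[OF buildable_down_closed[OF expansion.hyps(1)] expansion.prems expansion.hyps(2)]
    by blast
next
  case (attach K Z \<sigma>)
  then obtain S where S: "homology_basis K n S" "n \<le> 1 \<longrightarrow> S = {}" by auto
  obtain p where p: "card \<sigma> = Suc p" "1 \<le> p" using attach.hyps by (cases "card \<sigma>") auto
  have "\<exists>S'. homology_basis (insert \<sigma> K) n S' \<and> (n \<noteq> Suc p \<longrightarrow> S' = S)"
    using homology_basis_attach[OF buildable_down_closed[OF attach.hyps(1)] attach.prems attach.hyps(2,3,4,5) p(1) S(1)] .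
  then show ?case using S(2) p(2) by (metis One_nat_def Suc_le_mono le_zero_eq not_less_eq_eq numeral_2_eq_2 order_trans)
qed

end

section \<open>From a basis of cycles to free homology groups\<close>

text \<open>Evaluation of formal combinations induces the isomorphism onto the quotient. Since
  \<open>free_abelian\<close> takes its index set in the type of the group elements, here sets of
  chains, the basis is indexed by the singletons \<open>{z}\<close>; \<open>up\<close> and
  \<open>down\<close> translate.\<close>

lemma free_abelian_quotient:
  fixes S Z B :: "('a \<Rightarrow>\<^sub>0 int) set"
  defines "comb \<equiv> frag_extend (\<lambda>z::'a \<Rightarrow>\<^sub>0 int. z)"
  assumes Z: "Z \<subseteq> carrier (free_Abelian_group A)" "0 \<in> Z" "\<And>c d. c \<in> Z \<Longrightarrow> d \<in> Z \<Longrightarrow> c - d \<in> Z"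
    and B: "B \<subseteq> Z" "0 \<in> B" "\<And>c d. c \<in> B \<Longrightarrow> d \<in> B \<Longrightarrow> c - d \<in> B"
    and S: "S \<subseteq> Z" "\<And>c. c \<in> Z \<Longrightarrow> \<exists>f. Poly_Mapping.keys f \<subseteq> S \<and> c - comb f \<in> B"
      "\<And>f. Poly_Mapping.keys f \<subseteq> S \<Longrightarrow> comb f \<in> B \<Longrightarrow> f = 0"
  shows "free_abelian (subgroup_generated (free_Abelian_group A) Z Mod B)"
proof -
  let ?F = "free_Abelian_group A" and ?G = "subgroup_generated (free_Abelian_group A) Z"
  interpret F: comm_group ?F by (rule abelian_free_Abelian_group)
  have sub: "subgroup C ?F" if C: "C \<subseteq> Z" "0 \<in> C" "\<And>c d. c \<in> C \<Longrightarrow> d \<in> C \<Longrightarrow> c - d \<in> C" for C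
  proof
    have neg: "- c \<in> C" if "c \<in> C" for c using C(3)[OF C(2) that] by simp
    show "C \<subseteq> carrier ?F" using C Z by blast
    show "c \<otimes>\<^bsub>?F\<^esub> d \<in> C" if "c \<in> C" "d \<in> C" for c d
      using C(3)[OF that(1) neg[OF that(2)]] by simp
    show "\<one>\<^bsub>?F\<^esub> \<in> C" using C by simp
    show "inv\<^bsub>?F\<^esub> c \<in> C" if "c \<in> C" for c
    proof -
      have "c \<in> carrier ?F" using Z(1) C(1) that by blast
      then show ?thesis using neg[OF that] by simp
    qed
  qed
  have carG: "carrier ?G = Z"
    using sub[of Z] Z by (simp add: subgroup.carrier_subgroup_generated_subgroup)
  interpret G: comm_group ?G by (rule F.abelian_subgroup_generated[OF abelian_free_Abelian_group])
  have "subgroup B ?G"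
    using sub[OF B] F.subgroup_subgroup_generated_iff[of B Z] B(1) carG by auto
  then interpret N: normal B ?G by (rule G.subgroup_imp_normal)
  let ?Q = "?G Mod B"
  let ?S = "(\<lambda>z. {z}) ` S" and ?\<Phi> = "\<lambda>f. B #>\<^bsub>?G\<^esub> frag_extend the_elem f"
  have comb_in: "comb f \<in> Z" if "Poly_Mapping.keys f \<subseteq> S" for f
    using that
  proof (induction rule: frag_induction)
    case zero
    then show ?case using Z by (simp add: comb_def)
  next
    case (one z)
    then show ?case using S by (auto simp: comb_def)
  next
    case (diff f g)
    then show ?case using Z by (simp add: comb_def frag_extend_diff)
  qed
  define up where "up = frag_extend (frag_of \<circ> (\<lambda>z :: 'a \<Rightarrow>\<^sub>0 int. {z}))"
  define down where "down = frag_extend (frag_of \<circ> (the_elem :: ('a \<Rightarrow>\<^sub>0 int) set \<Rightarrow> _))"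
  have down: "frag_extend the_elem f = comb (down f)" "Poly_Mapping.keys (down f) \<subseteq> S" "up (down f) = f"
    if f: "Poly_Mapping.keys f \<subseteq> ?S" for f
  proof -
    show "frag_extend the_elem f = comb (down f)"
      using frag_extend_compose[of "\<lambda>z. z" the_elem f] by (simp add: comb_def down_def o_def)
    show "Poly_Mapping.keys (down f) \<subseteq> S"
    proof -
      have "Poly_Mapping.keys (down f) \<subseteq> (\<Union>x\<in>Poly_Mapping.keys f. Poly_Mapping.keys ((frag_of \<circ> the_elem) x))"
        unfolding down_def by (rule keys_frag_extend)
      also have "\<dots> \<subseteq> S" using f by auto
      finally show ?thesis .
    qed
    have "up (down f) = frag_extend ((frag_of \<circ> (\<lambda>z. {z})) \<circ> the_elem) f"
      unfolding up_def down_def by (rule frag_extend_compose)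
    also have "\<dots> = frag_extend frag_of f" using f by (intro frag_extend_eq) auto
    finally show "up (down f) = f" using frag_expansion[of f] by simp
  qed
  have up: "frag_extend the_elem (up f) = comb f" "Poly_Mapping.keys (up f) \<subseteq> ?S"
    if f: "Poly_Mapping.keys f \<subseteq> S" for f
  proof -
    show "frag_extend the_elem (up f) = comb f"
      using frag_extend_compose[of the_elem "\<lambda>z. {z}" f] by (simp add: comb_def up_def o_def)
    show "Poly_Mapping.keys (up f) \<subseteq> ?S"
    proof -
      have "Poly_Mapping.keys (up f) \<subseteq> (\<Union>x\<in>Poly_Mapping.keys f. Poly_Mapping.keys ((frag_of \<circ> (\<lambda>z. {z})) x))"
        unfolding up_def by (rule keys_frag_extend)
      also have "\<dots> \<subseteq> ?S" using f by auto
      finally show ?thesis .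
    qed
  qed
  have ext: "frag_extend the_elem \<in> hom (free_Abelian_group ?S) ?G"
    by (rule homI) (auto simp: carG frag_extend_add down comb_in)
  have "?\<Phi> \<in> hom (free_Abelian_group ?S) ?Q"
    using hom_compose[OF ext N.r_coset_hom_Mod] by (simp add: o_def)
  then interpret \<Phi>: group_hom "free_Abelian_group ?S" ?Q ?\<Phi>
    by (simp add: group_hom_def group_hom_axioms_def N.factorgroup_is_group)
  have "?\<Phi> \<in> iso (free_Abelian_group ?S) ?Q"
    unfolding \<Phi>.iso_iff
  proof (intro conjI ballI impI)
    show "carrier ?Q \<subseteq> ?\<Phi> ` carrier (free_Abelian_group ?S)"
    proof
      fix X assume "X \<in> carrier ?Q"
      then obtain c where c: "c \<in> Z" "X = B #>\<^bsub>?G\<^esub> c" by (auto simp: carrier_FactGroup carG)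
      obtain f where f: "Poly_Mapping.keys f \<subseteq> S" "c - comb f \<in> B" using S(2)[OF c(1)] by blast
      have "c \<in> B #>\<^bsub>?G\<^esub> comb f"
        unfolding r_coset_def using f(2) by (auto intro!: bexI[of _ "c - comb f"])
      then have "X = B #>\<^bsub>?G\<^esub> comb f"
        using G.repr_independence[of c B "comb f"] c comb_in[OF f(1)] N.is_subgroup by (simp add: carG)
      then have "X = ?\<Phi> (up f)" using up(1)[OF f(1)] by simp
      moreover have "up f \<in> carrier (free_Abelian_group ?S)" using up(2)[OF f(1)] by simp
      ultimately show "X \<in> ?\<Phi> ` carrier (free_Abelian_group ?S)" by blast
    qed
    fix f assume f: "f \<in> carrier (free_Abelian_group ?S)" and "?\<Phi> f = \<one>\<^bsub>?Q\<^esub>"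
    then have kS: "Poly_Mapping.keys f \<subseteq> ?S" and "B #>\<^bsub>?G\<^esub> comb (down f) = B" using down by auto
    then have "comb (down f) \<in> B"
      using G.rcos_self[of "comb (down f)" B] comb_in[OF down(2)[OF kS]] N.is_subgroup by (simp add: carG)
    then have "down f = 0" using S(3) down(2)[OF kS] by blast
    then show "f = \<one>\<^bsub>free_Abelian_group ?S\<^esub>" using down(3)[OF kS] by (simp add: up_def)
  qed
  then have "free_Abelian_group ?S \<cong> ?Q" by (auto simp: is_iso_def)
  then have "?Q \<cong> free_Abelian_group ?S" by (rule group.iso_sym[OF group_free_Abelian_group])
  then show ?thesis unfolding free_abelian_def by blast
qed

theorem free_abelian_homology_buildable:
  assumes H: "buildable H" "H \<subseteq> Pow V" "finite V" and r: "linear_order_on V r"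
  shows "free_abelian (simplicial_homology_group r H k)"
proof -
  interpret ordered_vertices V r using H r by unfold_locales
  have dc: "down_closed H" using H buildable_down_closed by blast
  have car: "carrier (simplicial_chain_group H k) = chains H (Suc k)" for k
    by (auto simp: simplicial_chain_group_def chains_def)
  have bd: "simplicial_boundaries r H k = boundaries H (Suc k)" for k
    by (simp add: simplicial_boundaries_def boundaries_def car simplicial_boundary_def[abs_def])
  have cyc: "simplicial_cycles r H k = (if k = 0 then chains H (Suc 0) else cycles H (Suc k))" for k
    by (auto simp: simplicial_cycles_def car cycles_def simplicial_boundary_def)
  let ?Z = "simplicial_cycles r H k" and ?B = "boundaries H (Suc k)"
  have "?B \<subseteq> cycles H (Suc k)"
    using boundary_chains[OF dc] boundary_boundary H(2) by (auto simp: boundaries_def cycles_def)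
  then have BZ: "?B \<subseteq> ?Z" by (auto simp: cyc cycles_def)
  obtain S where S: "S \<subseteq> ?Z" "\<And>c. c \<in> ?Z \<Longrightarrow> \<exists>f. Poly_Mapping.keys f \<subseteq> S \<and> c - combine f \<in> ?B"
    "\<And>f. Poly_Mapping.keys f \<subseteq> S \<Longrightarrow> combine f \<in> ?B \<Longrightarrow> f = 0"
  proof (cases "k = 0")
    case False
    obtain S where "homology_basis H (Suc k) S" using homology_basis_buildable[OF H(1,2)] by blast
    then show thesis using False by (intro that[of S]) (auto simp: cyc homology_basis_def)
  next
    case True
    \<comment> \<open>Unreduced homology in dimension 0 differs from the augmented one: every
      0-chain is a cycle. As the reduced group vanishes, a single vertex represents a basis.\<close>
    have hb: "homology_basis H 1 {}" using homology_basis_buildable[OF H(1,2), of 1] by auto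
    obtain v where v: "{v} \<in> H"
      using H(1) by (induction rule: buildable.induct) auto
    let ?v = "frag_of {v} :: 'a set \<Rightarrow>\<^sub>0 int"
    have vC: "?v \<in> chains H 1" using v by (simp add: chains_simps)
    show thesis
    proof (rule that[of "{?v}"])
      show "{?v} \<subseteq> ?Z" using True vC by (simp add: cyc)
    next
      fix c assume "c \<in> ?Z"
      then have c: "c \<in> chains H (Suc 0)" using True by (simp add: cyc)
      then have "bdry c \<in> chains H 0" by (rule boundary_chains[OF dc])
      moreover have "I = {}" if "I \<in> H" "card I = 0" for I
        using that dc by (auto simp: down_closed_def)
      ultimately have "Poly_Mapping.keys (bdry c) \<subseteq> insert {} {}" by (auto simp: chains_def)
      then obtain d m where "Poly_Mapping.keys d \<subseteq> {}" "bdry c = d + frag_cmul m (frag_of {})"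
        by (rule frag_split_insert)
      then have "bdry (c - frag_cmul m ?v) = 0" by (simp add: frag_extend_diff frag_extend_cmul face_boundary_vertex)
      moreover have "c - frag_cmul m ?v \<in> chains H 1" using c vC by (intro chains_diff chains_cmul) auto
      ultimately have "c - frag_cmul m ?v \<in> cycles H 1" by (simp add: cycles_def)
      then have "c - frag_cmul m ?v \<in> boundaries H 1"
        using hb by (auto simp: homology_basis_def)
      then have "c - combine (frag_cmul m (frag_of ?v)) \<in> ?B" using True by (simp add: frag_extend_cmul)
      moreover have "Poly_Mapping.keys (frag_cmul m (frag_of ?v)) \<subseteq> {?v}" by auto
      ultimately show "\<exists>f. Poly_Mapping.keys f \<subseteq> {?v} \<and> c - combine f \<in> ?B" by blast
    next
      fix f assume f: "Poly_Mapping.keys f \<subseteq> {?v}" "combine f \<in> ?B"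
      obtain d m where "Poly_Mapping.keys d \<subseteq> {}" "f = d + frag_cmul m (frag_of ?v)"
        using frag_split_insert[of f ?v "{}"] f(1) by auto
      then have fm: "f = frag_cmul m (frag_of ?v)" by simp
      \<comment> \<open>The augmentation kills boundaries but sends the vertex to the empty face, so
        it reads off the coefficient \<open>m\<close>, which must be 0.\<close>
      have "bdry (combine f) = 0" using f(2) boundary_boundary H(2) by (auto simp: boundaries_def)
      then show "f = 0" by (simp add: fm frag_extend_cmul face_boundary_vertex)
    qed
  qed
  have "free_abelian (subgroup_generated (free_Abelian_group {I \<in> H. card I = Suc k}) ?Z Mod ?B)"
  proof (rule free_abelian_quotient[OF _ _ _ BZ _ _ S])
    show "?Z \<subseteq> carrier (free_Abelian_group {I \<in> H. card I = Suc k})"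
      using car[of k] by (auto simp: simplicial_cycles_def simplicial_chain_group_def)
    show "0 \<in> ?Z" by (simp add: cyc cycles_def chains_simps)
    show "c - d \<in> ?Z" if "c \<in> ?Z" "d \<in> ?Z" for c d
      using that by (auto simp: cyc intro: chains_diff cycles_diff split: if_splits)
    show "0 \<in> ?B" by (auto simp: boundaries_def chains_simps intro!: image_eqI[of _ _ 0])
    show "c - d \<in> ?B" if "c \<in> ?B" "d \<in> ?B" for c d using that by (rule boundaries_diff)
  qed
  then show ?thesis
    by (simp add: simplicial_homology_group_def simplicial_chain_group_def bd)
qed

theorem theorem3p6:
  fixes V :: "'a set" and H :: "'a set set"
  assumes "abstract_simplicial_complex V H"
    and "boolean_representable V H"
    and "complex_dim H = 2"
  shows "(\<forall>r k. linear_order_on V r \<longrightarrow> free_abelian (simplicial_homology_group r H k)) \<and>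
    (\<exists>N d. (\<forall>i<N. d i \<in> {1, 2}) \<and>
       geometric_realization V H homotopy_equivalent_space wedge_of_spheres N d)"
proof
  have V: "finite V" "H \<subseteq> Pow V"
    using assms(1) by (auto simp: abstract_simplicial_complex_def)
  have H: "buildable H"
    using assms by (rule buildable_boolean_representable)
  show "\<forall>r k. linear_order_on V r \<longrightarrow> free_abelian (simplicial_homology_group r H k)"
    using free_abelian_homology_buildable[OF H V(2,1)] by blast
  show "\<exists>N d. (\<forall>i<N. d i \<in> {1, 2}) \<and>
       geometric_realization V H homotopy_equivalent_space wedge_of_spheres N d"
    using buildable_wedge_of_spheres[OF H V] by blast
qed

end
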